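(* Let $a>1$. Then $N_a(L)/L$ satisfies a large deviations principle on $[0,\infty)$ as $L\to\infty$ with speed $L$ and good rate function $$J_a(x):=\sup_{\theta\in\mathbb R}\{\theta x-\Lambda_a(\theta)\},\qquad x\ge0.$$ That is, $J_a$ is a good rate function on $[0,\infty)$ (lower semicontinuous, $[0,\infty]$-valued, with compact sublevel sets), and for every Borel set $A\subset[0,\infty)$, $$-\inf_{x\in A^\circ}J_a(x)\le\liminf_{L\to\infty}\frac1L\log\mathbb P\left(\frac{N_a(L)}{L}\in A\right)\le\limsup_{L\to\infty}\frac1L\log\mathbb P\left(\frac{N_a(L)}{L}\in A\right)\le-\inf_{x\in\overline A}J_a(x),$$ where $A^\circ$ and $\overline A$ denote the interior and closure of $A$ in the relative topology of $[0,\infty)$. Moreover, $J_a$ is strictly convex on $(0,\infty)$ and vanishes only at $\lambda_a=\frac1{4\pi}\left(1-\frac1a\right)$.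
   Context: Let $\mathbb H=\{z\in\mathbb C:\operatorname{Im}z>0\}$ with planar Lebesgue measure $\mathrm dA$. Let $\mathcal Z$ be the determinantal point process on $(\mathbb H,\mathrm dA)$ with Hermitian correlation kernel $K_{\mathbb H}(z,w)=-\frac{1}{\pi(z-\overline w)^2}$. For $a>1$ and $L>0$ set $N_a(L):=\#\{z\in\mathcal Z:0\le\operatorname{Re}z\le L,\ 1\le\operatorname{Im}z\le a\}$. The function $\Lambda_a$ is the limit $\Lambda_a(\theta)=\lim_{L\to\infty}\frac1L\log\mathbb E\exp(\theta N_a(L))$, $\theta\in\mathbb R$, which exists and equals $$\Lambda_a(\theta)=\frac{1}{2\pi}\int_0^\infty \log\left(1+(e^\theta-1)(e^{-2\xi}-e^{-2a\xi})\right)\,\mathrm d\xi .$$ Convention: $\inf\emptyset=+\infty$. *)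

theory Defs
  imports "HOL-Probability.Probability" "Jordan_Normal_Form.Determinant"
begin

section \<open>Determinantal point processes\<close>

text \<open>A simple point process on the space of \<open>\<mu>\<close>: a random locally finite set of points, measurable
  through its numbers of points in relatively compact Borel sets.\<close>

definition simple_point_process ::
    "'w measure \<Rightarrow> 'a::topological_space measure \<Rightarrow> ('w \<Rightarrow> 'a set) \<Rightarrow> bool" where
  "simple_point_process M \<mu> Z \<longleftrightarrow>
     prob_space M \<and>
     (\<forall>\<omega>\<in>space M. Z \<omega> \<subseteq> space \<mu>) \<and>
     (\<forall>\<omega>\<in>space M. \<forall>C. compact C \<and> C \<subseteq> space \<mu> \<longrightarrow> finite (Z \<omega> \<inter> C)) \<and>
     (\<forall>B\<in>sets \<mu>. (\<exists>C. compact C \<and> C \<subseteq> space \<mu> \<and> B \<subseteq> C) \<longrightarrow>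
        (\<lambda>\<omega>. card (Z \<omega> \<inter> B)) \<in> measurable M (count_space UNIV))"

text \<open>The \<open>n\<close>-point correlation function with respect to \<open>\<mu>\<close> is
  \<open>\<rho>\<^sub>n(x\<^sub>0,\<dots>,x\<^bsub>n-1\<^esub>) = det (K(x\<^sub>i,x\<^sub>j))\<close>:
  for all measurable \<open>f \<ge> 0\<close>, the expected sum of \<open>f\<close> over the \<open>n\<close>-tuples of pairwise distinct points
  of the process is the integral of \<open>f \<rho>\<^sub>n\<close>. The inner integral over a counting measure is this sum.
  For the Hermitian positive semidefinite kernels considered, the determinant is a nonnegative real.\<close>

definition determinantal_process ::
    "'w measure \<Rightarrow> 'a::topological_space measure \<Rightarrow> ('a \<Rightarrow> 'a \<Rightarrow> complex) \<Rightarrow> ('w \<Rightarrow> 'a set) \<Rightarrow> bool" where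
  "determinantal_process M \<mu> K Z \<longleftrightarrow>
     simple_point_process M \<mu> Z \<and>
     (\<forall>n. \<forall>f\<in>borel_measurable (Pi\<^sub>M {..<n} (\<lambda>_. \<mu>)).
        (\<integral>\<^sup>+\<omega>. (\<integral>\<^sup>+x. f x \<partial>count_space {x \<in> {..<n} \<rightarrow>\<^sub>E Z \<omega>. inj_on x {..<n}}) \<partial>M) =
        (\<integral>\<^sup>+x. f x * ennreal (Re (Determinant.det (Matrix.mat n n (\<lambda>(i, j). K (x i) (x j)))))
           \<partial>Pi\<^sub>M {..<n} (\<lambda>_. \<mu>)))"

definition halfplane_measure :: "complex measure" where
  "halfplane_measure = restrict_space lborel {z. Im z > 0}"

definition K_H :: "complex \<Rightarrow> complex \<Rightarrow> complex" where
  "K_H z w = - 1 / (complex_of_real pi * (z - cnj w)^2)"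

definition N_pts :: "('w \<Rightarrow> complex set) \<Rightarrow> real \<Rightarrow> real \<Rightarrow> 'w \<Rightarrow> nat" where
  "N_pts Z a L \<omega> = card {z \<in> Z \<omega>. 0 \<le> Re z \<and> Re z \<le> L \<and> 1 \<le> Im z \<and> Im z \<le> a}"

section \<open>The scaled cumulant generating function and its Legendre transform\<close>

definition Lambda :: "'w measure \<Rightarrow> ('w \<Rightarrow> complex set) \<Rightarrow> real \<Rightarrow> real \<Rightarrow> real" where
  "Lambda M Z a \<theta> =
     Lim at_top (\<lambda>L. 1 / L * ln (\<integral>\<omega>. exp (\<theta> * real (N_pts Z a L \<omega>)) \<partial>M))"

definition J_rate :: "'w measure \<Rightarrow> ('w \<Rightarrow> complex set) \<Rightarrow> real \<Rightarrow> real \<Rightarrow> ereal" where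
  "J_rate M Z a x = (SUP \<theta>. ereal (\<theta> * x - Lambda M Z a \<theta>))"

section \<open>Large deviations\<close>

definition good_rate_function :: "'a::topological_space set \<Rightarrow> ('a \<Rightarrow> ereal) \<Rightarrow> bool" where
  "good_rate_function S I \<longleftrightarrow>
     (\<forall>x\<in>S. 0 \<le> I x) \<and>
     (\<forall>x\<in>S. I x \<le> Liminf (at x within S) I) \<and>
     (\<forall>c::real. compact {x \<in> S. I x \<le> ereal c})"

text \<open>Logarithm of a probability, with \<open>log 0 = -\<infinity>\<close> (whereas \<open>ln 0 = 0\<close> on the reals).\<close>

definition elog :: "real \<Rightarrow> ereal" where
  "elog p = (if p = 0 then -\<infinity> else ereal (ln p))"

text \<open>Large deviations principle on \<open>S\<close> with speed \<open>L\<close> for the family \<open>Y L\<close>, \<open>L \<rightarrow> \<infinity>\<close>; interior and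
  closure are relative to \<open>S\<close>.\<close>

definition large_deviations_principle ::
    "'w measure \<Rightarrow> (real \<Rightarrow> 'w \<Rightarrow> 'a::topological_space) \<Rightarrow> 'a set \<Rightarrow> ('a \<Rightarrow> ereal) \<Rightarrow> bool" where
  "large_deviations_principle M Y S I \<longleftrightarrow>
     (\<forall>A\<in>sets (restrict_space borel S).
        - (INF x\<in>(top_of_set S) interior_of A. I x)
          \<le> Liminf at_top (\<lambda>L. ereal (1 / L) * elog (measure M {\<omega> \<in> space M. Y L \<omega> \<in> A})) \<and>
        Liminf at_top (\<lambda>L. ereal (1 / L) * elog (measure M {\<omega> \<in> space M. Y L \<omega> \<in> A}))
          \<le> Limsup at_top (\<lambda>L. ereal (1 / L) * elog (measure M {\<omega> \<in> space M. Y L \<omega> \<in> A})) \<and>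
        Limsup at_top (\<lambda>L. ereal (1 / L) * elog (measure M {\<omega> \<in> space M. Y L \<omega> \<in> A}))
          \<le> - (INF x\<in>(top_of_set S) closure_of A. I x))"

text \<open>The strict inequality between extended reals forces \<open>f < \<infinity>\<close> in the interior of \<open>S\<close>.\<close>

definition strictly_convex_on :: "real set \<Rightarrow> (real \<Rightarrow> ereal) \<Rightarrow> bool" where
  "strictly_convex_on S f \<longleftrightarrow> convex S \<and>
     (\<forall>x\<in>S. \<forall>y\<in>S. \<forall>t\<in>{0<..<1}. x \<noteq> y \<longrightarrow>
        f ((1 - t) * x + t * y) < ereal (1 - t) * f x + ereal t * f y)"

end

theory Submission
  imports Defs "Jordan_Normal_Form.Schur_Decomposition"
begin

text \<open>By the Gaertner-Ellis argument it suffices that the scaled cumulant generating function converges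
  to a differentiable limit whose Legendre transform is finite on \<open>[0,\<infinity>)\<close>. For
  \<open>t = exp \<theta> - 1\<close>, the expectation of \<open>(1 + t)\<^sup>N\<close> is the Fredholm determinant of the kernel restricted
  to the window. Replacing the window by finitely many points turns it into \<open>det (1 + t A)\<close> with
  \<open>A\<close> Hermitian positive semidefinite, that is, into a product of factors \<open>1 + t l\<close> over the eigenvalues
  \<open>l\<close>. Since the expectation of \<open>(1 + t)\<^sup>N\<close> is positive for all \<open>t > -1\<close>, no eigenvalue
  can exceed \<open>1\<close> in the limit, so Weierstrass approximation of \<open>ln (1 + t x) / x\<close> on a neighbourhood of
  \<open>[0,1]\<close> reduces the logarithm of the determinant to traces of powers of the kernel. Divided by \<open>L\<close>,
  these converge to the corresponding traces per unit length on the whole strip, which are moments of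
  \<open>exp (-2 \<xi>) - exp (-2 a \<xi>)\<close>.\<close>

section \<open>Positive semidefinite matrices and principal minors\<close>

text \<open>Operators and Fredholm determinants enter only through finite Hermitian matrices,
  factorial moments and iterated integrals. Two limits are taken in a fixed order: first the mesh at
  fixed \<open>L\<close>, then \<open>L\<close>. As the mesh shrinks the number of eigenvalues is
  unbounded, while their sum converges to a trace of order \<open>L\<close>. This is why
  \<open>ln (1 + t x) / x\<close> is approximated: an error \<epsilon> there becomes \<epsilon>
  times the trace, uniformly in the mesh and small per unit length. A neighbourhood of
  \<open>[0,1]\<close> is taken because eigenvalues may exceed \<open>1\<close> at a finite mesh;
  for negative \<open>t\<close> it has to stop before the singularity \<open>-1/t\<close>, which
  lies beyond \<open>1\<close>. In a long window a point at a fixed relative position moves away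
  from both ends, so its contribution tends to the diagonal of the strip kernel, which is invariant
  under horizontal translations. The half-line adds a boundary problem: slopes of the limit are only
  known to cover the positive numbers, so the lower bound at \<open>0\<close> is inherited from
  small positive points.\<close>

lemma psd_spectrum:
  fixes A :: "complex mat"
  assumes A: "A \<in> carrier_mat n n"
    and psd: "\<And>v. \<exists>r\<ge>0. (\<Sum>i<n. \<Sum>j<n. cnj (v i) * A $$ (i, j) * v j) = complex_of_real r"
  obtains l :: "nat \<Rightarrow> real" where "\<And>i. i < n \<Longrightarrow> 0 \<le> l i"
    and "\<And>s t :: real. Determinant.det (complex_of_real s \<cdot>\<^sub>m 1\<^sub>m n + complex_of_real t \<cdot>\<^sub>m A) = complex_of_real (\<Prod>i<n. s + t * l i)"
    and "\<And>k. (\<Sum>i<n. (A ^\<^sub>m k) $$ (i, i)) = complex_of_real (\<Sum>i<n. l i ^ k)"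
proof -
  obtain es where es: "char_poly A = (\<Prod> a \<leftarrow> es. [:- a, 1:])" using char_poly_factorized[OF A] by blast
  from schur_decomposition_exists[OF A es] obtain B where B: "B \<in> carrier_mat n n" 
    and ut: "upper_triangular B" and sim: "similar_mat A B" by blast
  from sim obtain P Q where wit: "similar_mat_wit A B P Q" unfolding similar_mat_def by blast
  have dims: "P \<in> carrier_mat n n" "Q \<in> carrier_mat n n" and PQ: "P * Q = 1\<^sub>m n" "Q * P = 1\<^sub>m n" and APBQ: "A = P * B * Q"
    using similar_mat_witD2[OF A wit] by auto
  \<comment> \<open>In an upper triangular form similar to \<open>A\<close> the diagonal lists the
    eigenvalues; \<open>Re\<close> loses nothing once they are shown to be real.\<close>
  define l where "l i = Re (B $$ (i, i))" for i
  have pos: "0 \<le> l i \<and> B $$ (i,i) = complex_of_real (l i)" if i: "i < n" for i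
  proof -
    have "char_poly A = char_poly B" using char_poly_similar[OF sim] .
    also have "\<dots> = (\<Prod> a \<leftarrow> diag_mat B. [:- a, 1:])" using char_poly_upper_triangular[OF B ut] .
    finally have "poly (char_poly A) (B $$ (i,i)) = 0"
      using i B by (auto simp: poly_prod_list prod_list_zero_iff diag_mat_def image_iff intro!: bexI[of _ i])
    hence "eigenvalue A (B $$ (i,i))" using eigenvalue_root_char_poly[OF A] by blast
    then obtain v where v: "v \<in> carrier_vec n" "v \<noteq> 0\<^sub>v n" and ev: "A *\<^sub>v v = B $$ (i,i) \<cdot>\<^sub>v v"
      unfolding eigenvalue_def eigenvector_def using A by auto
    have row: "(\<Sum>j<n. A $$ (k,j) * v $ j) = B $$ (i,i) * v $ k" if k: "k < n" for k
    proof -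
      have "(A *\<^sub>v v) $ k = (B $$ (i,i) \<cdot>\<^sub>v v) $ k" by (simp add: ev)
      thus ?thesis using k A v(1) by (simp add: scalar_prod_def lessThan_atLeast0)
    qed
    \<comment> \<open>Pairing the eigenvector equation with \<open>cnj v\<close> gives
      \<open>r = B $$ (i,i) * |v|^2\<close>, so the eigenvalue is a quotient of nonnegative
      reals.\<close>
    obtain r where r: "r \<ge> 0" "(\<Sum>k<n. \<Sum>j<n. cnj (v $ k) * A $$ (k, j) * v $ j) = complex_of_real r"
      using psd[of "\<lambda>i. v $ i"] by blast
    have "complex_of_real r = (\<Sum>k<n. cnj (v $ k) * (\<Sum>j<n. A $$ (k, j) * v $ j))"
      unfolding r(2)[symmetric] by (simp add: sum_distrib_left mult.assoc)
    also have "\<dots> = (\<Sum>k<n. cnj (v $ k) * (B $$ (i,i) * v $ k))"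
      by (intro sum.cong refl arg_cong2[where f = "(*)"] row) auto
    also have "\<dots> = (\<Sum>k<n. B $$ (i,i) * complex_of_real ((cmod (v $ k))\<^sup>2))"
      by (simp only: complex_norm_square mult_ac)
    also have "\<dots> = B $$ (i,i) * complex_of_real (\<Sum>k<n. (cmod (v $ k))\<^sup>2)"
      by (simp add: sum_distrib_left)
    finally have eq: "complex_of_real r = B $$ (i,i) * complex_of_real (\<Sum>k<n. (cmod (v $ k))\<^sup>2)" .
    have "(\<Sum>k<n. (cmod (v $ k))\<^sup>2) \<noteq> 0"
    proof
      assume "(\<Sum>k<n. (cmod (v $ k))\<^sup>2) = 0"
      hence "\<forall>k<n. v $ k = 0" by (simp add: sum_nonneg_eq_0_iff)
      hence "v = 0\<^sub>v n" using v(1) by (intro eq_vecI) auto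
      with v(2) show False by simp
    qed
    hence gt: "(\<Sum>k<n. (cmod (v $ k))\<^sup>2) > 0" by (simp add: less_le sum_nonneg)
    hence "B $$ (i,i) = complex_of_real r / complex_of_real (\<Sum>k<n. (cmod (v $ k))\<^sup>2)"
      unfolding eq by (intro nonzero_mult_div_cancel_right[symmetric]) (simp only: of_real_eq_0_iff)
    hence "B $$ (i,i) = complex_of_real (r / (\<Sum>k<n. (cmod (v $ k))\<^sup>2))" by (simp only: of_real_divide)
    thus ?thesis using r(1) gt by (simp add: l_def)
  qed
  \<comment> \<open>Affine functions of the matrix respect the similarity. Both coefficients are
    kept for two uses: \<open>s = 0\<close>, \<open>t = 1\<close> gives the determinant itself,
    \<open>s = 1\<close> the generating function in \<open>t\<close>.\<close>
  have det: "Determinant.det (complex_of_real s \<cdot>\<^sub>m 1\<^sub>m n + complex_of_real t \<cdot>\<^sub>m A) = complex_of_real (\<Prod>i<n. s + t * l i)" for s t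
  proof -
    let ?f = "\<lambda>X. complex_of_real s \<cdot>\<^sub>m 1\<^sub>m n + complex_of_real t \<cdot>\<^sub>m X"
    have "?f A = P * ?f B * Q"
    proof -
      have "P * ?f B * Q = P * (complex_of_real s \<cdot>\<^sub>m 1\<^sub>m n) * Q + P * (complex_of_real t \<cdot>\<^sub>m B) * Q"
        using dims B by (simp add: mult_add_distrib_mat[of _ n n _ n] add_mult_distrib_mat[of _ n n _ _ n])
      also have "P * (complex_of_real s \<cdot>\<^sub>m 1\<^sub>m n) * Q = complex_of_real s \<cdot>\<^sub>m 1\<^sub>m n"
        using dims PQ by (simp add: mult_smult_distrib[of _ n n _ n] mult_smult_assoc_mat[of _ n n _ n])
      also have "P * (complex_of_real t \<cdot>\<^sub>m B) * Q = complex_of_real t \<cdot>\<^sub>m A"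
        using dims B by (simp add: APBQ mult_smult_distrib[of _ n n _ n] mult_smult_assoc_mat[of _ n n _ n])
      finally show ?thesis by simp
    qed
    hence "similar_mat (?f A) (?f B)"
      using dims PQ A B by (intro similar_matI[of _ _ P Q n]) auto
    hence "Determinant.det (?f A) = Determinant.det (?f B)" by (rule det_similar)
    also have "\<dots> = prod_list (diag_mat (?f B))"
      using B upper_triangularD[OF ut] by (intro det_upper_triangular[of _ n] upper_triangularI) auto
    also have "\<dots> = (\<Prod>i<n. ?f B $$ (i,i))"
      using B unfolding diag_mat_def by (simp add: prod.distinct_set_conv_list[symmetric] lessThan_atLeast0)
    also have "\<dots> = (\<Prod>i<n. complex_of_real (s + t * l i))"
      using B pos by (intro prod.cong refl) auto
    finally show ?thesis by simp
  qed
  have tr: "(\<Sum>i<n. (A ^\<^sub>m k) $$ (i, i)) = complex_of_real (\<Sum>i<n. l i ^ k)" for k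
  proof -
    have Bk: "B ^\<^sub>m k \<in> carrier_mat n n" using B by simp
    \<comment> \<open>Triangularity is carried along in the induction because only then is a
      diagonal entry of the product the product of the diagonal entries.\<close>
    have utk: "upper_triangular (B ^\<^sub>m k) \<and> (\<forall>i<n. (B ^\<^sub>m k) $$ (i,i) = (B $$ (i,i)) ^ k)"
    proof (induction k)
      case 0 show ?case using B by auto
    next
      case (Suc k)
      have C: "B ^\<^sub>m k \<in> carrier_mat n n" using B by simp
      have ij: "(B ^\<^sub>m Suc k) $$ (i,j) = (\<Sum>m\<in>{0..<n}. (B ^\<^sub>m k) $$ (i,m) * B $$ (m,j))" if "i < n" "j < n" for i j
        using that B C by (simp add: scalar_prod_def)
      have "(B ^\<^sub>m Suc k) $$ (i,j) = 0" if "j < i" "i < n" for i j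
      proof -
        have "(B ^\<^sub>m k) $$ (i,m) * B $$ (m,j) = 0" if "m < n" for m
        proof (cases "m < i")
          case True thus ?thesis using Suc C \<open>i < n\<close> by (auto elim: upper_triangularD)
        next
          case False thus ?thesis using upper_triangularD[OF ut, of j m] B \<open>j < i\<close> \<open>m < n\<close> by simp
        qed
        thus ?thesis using that ij[of i j] by (auto intro!: sum.neutral)
      qed
      moreover have "(B ^\<^sub>m Suc k) $$ (i,i) = (B $$ (i,i)) ^ Suc k" if "i < n" for i
      proof -
        have "(B ^\<^sub>m k) $$ (i,m) * B $$ (m,i) = 0" if "m < n" "m \<noteq> i" for m
        proof (cases "m < i")
          case True thus ?thesis using Suc C \<open>i < n\<close> by (auto elim: upper_triangularD)
        next
          case False thus ?thesis using upper_triangularD[OF ut, of i m] B that by simp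
        qed
        hence "(\<Sum>m\<in>{0..<n}. (B ^\<^sub>m k) $$ (i,m) * B $$ (m,i)) = (\<Sum>m\<in>{i}. (B ^\<^sub>m k) $$ (i,m) * B $$ (m,i))"
          using that by (intro sum.mono_neutral_right) auto
        thus ?thesis using ij[of i i] that Suc by simp
      qed
      ultimately show ?case using C B by (auto intro!: upper_triangularI)
    qed
    have ent: "(X * Y) $$ (i, j) = (\<Sum>m<n. X $$ (i, m) * Y $$ (m, j))"
      if "X \<in> carrier_mat n n" "Y \<in> carrier_mat n n" "i < n" "j < n" for X Y :: "complex mat" and i j
      using that by (simp add: scalar_prod_def lessThan_atLeast0)
    have PB: "P * B ^\<^sub>m k \<in> carrier_mat n n" using dims Bk by simp
    have "(\<Sum>i<n. (A ^\<^sub>m k) $$ (i, i)) = (\<Sum>i<n. \<Sum>j<n. (\<Sum>m<n. P $$ (i,m) * (B ^\<^sub>m k) $$ (m,j)) * Q $$ (j,i))"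
      unfolding similar_mat_wit_pow_id[OF wit] using dims Bk PB by (simp add: ent del: assoc_mult_mat index_mult_mat)
    also have "\<dots> = (\<Sum>i<n. \<Sum>j<n. \<Sum>m<n. P $$ (i,m) * (B ^\<^sub>m k) $$ (m,j) * Q $$ (j,i))"
      by (simp add: sum_distrib_right)
    also have "\<dots> = (\<Sum>j<n. \<Sum>i<n. \<Sum>m<n. P $$ (i,m) * (B ^\<^sub>m k) $$ (m,j) * Q $$ (j,i))"
      by (rule sum.swap)
    also have "\<dots> = (\<Sum>j<n. \<Sum>m<n. \<Sum>i<n. P $$ (i,m) * (B ^\<^sub>m k) $$ (m,j) * Q $$ (j,i))"
      by (rule sum.cong[OF refl], rule sum.swap)
    \<comment> \<open>Cyclicity of the trace, written in entries: the sum over \<open>i\<close>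
      closes up to \<open>Q * P = 1\<close>.\<close>
    also have "\<dots> = (\<Sum>j<n. \<Sum>m<n. (B ^\<^sub>m k) $$ (m,j) * (Q * P) $$ (j,m))"
      using dims by (simp add: ent sum_distrib_left mult_ac del: index_mult_mat)
    also have "\<dots> = (\<Sum>j<n. \<Sum>m<n. if m = j then (B ^\<^sub>m k) $$ (m,j) else 0)"
      unfolding PQ by (intro sum.cong refl) auto
    also have "\<dots> = (\<Sum>j<n. complex_of_real (l j ^ k))"
      using utk pos by (intro sum.cong refl) (auto simp: sum.delta)
    finally show ?thesis by simp
  qed
  show thesis by (rule that[of l]) (use pos det tr in auto)
qed

section \<open>The finite Fredholm expansion of \<open>det (1 + t A)\<close>\<close>

lemma card_inj_PiE:
  assumes "finite S"
  shows "card {x \<in> {..<n::nat} \<rightarrow>\<^sub>E S. inj_on x {..<n}} = fact n * (card S choose n)"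
proof (induction n)
  case 0
  have "{x \<in> {..<0::nat} \<rightarrow>\<^sub>E S. inj_on x {..<0}} = {\<lambda>_. undefined}" by auto
  thus ?case by simp
next
  case (Suc n)
  let ?X = "\<lambda>n. {x \<in> {..<n::nat} \<rightarrow>\<^sub>E S. inj_on x {..<n}}"
  have fin: "finite (?X n)" for n
    by (rule finite_subset[of _ "{..<n} \<rightarrow>\<^sub>E S"]) (auto intro!: finite_PiE simp: assms)
  \<comment> \<open>An injective tuple of length \<open>n + 1\<close> is one of length
    \<open>n\<close> together with a last value outside its range.\<close>
  have "bij_betw (\<lambda>(x, s). x(n := s)) (SIGMA x:?X n. S - x ` {..<n}) (?X (Suc n))"
  proof (rule bij_betw_byWitness[where f' = "\<lambda>x. (restrict x {..<n}, x n)"])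
    show "\<forall>a\<in>SIGMA x:?X n. S - x ` {..<n}. (\<lambda>x. (restrict x {..<n}, x n)) ((\<lambda>(x, s). x(n := s)) a) = a"
      by (auto simp: fun_eq_iff PiE_def extensional_def)
    show "\<forall>a'\<in>?X (Suc n). (\<lambda>(x, s). x(n := s)) ((\<lambda>x. (restrict x {..<n}, x n)) a') = a'"
      by (auto simp: fun_eq_iff PiE_def extensional_def)
    show "(\<lambda>(x, s). x(n := s)) ` (SIGMA x:?X n. S - x ` {..<n}) \<subseteq> ?X (Suc n)"
      by (auto simp: PiE_def extensional_def lessThan_Suc Pi_def inj_on_def image_def split: if_splits)
    show "(\<lambda>x. (restrict x {..<n}, x n)) ` ?X (Suc n) \<subseteq> (SIGMA x:?X n. S - x ` {..<n})"
      by (auto simp: PiE_def lessThan_Suc Pi_def inj_on_def)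
  qed
  hence "card (?X (Suc n)) = card (SIGMA x:?X n. S - x ` {..<n})" by (simp add: bij_betw_same_card)
  also have "\<dots> = (\<Sum>x\<in>?X n. card (S - x ` {..<n}))" using fin assms by (simp add: card_SigmaI)
  also have "\<dots> = (\<Sum>x\<in>?X n. card S - n)"
  proof (rule sum.cong[OF refl])
    fix x assume "x \<in> ?X n"
    hence "x ` {..<n} \<subseteq> S" "card (x ` {..<n}) = n" by (auto simp: card_image)
    thus "card (S - x ` {..<n}) = card S - n" using assms by (simp add: card_Diff_subset finite_subset)
  qed
  also have "\<dots> = fact n * (card S choose n) * (card S - n)" using Suc by simp
  also have "\<dots> = fact n * (Suc n * (card S choose Suc n))"
    by (simp only: binomial_absorption binomial_absorb_comp[symmetric] mult_ac)
  also have "\<dots> = fact (Suc n) * (card S choose Suc n)" by (simp add: algebra_simps)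
  finally show ?case .
qed

text \<open>The sign of a permutation does not depend on an order of the indices, so a minor can be
  attached to any finite index set without enumerating it.\<close>

definition principal_minor :: "('a \<Rightarrow> 'a \<Rightarrow> 'b::comm_ring_1) \<Rightarrow> 'a set \<Rightarrow> 'b" where
  "principal_minor A S = (\<Sum>p | p permutes S. of_int (sign p) * (\<Prod>i\<in>S. A i (p i)))"

text \<open>In the Leibniz formula each factor of \<open>1 + t A\<close> is split; \<open>S\<close>
  collects the indices that choose the entry of \<open>A\<close>. The identity part forces
  \<open>p\<close> to fix all other indices, which leaves exactly the permutations of
  \<open>S\<close>.\<close>

lemma det_one_plus_smult:
  fixes A :: "'a::comm_ring_1 mat"
  assumes A: "A \<in> carrier_mat d d"
  shows "Determinant.det (1\<^sub>m d + t \<cdot>\<^sub>m A) = (\<Sum>S\<in>Pow {0..<d}. t ^ card S * principal_minor (\<lambda>i j. A $$ (i, j)) S)"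
proof -
  let ?U = "{0..<d}"
  let ?g = "\<lambda>p i. if p i = i then 1 else (0::'a)"
  have "Determinant.det (1\<^sub>m d + t \<cdot>\<^sub>m A) = (\<Sum>p | p permutes ?U. of_int (sign p) * (\<Prod>i\<in>?U. (1\<^sub>m d + t \<cdot>\<^sub>m A) $$ (i, p i)))"
    using A by (simp add: Determinant.det_def)
  also have "\<dots> = (\<Sum>p | p permutes ?U. of_int (sign p) * (\<Prod>i\<in>?U. t * A $$ (i, p i) + ?g p i))"
  proof (intro sum.cong refl arg_cong2[where f = "(*)"] prod.cong)
    fix p i assume "p \<in> {p. p permutes ?U}" "i \<in> ?U"
    moreover from this have "p i \<in> ?U" by (simp add: permutes_in_image)
    ultimately show "(1\<^sub>m d + t \<cdot>\<^sub>m A) $$ (i, p i) = t * A $$ (i, p i) + ?g p i" using A by auto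
  qed
  also have "\<dots> = (\<Sum>p | p permutes ?U. \<Sum>S\<in>Pow ?U. of_int (sign p) * ((\<Prod>i\<in>S. t * A $$ (i, p i)) * (\<Prod>i\<in>?U-S. ?g p i)))"
    by (simp add: prod_add sum_distrib_left)
  also have "\<dots> = (\<Sum>S\<in>Pow ?U. \<Sum>p | p permutes ?U. of_int (sign p) * ((\<Prod>i\<in>S. t * A $$ (i, p i)) * (\<Prod>i\<in>?U-S. ?g p i)))"
    by (rule sum.swap)
  also have "\<dots> = (\<Sum>S\<in>Pow ?U. t ^ card S * principal_minor (\<lambda>i j. A $$ (i, j)) S)"
  proof (rule sum.cong[OF refl])
    fix S assume S: "S \<in> Pow ?U"
    have "(\<Sum>p | p permutes ?U. of_int (sign p) * ((\<Prod>i\<in>S. t * A $$ (i, p i)) * (\<Prod>i\<in>?U-S. ?g p i)))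
        = (\<Sum>p | p permutes S. of_int (sign p) * (t ^ card S * (\<Prod>i\<in>S. A $$ (i, p i))))"
    proof (rule sum.mono_neutral_cong_right)
      show "finite {p. p permutes ?U}" by (simp add: finite_permutations)
      show "{p. p permutes S} \<subseteq> {p. p permutes ?U}" using S by (auto intro: permutes_subset)
      show "\<forall>p\<in>{p. p permutes ?U} - {p. p permutes S}. of_int (sign p) * ((\<Prod>i\<in>S. t * A $$ (i, p i)) * (\<Prod>i\<in>?U-S. ?g p i)) = 0"
      proof
        fix p assume "p \<in> {p. p permutes ?U} - {p. p permutes S}"
        hence p: "p permutes ?U" "\<not> p permutes S" by auto
        have "\<exists>i\<in>?U - S. p i \<noteq> i"
        proof (rule ccontr)
          assume "\<not> ?thesis"
          hence "p permutes S" using p(1) S by (intro permutes_superset[OF p(1)]) auto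
          with p(2) show False ..
        qed
        hence "(\<Prod>i\<in>?U-S. ?g p i) = 0" by (intro prod_zero) auto
        thus "of_int (sign p) * ((\<Prod>i\<in>S. t * A $$ (i, p i)) * (\<Prod>i\<in>?U-S. ?g p i)) = 0" by simp
      qed
      fix p assume "p \<in> {p. p permutes S}"
      hence "p permutes S" by simp
      hence "(\<Prod>i\<in>?U-S. ?g p i) = 1" by (intro prod.neutral) (auto simp: permutes_not_in)
      thus "of_int (sign p) * ((\<Prod>i\<in>S. t * A $$ (i, p i)) * (\<Prod>i\<in>?U-S. ?g p i)) = of_int (sign p) * (t ^ card S * (\<Prod>i\<in>S. A $$ (i, p i)))"
        by (simp add: prod.distrib)
    qed
    thus "(\<Sum>p | p permutes ?U. of_int (sign p) * ((\<Prod>i\<in>S. t * A $$ (i, p i)) * (\<Prod>i\<in>?U-S. ?g p i))) = t ^ card S * principal_minor (\<lambda>i j. A $$ (i, j)) S"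
      by (simp add: principal_minor_def sum_distrib_left mult.left_commute)
  qed
  finally show ?thesis .
qed

text \<open>Conjugation by \<open>x\<close> matches the permutations of the positions with those of
  the image and keeps their signs.\<close>

lemma det_eq_principal_minor:
  assumes inj: "inj_on x {..<n}"
  shows "Determinant.det (mat n n (\<lambda>(i, j). A (x i) (x j))) = principal_minor A (x ` {..<n})"
proof -
  have bij: "bij_betw x {..<n} (x ` {..<n})" using inj by (simp add: bij_betw_def)
  let ?y = "inv_into {..<n} x"
  have bij': "bij_betw ?y (x ` {..<n}) {..<n}" using bij by (rule bij_betw_inv_into)
  have "Determinant.det (mat n n (\<lambda>(i, j). A (x i) (x j))) = (\<Sum>p | p permutes {..<n}. of_int (sign p) * (\<Prod>i\<in>{..<n}. A (x i) (x (p i))))"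
    unfolding Determinant.det_def lessThan_atLeast0 dim_row_mat dim_col_mat if_True simp_thms
  proof (intro sum.cong refl arg_cong2[where f = "(*)"] prod.cong)
    fix p i assume p: "p \<in> {p. p permutes {0..<n}}" and i: "i \<in> {0..<n}"
    hence "p i < n" using permutes_in_image[of p "{0..<n}" i] by simp
    thus "mat n n (\<lambda>(i, j). A (x i) (x j)) $$ (i, p i) = A (x i) (x (p i))" using i by simp
  qed
  also have "\<dots> = principal_minor A (x ` {..<n})"
    unfolding principal_minor_def
  proof (rule sum.reindex_bij_witness[of _ "map_permutation (x ` {..<n}) ?y" "map_permutation {..<n} x"])
    fix p assume "p \<in> {p. p permutes {..<n}}"
    hence p: "p permutes {..<n}" by simp
    show "map_permutation (x ` {..<n}) ?y (map_permutation {..<n} x p) = p"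
      by (rule map_permutation_compose_inv[OF bij p]) (use inj in auto)
    show "map_permutation {..<n} x p \<in> {p. p permutes x ` {..<n}}"
      using map_permutation_permutes[OF bij p] by simp
    show "of_int (sign (map_permutation {..<n} x p)) * (\<Prod>i\<in>x ` {..<n}. A i (map_permutation {..<n} x p i)) =
        of_int (sign p) * (\<Prod>i\<in>{..<n}. A (x i) (x (p i)))"
      using inj p by (simp add: sign_map_permutation prod.reindex map_permutation_apply)
  next
    fix p assume "p \<in> {p. p permutes x ` {..<n}}"
    hence p: "p permutes x ` {..<n}" by simp
    show "map_permutation {..<n} x (map_permutation (x ` {..<n}) ?y p) = p"
      by (rule map_permutation_compose_inv[OF bij' p]) (auto simp: f_inv_into_f)
    show "map_permutation (x ` {..<n}) ?y p \<in> {p. p permutes {..<n}}"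
      using map_permutation_permutes[OF bij' p] by simp
  qed
  finally show ?thesis .
qed

lemma det_eq_0_if_not_inj:
  assumes "\<not> inj_on x {..<n}"
  shows "Determinant.det (mat n n (\<lambda>(i, j). A (x i) (x j))) = (0::'a::comm_ring_1)"
proof -
  from assms obtain i j where "i < n" "j < n" "i \<noteq> j" "x i = x j" by (auto simp: inj_on_def)
  thus ?thesis by (intro det_identical_rows[of _ n i j]) auto
qed

text \<open>Tuples with a repetition give equal rows and vanish; every \<open>n\<close>-element set
  is enumerated by \<open>n!\<close> injective tuples.\<close>

lemma sum_det_eq_principal_minors:
  fixes A :: "'b \<Rightarrow> 'b \<Rightarrow> 'a::field_char_0"
  assumes X: "finite X"
  shows "(\<Sum>x\<in>{..<n} \<rightarrow>\<^sub>E X. Determinant.det (mat n n (\<lambda>(i, j). A (x i) (x j)))) =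
    fact n * (\<Sum>S | S \<subseteq> X \<and> card S = n. principal_minor A S)"
proof -
  let ?I = "{x \<in> {..<n} \<rightarrow>\<^sub>E X. inj_on x {..<n}}"
  let ?T = "{S. S \<subseteq> X \<and> card S = n}"
  have finT: "finite ?T" by (rule finite_subset[of _ "Pow X"]) (auto simp: X)
  have finI: "finite ?I" by (rule finite_subset[of _ "{..<n} \<rightarrow>\<^sub>E X"]) (auto intro!: finite_PiE simp: X)
  have "(\<Sum>x\<in>{..<n} \<rightarrow>\<^sub>E X. Determinant.det (mat n n (\<lambda>(i, j). A (x i) (x j)))) = (\<Sum>x\<in>?I. principal_minor A (x ` {..<n}))"
  proof (rule sum.mono_neutral_cong_right)
    show "finite ({..<n} \<rightarrow>\<^sub>E X)" by (intro finite_PiE) (auto simp: X)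
    show "\<forall>x\<in>({..<n} \<rightarrow>\<^sub>E X) - ?I. Determinant.det (mat n n (\<lambda>(i, j). A (x i) (x j))) = 0"
      by (intro ballI det_eq_0_if_not_inj) simp
    show "Determinant.det (mat n n (\<lambda>(i, j). A (x i) (x j))) = principal_minor A (x ` {..<n})" if "x \<in> ?I" for x
      using that by (intro det_eq_principal_minor) simp
  qed simp
  also have "\<dots> = (\<Sum>S\<in>?T. \<Sum>x | x \<in> ?I \<and> x ` {..<n} = S. principal_minor A (x ` {..<n}))"
    by (rule sum.group[symmetric]) (use finI finT in \<open>force simp: card_image\<close>)+
  also have "\<dots> = (\<Sum>S\<in>?T. fact n * principal_minor A S)"
  proof (rule sum.cong[OF refl])
    fix S assume S: "S \<in> ?T"
    hence finS: "finite S" using X finite_subset by blast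
    have "{x. x \<in> ?I \<and> x ` {..<n} = S} = {x \<in> {..<n} \<rightarrow>\<^sub>E S. inj_on x {..<n}}"
    proof (intro equalityI subsetI)
      fix x assume "x \<in> {x \<in> {..<n} \<rightarrow>\<^sub>E S. inj_on x {..<n}}"
      moreover from this have "x ` {..<n} = S" using S finS
        by (intro card_subset_eq) (auto simp: card_image)
      moreover have "{..<n} \<rightarrow>\<^sub>E S \<subseteq> {..<n} \<rightarrow>\<^sub>E X" using S by (intro PiE_mono) simp
      ultimately show "x \<in> {x. x \<in> ?I \<and> x ` {..<n} = S}" by blast
    next
      fix x assume x: "x \<in> {x. x \<in> ?I \<and> x ` {..<n} = S}"
      hence "x \<in> {..<n} \<rightarrow>\<^sub>E S" by (intro PiE_I) (auto intro: PiE_arb)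
      thus "x \<in> {x \<in> {..<n} \<rightarrow>\<^sub>E S. inj_on x {..<n}}" using x by simp
    qed
    hence "card {x. x \<in> ?I \<and> x ` {..<n} = S} = fact n" using card_inj_PiE[OF finS, of n] S by simp
    thus "(\<Sum>x | x \<in> ?I \<and> x ` {..<n} = S. principal_minor A (x ` {..<n})) = fact n * principal_minor A S"
      by simp
  qed
  also have "\<dots> = fact n * (\<Sum>S\<in>?T. principal_minor A S)" by (simp add: sum_distrib_left)
  finally show ?thesis .
qed

text \<open>With tuples in place of subsets, the coefficient of \<open>t ^ n\<close> has the shape
  of an integral of the \<open>n\<close>-point correlation function.\<close>

lemma det_one_plus_smult_expansion:
  fixes A :: "'a::field_char_0 mat"
  assumes A: "A \<in> carrier_mat d d"
  shows "Determinant.det (1\<^sub>m d + t \<cdot>\<^sub>m A) = (\<Sum>n\<le>d. t ^ n / fact n *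
     (\<Sum>x\<in>{..<n} \<rightarrow>\<^sub>E {0..<d}. Determinant.det (mat n n (\<lambda>(i, j). A $$ (x i, x j)))))"
proof -
  let ?m = "principal_minor (\<lambda>i j. A $$ (i, j))"
  have "Determinant.det (1\<^sub>m d + t \<cdot>\<^sub>m A) = (\<Sum>S\<in>Pow {0..<d}. t ^ card S * ?m S)"
    by (rule det_one_plus_smult[OF A])
  also have "\<dots> = (\<Sum>n\<in>{..d}. \<Sum>S | S \<in> Pow {0..<d} \<and> card S = n. t ^ card S * ?m S)"
    by (rule sum.group[symmetric]) (auto dest: card_mono[rotated])
  also have "\<dots> = (\<Sum>n\<le>d. t ^ n * (\<Sum>S | S \<subseteq> {0..<d} \<and> card S = n. ?m S))"
    by (simp add: sum_distrib_left)
  also have "\<dots> = (\<Sum>n\<le>d. t ^ n / fact n *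
     (\<Sum>x\<in>{..<n} \<rightarrow>\<^sub>E {0..<d}. Determinant.det (mat n n (\<lambda>(i, j). A $$ (x i, x j)))))"
    using sum_det_eq_principal_minors[of "{0..<d}" _ "\<lambda>i j. A $$ (i, j)"] by simp
  finally show ?thesis .
qed

section \<open>The Gaertner-Ellis theorem on the half-line\<close>

text \<open>Through \<open>finite_conj\<close> the derivative reaches every positive number: it
  forces \<open>\<Lambda>\<close> to grow faster than any linear function at infinity and to stay
  bounded below. A positive mean leaves room between \<open>0\<close> and
  \<open>\<Lambda>' 0\<close> for the bound at the boundary point.\<close>

locale legendre =
  fixes \<Lambda> \<Lambda>' :: "real \<Rightarrow> real"
  assumes deriv: "\<And>\<theta>. (\<Lambda> has_real_derivative \<Lambda>' \<theta>) (at \<theta>)"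
    and mono_deriv: "mono \<Lambda>'"
    and at_0: "\<Lambda> 0 = 0"
    and deriv_0_pos: "\<Lambda>' 0 > 0"
    and finite_conj: "\<And>x. x \<ge> 0 \<Longrightarrow> \<exists>D. \<forall>\<theta>. \<theta> * x - \<Lambda> \<theta> \<le> D"
begin

section \<open>Convex duality for the rate function\<close>

definition J :: "real \<Rightarrow> ereal" where
  "J x = (SUP \<theta>. ereal (\<theta> * x - \<Lambda> \<theta>))"

lemma J_ge: "ereal (\<theta> * x - \<Lambda> \<theta>) \<le> J x"
  unfolding J_def by (rule SUP_upper) simp

lemma J_leI: "(\<And>\<theta>. \<theta> * x - \<Lambda> \<theta> \<le> c) \<Longrightarrow> J x \<le> ereal c"
  unfolding J_def by (rule SUP_least) simp

lemma J_nonneg: "0 \<le> J x"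
  using J_ge[of 0 x] at_0 by (simp add: zero_ereal_def)

lemma J_finite: "x \<ge> 0 \<Longrightarrow> J x < \<infinity>"
  using finite_conj[of x] J_leI by (metis ereal_infty_less(1) ereal_infty_less_eq(1) PInfty_neq_ereal(1))

lemma above_tangent: "\<Lambda> \<eta> \<ge> \<Lambda> \<theta> + \<Lambda>' \<theta> * (\<eta> - \<theta>)"
proof -
  have "convex_on UNIV \<Lambda>"
    by (rule convex_on_realI[where f' = \<Lambda>']) (use deriv mono_deriv in \<open>auto simp: mono_def\<close>)
  from convex_on_imp_above_tangent[OF this, of \<theta> \<eta> "\<Lambda>' \<theta>"] deriv show ?thesis by simp
qed

lemma J_deriv: "J (\<Lambda>' \<theta>) = ereal (\<theta> * \<Lambda>' \<theta> - \<Lambda> \<theta>)"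
proof (rule antisym[OF J_leI J_ge])
  fix \<eta> show "\<eta> * \<Lambda>' \<theta> - \<Lambda> \<eta> \<le> \<theta> * \<Lambda>' \<theta> - \<Lambda> \<theta>"
    using above_tangent[of \<theta> \<eta>] by (simp add: algebra_simps)
qed

text \<open>The first-order condition recovers a point from its optimal slope; uniqueness of the
  zero and strict convexity both rest on it.\<close>

lemma deriv_eq_if_max:
  assumes "\<And>\<eta>. \<eta> * x - \<Lambda> \<eta> \<le> \<theta> * x - \<Lambda> \<theta>"
  shows "\<Lambda>' \<theta> = x"
proof -
  have "((\<lambda>\<eta>. \<eta> * x - \<Lambda> \<eta>) has_real_derivative (x - \<Lambda>' \<theta>)) (at \<theta>)"
    by (auto intro!: derivative_eq_intros deriv)
  hence "x - \<Lambda>' \<theta> = 0" by (rule DERIV_local_max[where d = 1]) (use assms in auto)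
  thus ?thesis by simp
qed

text \<open>The function \<open>\<eta> * x - \<Lambda> \<eta>\<close> attains its maximum because it
  is nonpositive far out: finiteness of the conjugate at \<open>x + 1\<close> controls large
  \<open>\<eta>\<close>, finiteness at \<open>0\<close> controls very negative
  \<open>\<eta>\<close>. The first-order condition at a maximiser gives the slope.\<close>

lemma deriv_surj:
  assumes x: "x > 0"
  obtains \<theta> where "\<Lambda>' \<theta> = x"
proof -
  obtain D where D: "\<And>\<theta>. \<theta> * (x + 1) - \<Lambda> \<theta> \<le> D" using finite_conj[of "x+1"] x by auto
  obtain D0 where D0: "\<And>\<theta>. - \<Lambda> \<theta> \<le> D0" using finite_conj[of 0] by auto
  \<comment> \<open>Outside \<open>[-R, R]\<close> the objective is at most \<open>0\<close>, its
    value at \<open>\<eta> = 0\<close>; the outer \<open>max\<close> keeps \<open>0\<close> in the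
    interval.\<close>
  define R where "R = max (max D (D0 / x)) 0"
  have cont: "continuous_on {-R..R} (\<lambda>\<eta>. \<eta> * x - \<Lambda> \<eta>)"
    by (intro continuous_intros continuous_at_imp_continuous_on ballI DERIV_isCont[OF deriv])
  obtain \<theta> where \<theta>: "\<theta> \<in> {-R..R}" "\<And>\<eta>. \<eta> \<in> {-R..R} \<Longrightarrow> \<eta> * x - \<Lambda> \<eta> \<le> \<theta> * x - \<Lambda> \<theta>"
    using continuous_attains_sup[OF _ _ cont] by (auto simp: R_def)
  have ge0: "0 \<le> \<theta> * x - \<Lambda> \<theta>" using \<theta>(2)[of 0] at_0 by (simp add: R_def)
  have "\<eta> * x - \<Lambda> \<eta> \<le> \<theta> * x - \<Lambda> \<theta>" for \<eta>
  proof -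
    consider "\<eta> \<in> {-R..R}" | "\<eta> > R" | "\<eta> < -R" by force
    thus ?thesis
    proof cases
      case 1 thus ?thesis by (rule \<theta>(2))
    next
      case 2
      have "\<eta> * x - \<Lambda> \<eta> \<le> D - \<eta>" using D[of \<eta>] by (simp add: algebra_simps)
      also have "\<dots> \<le> 0" using 2 by (simp add: R_def)
      finally show ?thesis using ge0 by simp
    next
      case 3
      have "D0 / x < - \<eta>" using 3 by (simp add: R_def)
      hence "D0 < - \<eta> * x" using x by (simp add: field_simps)
      thus ?thesis using D0[of \<eta>] ge0 by simp
    qed
  qed
  thus thesis using deriv_eq_if_max that by blast
qed

lemma J_zero_iff: "J x = 0 \<longleftrightarrow> x = \<Lambda>' 0"
proof
  assume "J x = 0"
  hence "\<eta> * x - \<Lambda> \<eta> \<le> 0" for \<eta> using J_ge[of \<eta> x] by (simp add: zero_ereal_def)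
  thus "x = \<Lambda>' 0" using deriv_eq_if_max[of x 0] at_0 by simp
qed (use J_deriv[of 0] at_0 in \<open>simp add: zero_ereal_def\<close>)

text \<open>The line of slope \<open>\<theta>\<close> that supports \<open>J\<close> at the
  intermediate point \<open>z\<close> lies strictly below \<open>J\<close> at every other positive
  \<open>w\<close>: equality would make \<open>\<theta>\<close> optimal for \<open>w\<close> as
  well, so that \<open>\<Lambda>' \<theta>\<close> would equal both \<open>z\<close> and
  \<open>w\<close>.\<close>

lemma J_strictly_convex: "strictly_convex_on {0<..} J"
  unfolding strictly_convex_on_def
proof (intro conjI ballI impI)
  fix x y t :: real assume xy: "x \<in> {0<..}" "y \<in> {0<..}" "x \<noteq> y" and t: "t \<in> {0<..<1}"
  define z where "z = (1 - t) * x + t * y"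
  have "z > 0" unfolding z_def using xy t by (auto intro!: add_pos_pos)
  then obtain \<theta> where \<theta>: "\<Lambda>' \<theta> = z" by (rule deriv_surj)
  have lt: "ereal (\<theta> * w - \<Lambda> \<theta>) < J w" if w: "w > 0" "w \<noteq> z" for w
  proof -
    obtain \<eta> where "\<Lambda>' \<eta> = w" using w(1) by (rule deriv_surj)
    show ?thesis
    proof (rule ccontr)
      assume "\<not> ?thesis"
      hence "J w \<le> ereal (\<theta> * w - \<Lambda> \<theta>)" by simp
      from order_trans[OF J_ge this] have "\<eta> * w - \<Lambda> \<eta> \<le> \<theta> * w - \<Lambda> \<theta>" for \<eta> by simp
      from deriv_eq_if_max[OF this] w(2) \<theta> show False by simp
    qed
  qed
  have "x \<noteq> z" using xy t by (simp add: z_def algebra_simps)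
  have "y - z = (1 - t) * (y - x)" by (simp add: z_def algebra_simps)
  hence "y \<noteq> z" using xy t by auto
  obtain jx where jx: "J x = ereal jx" using J_finite[of x] J_nonneg[of x] xy by (cases "J x") auto
  obtain jy where jy: "J y = ereal jy" using J_finite[of y] J_nonneg[of y] xy by (cases "J y") auto
  have "(1 - t) * (\<theta> * x - \<Lambda> \<theta>) + t * (\<theta> * y - \<Lambda> \<theta>) < (1 - t) * jx + t * jy"
    using lt[of x] lt[of y] xy t \<open>x \<noteq> z\<close> \<open>y \<noteq> z\<close> jx jy
    by (intro add_strict_mono mult_strict_left_mono) auto
  also have "(1 - t) * (\<theta> * x - \<Lambda> \<theta>) + t * (\<theta> * y - \<Lambda> \<theta>) = \<theta> * z - \<Lambda> \<theta>"
    by (simp add: z_def algebra_simps)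
  finally show "J ((1 - t) * x + t * y) < ereal (1 - t) * J x + ereal t * J y"
    using J_deriv[of \<theta>] \<theta> jx jy by (simp add: z_def)
qed simp

lemma J_good_rate_function: "good_rate_function {0..} J"
  unfolding good_rate_function_def
proof (intro conjI ballI allI)
  fix x :: real assume x: "x \<in> {0..}"
  have nt: "at x within {0..} \<noteq> bot"
  proof -
    have "x islimpt {x..x+1}" using islimpt_Icc[of x "x+1" x] by simp
    hence "x islimpt {0..}" by (rule islimpt_subset) (use x in auto)
    thus ?thesis by (simp add: trivial_limit_within)
  qed
  show "J x \<le> Liminf (at x within {0..}) J"
    unfolding J_def[of x]
  proof (rule SUP_least)
    fix \<theta>
    have "((\<lambda>y. ereal (\<theta> * y - \<Lambda> \<theta>)) \<longlongrightarrow> ereal (\<theta> * x - \<Lambda> \<theta>)) (at x within {0..})"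
      by (intro tendsto_intros)
    hence "ereal (\<theta> * x - \<Lambda> \<theta>) = Liminf (at x within {0..}) (\<lambda>y. ereal (\<theta> * y - \<Lambda> \<theta>))"
      by (rule lim_imp_Liminf[OF nt, symmetric])
    also have "\<dots> \<le> Liminf (at x within {0..}) J"
      by (intro Liminf_mono always_eventually allI J_ge)
    finally show "ereal (\<theta> * x - \<Lambda> \<theta>) \<le> Liminf (at x within {0..}) J" .
  qed
next
  fix c :: real
  have eq: "{x \<in> {0..}. J x \<le> ereal c} = {0..} \<inter> (\<Inter>\<theta>. {x. \<theta> * x - \<Lambda> \<theta> \<le> c})"
    unfolding J_def by (auto simp: SUP_le_iff)
  have "closed {x \<in> {0..}. J x \<le> ereal c}"
    unfolding eq by (intro closed_Int closed_INT closed_atLeast ballI closed_Collect_le continuous_intros)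
  \<comment> \<open>The single slope \<open>\<theta> = 1\<close> already bounds the sublevel
    set.\<close>
  moreover have "{x \<in> {0..}. J x \<le> ereal c} \<subseteq> {0..c + \<Lambda> 1}"
    unfolding eq by (auto dest!: spec[of _ 1])
  ultimately show "compact {x \<in> {0..}. J x \<le> ereal c}"
    using bounded_subset[OF bounded_closed_interval] by (auto simp: compact_eq_bounded_closed)
qed (simp add: J_nonneg)

text \<open>Tilting reaches values of \<open>\<Lambda>'\<close>, which are only known to include the
  positive numbers. Below the mean the optimal slope is at most \<open>0\<close>, so dropping
  \<open>\<theta> * y\<close> can only increase the value; thus \<open>0\<close> can borrow the
  lower bound of nearby points.\<close>

lemma J_le_J_0:
  assumes "0 < y" "y < \<Lambda>' 0"
  shows "J y \<le> J 0"
proof -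
  obtain \<theta> where \<theta>: "\<Lambda>' \<theta> = y" using assms(1) by (rule deriv_surj)
  have "\<theta> \<le> 0" using mono_deriv assms(2) \<theta> by (metis linorder_not_le monoD nle_le)
  hence "\<theta> * y \<le> 0" using assms(1) by (simp add: mult_nonpos_nonneg)
  hence "J y \<le> ereal (\<theta> * 0 - \<Lambda> \<theta>)" using J_deriv[of \<theta>] \<theta> by simp
  also have "\<dots> \<le> J 0" by (rule J_ge)
  finally show ?thesis .
qed

end

section \<open>Tilted lower bounds and exponential Chebyshev bounds\<close>

lemma elog_nonpos: "p \<le> 1 \<Longrightarrow> 0 \<le> p \<Longrightarrow> elog p \<le> 0"
  by (auto simp: elog_def zero_ereal_def)

lemma elog_ge:
  assumes "exp (L * b) \<le> p" "L > 0"
  shows "ereal b \<le> ereal (1 / L) * elog p"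
proof -
  have "p > 0" using less_le_trans[OF exp_gt_zero assms(1)] .
  moreover from this have "L * b \<le> ln p" using assms(1) by (simp add: ln_ge_iff)
  ultimately show ?thesis using assms(2) by (simp add: elog_def field_simps)
qed

lemma elog_le:
  assumes "p \<le> exp (L * b)" "L > 0" "0 \<le> p"
  shows "ereal (1 / L) * elog p \<le> ereal b"
proof (cases "p = 0")
  case False
  hence "p > 0" using assms(3) by simp
  moreover from this have "ln p \<le> L * b" using assms(1) by (metis ln_exp ln_le_cancel_iff exp_gt_zero)
  ultimately show ?thesis using assms(2) by (simp add: elog_def field_simps)
qed (use assms in \<open>simp add: elog_def\<close>)

locale gaertner_ellis = legendre \<Lambda> \<Lambda>' + prob_space M
  for \<Lambda> \<Lambda>' and M :: "'w measure" +
  fixes N :: "real \<Rightarrow> 'w \<Rightarrow> real"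
  assumes integrable_exp: "\<And>\<theta> L. L > 0 \<Longrightarrow> integrable M (\<lambda>\<omega>. exp (\<theta> * N L \<omega>))"
    and N_meas [measurable]: "\<And>L. L > 0 \<Longrightarrow> N L \<in> borel_measurable M"
    and N_nonneg: "\<And>L \<omega>. 0 \<le> N L \<omega>"
    and scgf: "\<And>\<theta>. ((\<lambda>L. 1 / L * ln (\<integral>\<omega>. exp (\<theta> * N L \<omega>) \<partial>M)) \<longlongrightarrow> \<Lambda> \<theta>) at_top"
begin

definition mgf :: "real \<Rightarrow> real \<Rightarrow> real" where
  "mgf L \<theta> = (\<integral>\<omega>. exp (\<theta> * N L \<omega>) \<partial>M)"

lemma mgf_pos: "L > 0 \<Longrightarrow> mgf L \<theta> > 0"
proof -
  assume L: "L > 0"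
  have "mgf L \<theta> \<ge> 0" unfolding mgf_def by (intro integral_nonneg_AE) simp
  moreover have "mgf L \<theta> \<noteq> 0"
    unfolding mgf_def using integral_nonneg_eq_0_iff_AE[OF integrable_exp[OF L, of \<theta>]] AE_False
    by (auto simp: prob_space)
  ultimately show ?thesis by simp
qed

lemma eventually_mgf:
  assumes "b < \<Lambda> \<theta>" "\<Lambda> \<theta> < c"
  shows "eventually (\<lambda>L. exp (L * b) \<le> mgf L \<theta> \<and> mgf L \<theta> \<le> exp (L * c)) at_top"
proof -
  have "eventually (\<lambda>L. b < 1 / L * ln (mgf L \<theta>)) at_top" "eventually (\<lambda>L. 1 / L * ln (mgf L \<theta>) < c) at_top"
    unfolding mgf_def using order_tendstoD[OF scgf] assms by auto
  with eventually_gt_at_top[of "0::real"] show ?thesis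
  proof eventually_elim
    case (elim L)
    have "L * b \<le> ln (mgf L \<theta>)" "ln (mgf L \<theta>) \<le> L * c" using elim by (auto simp: field_simps)
    thus ?case using mgf_pos[OF elim(1), of \<theta>] by (metis exp_le_cancel_iff exp_ln)
  qed
qed

text \<open>Under the measure tilted by \<open>exp (\<eta> N)\<close>, the quotient \<open>N / L\<close> concentrates at \<open>\<Lambda>' \<eta> = x\<close>.\<close>

lemma local_lower_bound:
  assumes d: "d > 0" and x: "x = \<Lambda>' \<eta>" and e: "\<epsilon> > 0"
  shows "eventually (\<lambda>L. exp (L * (\<Lambda> \<eta> - \<eta> * x - \<epsilon>)) \<le> prob {\<omega>\<in>space M. \<bar>N L \<omega> / L - x\<bar> < d}) at_top"
proof -
  \<comment> \<open>On the smaller window of radius \<open>\<delta>\<close> the exponent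
    \<open>\<eta> * N / L\<close> stays within \<open>\<epsilon> / 4\<close> of
    \<open>\<eta> * x\<close>.\<close>
  define \<delta> where "\<delta> = min d (\<epsilon> / (4 * (\<bar>\<eta>\<bar> + 1)))"
  have \<delta>: "\<delta> > 0" "\<delta> \<le> d" using d e by (auto simp: \<delta>_def)
  have "\<delta> \<le> \<epsilon> / (4 * (\<bar>\<eta>\<bar> + 1))" by (simp add: \<delta>_def)
  hence "(\<bar>\<eta>\<bar> + 1) * \<delta> \<le> \<epsilon> / 4" by (simp add: field_simps)
  hence \<eta>\<delta>: "\<bar>\<eta>\<bar> * \<delta> \<le> \<epsilon> / 4" using \<delta> by (simp add: distrib_right)
  have der: "((\<lambda>s. (\<Lambda> (\<eta> + s) - \<Lambda> \<eta>) / s) \<longlongrightarrow> x) (at 0)"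
    using deriv[of \<eta>] x by (simp add: DERIV_def)
  have "eventually (\<lambda>s. (\<Lambda> (\<eta> + s) - \<Lambda> \<eta>) / s < x + \<delta>) (at 0)"
    "eventually (\<lambda>s. (\<Lambda> (\<eta> + s) - \<Lambda> \<eta>) / s > x - \<delta>) (at 0)"
    using order_tendstoD[OF der] \<delta> by auto
  hence "eventually (\<lambda>s. (\<Lambda> (\<eta> + s) - \<Lambda> \<eta>) / s < x + \<delta> \<and> (\<Lambda> (\<eta> + s) - \<Lambda> \<eta>) / s > x - \<delta>) (at 0)"
    by eventually_elim simp
  then obtain r where r: "r > 0" "\<And>s. s \<noteq> 0 \<Longrightarrow> \<bar>s\<bar> < r \<Longrightarrow> (\<Lambda> (\<eta> + s) - \<Lambda> \<eta>) / s < x + \<delta> \<and> (\<Lambda> (\<eta> + s) - \<Lambda> \<eta>) / s > x - \<delta>"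
    unfolding eventually_at by (auto simp: dist_real_def)
  \<comment> \<open>A shift of the tilt so small that the difference quotients of
    \<open>\<Lambda>\<close> at \<open>\<eta>\<close> in both directions lie within
    \<open>\<delta>\<close> of \<open>x\<close>; this makes the Chebyshev exponents in
    \<open>s1\<close> and \<open>s2\<close> strictly smaller than
    \<open>\<Lambda> \<eta>\<close>.\<close>
  define s where "s = r / 2"
  have s: "s > 0" using r by (simp add: s_def)
  have s1: "\<Lambda> (\<eta> + s) - s * (x + \<delta>) < \<Lambda> \<eta>"
    using r(2)[of s] r(1) s by (simp add: s_def field_simps)
  have s2: "\<Lambda> (\<eta> - s) + s * (x - \<delta>) < \<Lambda> \<eta>"
    using r(2)[of "-s"] r(1) s by (simp add: s_def field_simps)
  \<comment> \<open>At most a third of each gap: one \<open>\<gamma>\<close> is spent on the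
    estimate of the shifted moment, and \<open>2 * \<gamma>\<close> remain, one for the moment at
    \<open>\<eta>\<close> and one for a factor \<open>4\<close>.\<close>
  define \<gamma> where "\<gamma> = min (min ((\<Lambda> \<eta> - (\<Lambda> (\<eta> + s) - s * (x + \<delta>))) / 3) ((\<Lambda> \<eta> - (\<Lambda> (\<eta> - s) + s * (x - \<delta>))) / 3)) (\<epsilon> / 4)"
  have \<gamma>: "\<gamma> > 0" "\<gamma> \<le> \<epsilon> / 4" using s1 s2 e by (auto simp: \<gamma>_def)
  have "\<gamma> \<le> (\<Lambda> \<eta> - (\<Lambda> (\<eta> + s) - s * (x + \<delta>))) / 3" "\<gamma> \<le> (\<Lambda> \<eta> - (\<Lambda> (\<eta> - s) + s * (x - \<delta>))) / 3"
    unfolding \<gamma>_def by (rule min.coboundedI1[OF min.cobounded1], rule min.coboundedI1[OF min.cobounded2])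
  note \<gamma>_le = this
  have \<gamma>1: "\<Lambda> (\<eta> + s) - s * (x + \<delta>) + \<gamma> \<le> \<Lambda> \<eta> - 2 * \<gamma>"
    using \<gamma>_le(1) by (simp add: field_simps)
  have \<gamma>2: "\<Lambda> (\<eta> - s) + s * (x - \<delta>) + \<gamma> \<le> \<Lambda> \<eta> - 2 * \<gamma>"
    using \<gamma>_le(2) by (simp add: field_simps)
  have ev: "eventually (\<lambda>L. exp (L * (\<Lambda> \<eta> - \<gamma>)) \<le> mgf L \<eta> \<and> mgf L \<eta> \<le> exp (L * (\<Lambda> \<eta> + \<gamma>))) at_top"
    "eventually (\<lambda>L. exp (L * (\<Lambda> (\<eta>+s) - \<gamma>)) \<le> mgf L (\<eta>+s) \<and> mgf L (\<eta>+s) \<le> exp (L * (\<Lambda> (\<eta>+s) + \<gamma>))) at_top"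
    "eventually (\<lambda>L. exp (L * (\<Lambda> (\<eta>-s) - \<gamma>)) \<le> mgf L (\<eta>-s) \<and> mgf L (\<eta>-s) \<le> exp (L * (\<Lambda> (\<eta>-s) + \<gamma>))) at_top"
    using \<gamma> by (intro eventually_mgf; simp)+
  have "eventually (\<lambda>L. L \<ge> ln 4 / \<gamma>) at_top" "eventually (\<lambda>L. L \<ge> 4 * ln 2 / \<epsilon>) at_top" by (rule eventually_ge_at_top)+
  with ev eventually_gt_at_top[of "0::real"] show ?thesis
  proof eventually_elim
    case (elim L)
    note L = \<open>L > 0\<close>
    let ?G = "{\<omega>\<in>space M. \<bar>N L \<omega> / L - x\<bar> < \<delta>}"
    have G[measurable]: "?G \<in> sets M" using N_meas[OF L] by measurable
    have i1: "integrable M (\<lambda>\<omega>. exp (L * (\<eta> * x + \<bar>\<eta>\<bar> * \<delta>)) * indicator ?G \<omega>)"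
      by (intro integrable_mult_right) (simp add: emeasure_eq_measure)
    have i2: "integrable M (\<lambda>\<omega>. c * exp (\<theta> * N L \<omega>))" for c \<theta>
      by (intro integrable_mult_right integrable_exp L)
    have int: "integrable M (\<lambda>\<omega>. exp (L * (\<eta> * x + \<bar>\<eta>\<bar> * \<delta>)) * indicator ?G \<omega>
        + exp (- s * L * (x + \<delta>)) * exp ((\<eta> + s) * N L \<omega>) + exp (s * L * (x - \<delta>)) * exp ((\<eta> - s) * N L \<omega>))"
      by (intro Bochner_Integration.integrable_add i1 i2)
    \<comment> \<open>Concentration under the tilt as a pointwise inequality: off the window,
      \<open>exp (\<eta> * N)\<close> is dominated by an exponential tilted a further
      \<open>s\<close> upwards or downwards.\<close>
    have pw: "exp (\<eta> * N L \<omega>) \<le> exp (L * (\<eta> * x + \<bar>\<eta>\<bar> * \<delta>)) * indicator ?G \<omega>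
        + exp (- s * L * (x + \<delta>)) * exp ((\<eta> + s) * N L \<omega>) + exp (s * L * (x - \<delta>)) * exp ((\<eta> - s) * N L \<omega>)"
      if \<omega>: "\<omega> \<in> space M" for \<omega>
    proof -
      define u where "u = N L \<omega> / L"
      have Nu: "N L \<omega> = L * u" using L by (simp add: u_def)
      let ?a = "exp (L * (\<eta> * x + \<bar>\<eta>\<bar> * \<delta>)) * indicator ?G \<omega>"
      let ?b = "exp (- s * L * (x + \<delta>)) * exp ((\<eta> + s) * N L \<omega>)"
      let ?c = "exp (s * L * (x - \<delta>)) * exp ((\<eta> - s) * N L \<omega>)"
      show ?thesis
      proof -
        have "\<bar>u - x\<bar> < \<delta> \<or> u - x \<ge> \<delta> \<or> x - u \<ge> \<delta>" by linarith
        thus ?thesis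
        proof (elim disjE)
          assume 1: "\<bar>u - x\<bar> < \<delta>"
          have "\<eta> * (u - x) \<le> \<bar>\<eta>\<bar> * \<delta>"
            by (rule order_trans[OF abs_ge_self[of "\<eta> * (u - x)"]]) (use 1 in \<open>auto simp: abs_mult intro!: mult_left_mono\<close>)
          hence "L * (\<eta> * u) \<le> L * (\<eta> * x + \<bar>\<eta>\<bar> * \<delta>)" using L by (intro mult_left_mono) (auto simp: algebra_simps)
          moreover have "indicator ?G \<omega> = (1::real)" using 1 \<omega> by (simp add: u_def)
          hence "?a = exp (L * (\<eta> * x + \<bar>\<eta>\<bar> * \<delta>))" by (simp only: mult_1_right)
          moreover have "\<eta> * N L \<omega> = L * (\<eta> * u)" by (simp add: Nu)
          ultimately have "exp (\<eta> * N L \<omega>) \<le> ?a" by (simp only: exp_le_cancel_iff)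
          moreover have "?b \<ge> 0" "?c \<ge> 0" by auto
          ultimately show ?thesis by linarith
        next
          assume 2: "u - x \<ge> \<delta>"
          have "s * L * (x + \<delta>) \<le> s * L * u" using 2 s L by (intro mult_left_mono) auto
          hence "exp (\<eta> * N L \<omega>) \<le> ?b" unfolding exp_add[symmetric] by (simp add: Nu algebra_simps)
          moreover have "?a \<ge> 0" "?c \<ge> 0" by auto
          ultimately show ?thesis by linarith
        next
          assume 3: "x - u \<ge> \<delta>"
          have "s * L * u \<le> s * L * (x - \<delta>)" using 3 s L by (intro mult_left_mono) auto
          hence "exp (\<eta> * N L \<omega>) \<le> ?c" unfolding exp_add[symmetric] by (simp add: Nu algebra_simps)
          moreover have "?a \<ge> 0" "?b \<ge> 0" by auto
          ultimately show ?thesis by linarith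
        qed
      qed
    qed
    have "mgf L \<eta> \<le> (\<integral>\<omega>. exp (L * (\<eta> * x + \<bar>\<eta>\<bar> * \<delta>)) * indicator ?G \<omega>
        + exp (- s * L * (x + \<delta>)) * exp ((\<eta> + s) * N L \<omega>) + exp (s * L * (x - \<delta>)) * exp ((\<eta> - s) * N L \<omega>) \<partial>M)"
      unfolding mgf_def[of L \<eta>] by (rule Bochner_Integration.integral_mono[OF integrable_exp[OF L, of \<eta>] int pw])
    also have "\<dots> = exp (L * (\<eta> * x + \<bar>\<eta>\<bar> * \<delta>)) * prob ?G + exp (- s * L * (x + \<delta>)) * mgf L (\<eta> + s) + exp (s * L * (x - \<delta>)) * mgf L (\<eta> - s)"
      by (simp only: Bochner_Integration.integral_add[OF Bochner_Integration.integrable_add[OF i1 i2] i2]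
        Bochner_Integration.integral_add[OF i1 i2]) (simp add: mgf_def)
    finally have main: "mgf L \<eta> \<le> exp (L * (\<eta> * x + \<bar>\<eta>\<bar> * \<delta>)) * prob ?G + exp (- s * L * (x + \<delta>)) * mgf L (\<eta> + s) + exp (s * L * (x - \<delta>)) * mgf L (\<eta> - s)" .
    have q: "exp (L * (\<Lambda> \<eta> - 2 * \<gamma>)) \<le> mgf L \<eta> / 4"
    proof -
      have "ln 4 \<le> L * \<gamma>" using elim(5) \<gamma> by (simp add: field_simps)
      hence "exp (L * (\<Lambda> \<eta> - 2 * \<gamma>) + ln 4) \<le> exp (L * (\<Lambda> \<eta> - \<gamma>))" by (simp add: algebra_simps)
      also have "\<dots> \<le> mgf L \<eta>" using elim by simp
      finally show ?thesis by (simp add: exp_add)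
    qed
    have "exp (- s * L * (x + \<delta>)) * mgf L (\<eta> + s) \<le> exp (- s * L * (x + \<delta>)) * exp (L * (\<Lambda> (\<eta>+s) + \<gamma>))"
      using elim by (intro mult_left_mono) auto
    also have "\<dots> = exp (L * (\<Lambda> (\<eta>+s) - s * (x + \<delta>) + \<gamma>))" by (simp add: exp_add[symmetric] algebra_simps)
    also have "\<dots> \<le> exp (L * (\<Lambda> \<eta> - 2 * \<gamma>))" unfolding exp_le_cancel_iff by (rule mult_left_mono[OF \<gamma>1]) (use L in simp)
    finally have q1: "exp (- s * L * (x + \<delta>)) * mgf L (\<eta> + s) \<le> mgf L \<eta> / 4" using q by simp
    have "exp (s * L * (x - \<delta>)) * mgf L (\<eta> - s) \<le> exp (s * L * (x - \<delta>)) * exp (L * (\<Lambda> (\<eta>-s) + \<gamma>))"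
      using elim by (intro mult_left_mono) auto
    also have "\<dots> = exp (L * (\<Lambda> (\<eta>-s) + s * (x - \<delta>) + \<gamma>))" by (simp add: exp_add[symmetric] algebra_simps)
    also have "\<dots> \<le> exp (L * (\<Lambda> \<eta> - 2 * \<gamma>))" unfolding exp_le_cancel_iff by (rule mult_left_mono[OF \<gamma>2]) (use L in simp)
    finally have q2: "exp (s * L * (x - \<delta>)) * mgf L (\<eta> - s) \<le> mgf L \<eta> / 4" using q by simp
    \<comment> \<open>The two tails take at most a quarter each, so the window carries at least half
      of the tilted mass.\<close>
    have "mgf L \<eta> / 2 \<le> exp (L * (\<eta> * x + \<bar>\<eta>\<bar> * \<delta>)) * prob ?G" using main q1 q2 by simp
    moreover have "exp (L * (\<Lambda> \<eta> - \<gamma>)) / 2 \<le> mgf L \<eta> / 2" using elim by simp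
    ultimately have "exp (L * (\<Lambda> \<eta> - \<gamma>)) / 2 \<le> exp (L * (\<eta> * x + \<bar>\<eta>\<bar> * \<delta>)) * prob ?G" by linarith
    moreover have "exp (L * (\<eta> * x + \<bar>\<eta>\<bar> * \<delta>)) * exp (L * (\<Lambda> \<eta> - \<eta> * x - \<epsilon>)) \<le> exp (L * (\<Lambda> \<eta> - \<gamma>)) / 2"
    proof -
      have "ln 2 \<le> L * (\<epsilon> / 4)" using elim(6) e by (simp add: field_simps)
      moreover have "L * (\<bar>\<eta>\<bar> * \<delta>) \<le> L * (\<epsilon> / 4)" "L * \<gamma> \<le> L * (\<epsilon>/4)" using L \<eta>\<delta> \<gamma> by (auto intro!: mult_left_mono)
      moreover have "0 \<le> L * \<epsilon>" using L e by simp
      ultimately have "L * (\<eta> * x + \<bar>\<eta>\<bar> * \<delta>) + L * (\<Lambda> \<eta> - \<eta> * x - \<epsilon>) + ln 2 \<le> L * (\<Lambda> \<eta> - \<gamma>)"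
        by (simp add: algebra_simps)
      hence "exp (L * (\<eta> * x + \<bar>\<eta>\<bar> * \<delta>) + L * (\<Lambda> \<eta> - \<eta> * x - \<epsilon>) + ln 2) \<le> exp (L * (\<Lambda> \<eta> - \<gamma>))" by simp
      thus ?thesis by (simp add: exp_add)
    qed
    ultimately have "exp (L * (\<eta> * x + \<bar>\<eta>\<bar> * \<delta>)) * exp (L * (\<Lambda> \<eta> - \<eta> * x - \<epsilon>)) \<le> exp (L * (\<eta> * x + \<bar>\<eta>\<bar> * \<delta>)) * prob ?G" by linarith
    hence "exp (L * (\<Lambda> \<eta> - \<eta> * x - \<epsilon>)) \<le> prob ?G" by simp
    also have "\<dots> \<le> prob {\<omega>\<in>space M. \<bar>N L \<omega> / L - x\<bar> < d}"
      using N_meas[OF L] \<delta> by (intro finite_measure_mono) auto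
    finally show ?case .
  qed
qed

lemma lower_bound_pos:
  assumes x: "x > 0" and d: "d > 0" and A: "{0..} \<inter> ball x d \<subseteq> A" and meas: "A \<in> sets borel"
  shows "- J x \<le> Liminf at_top (\<lambda>L. ereal (1 / L) * elog (prob {\<omega>\<in>space M. N L \<omega> / L \<in> A}))"
proof -
  obtain \<eta> where \<eta>: "x = \<Lambda>' \<eta>" using deriv_surj[OF x] by metis
  have "- J x + ereal (-e) \<le> Liminf at_top (\<lambda>L. ereal (1 / L) * elog (prob {\<omega>\<in>space M. N L \<omega> / L \<in> A}))" if e: "e > 0" for e
  proof (rule Liminf_bounded)
    show "\<forall>\<^sub>F L in at_top. - J x + ereal (-e) \<le> ereal (1 / L) * elog (prob {\<omega>\<in>space M. N L \<omega> / L \<in> A})"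
      using local_lower_bound[OF d \<eta> e] eventually_gt_at_top[of "0::real"]
    proof eventually_elim
      case (elim L)
      have "exp (L * (\<Lambda> \<eta> - \<eta> * x - e)) \<le> prob {\<omega>\<in>space M. \<bar>N L \<omega> / L - x\<bar> < d}" by fact
      also have "\<dots> \<le> prob {\<omega>\<in>space M. N L \<omega> / L \<in> A}"
        using N_meas[OF elim(2)] meas A N_nonneg elim(2)
        by (intro finite_measure_mono) (auto simp: dist_real_def abs_minus_commute)
      finally show ?case using elog_ge[OF _ elim(2)] J_deriv[of \<eta>] \<eta> by simp
    qed
  qed
  hence *: "- J x \<le> Liminf at_top (\<lambda>L. ereal (1 / L) * elog (prob {\<omega>\<in>space M. N L \<omega> / L \<in> A})) + ereal e" if "e > 0" for e
    using that J_deriv[of \<eta>] \<eta>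
    by (cases "Liminf at_top (\<lambda>L. ereal (1 / L) * elog (prob {\<omega>\<in>space M. N L \<omega> / L \<in> A}))") (force simp: algebra_simps)+
  show ?thesis by (rule ereal_le_epsilon2) (use * in blast)
qed

lemma lower_bound:
  assumes x: "x \<ge> 0" and d: "d > 0" and A: "{0..} \<inter> ball x d \<subseteq> A" and meas: "A \<in> sets borel"
  shows "- J x \<le> Liminf at_top (\<lambda>L. ereal (1 / L) * elog (prob {\<omega>\<in>space M. N L \<omega> / L \<in> A}))"
proof (cases "x = 0")
  case True
  \<comment> \<open>Close enough to \<open>0\<close> for its ball to stay inside
    \<open>ball 0 d\<close>, and below the mean so that \<open>J y \<le> J 0\<close>.\<close>
  define y where "y = min (d / 2) (\<Lambda>' 0 / 2)"
  have y: "0 < y" "y < \<Lambda>' 0" "y \<le> d / 2" using d deriv_0_pos by (auto simp: y_def)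
  have "- J x \<le> - J y" using J_le_J_0[OF y(1,2)] True by simp
  also have "\<dots> \<le> Liminf at_top (\<lambda>L. ereal (1 / L) * elog (prob {\<omega>\<in>space M. N L \<omega> / L \<in> A}))"
  proof (rule lower_bound_pos[OF y(1) half_gt_zero[OF d] _ meas])
    have "ball y (d/2) \<subseteq> ball x d" using y True by (auto simp: dist_real_def abs_if split: if_splits)
    thus "{0..} \<inter> ball y (d / 2) \<subseteq> A" using A by blast
  qed
  finally show ?thesis .
qed (use lower_bound_pos assms in auto)

text \<open>Two slopes suffice. To the right of the mean, the point of \<open>C\<close> nearest to
  it has a slope that beats \<open>\<alpha>\<close>; this slope is nonnegative, so it works for all
  points of \<open>C\<close> farther right. The left side is symmetric, and the two Chebyshev bounds
  are added.\<close>

lemma upper_bound: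
  assumes C: "closed C" and AC: "A \<subseteq> C" and meas: "A \<in> sets borel"
    and \<alpha>: "0 \<le> \<alpha>" "\<And>x. x \<in> C \<Longrightarrow> ereal \<alpha> < J x"
  shows "eventually (\<lambda>L. prob {\<omega>\<in>space M. N L \<omega> / L \<in> A} \<le> exp (L * - \<alpha>)) at_top"
proof -
  let ?m = "\<Lambda>' 0"
  have tang: "\<theta> * ?m \<le> \<Lambda> \<theta>" for \<theta> using above_tangent[of 0 \<theta>] at_0 by (simp add: mult.commute)
  have ex: "\<exists>\<theta>. \<theta> * x - \<Lambda> \<theta> > \<alpha>" if "x \<in> C" for x
    using \<alpha>(2)[OF that] unfolding J_def by (auto simp: less_SUP_iff)
  have "\<exists>\<theta> \<beta>. \<beta> > \<alpha> \<and> (\<forall>y\<in>C. y \<ge> ?m \<longrightarrow> \<theta> * y - \<Lambda> \<theta> \<ge> \<beta>)"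
  proof (cases "C \<inter> {?m..} = {}")
    case True thus ?thesis by (auto intro!: exI[of _ 0] exI[of _ "\<alpha> + 1"])
  next
    case False
    have bdd: "bdd_below (C \<inter> {?m..})" by (auto intro!: bdd_belowI[of _ ?m])
    have "Inf (C \<inter> {?m..}) \<in> C \<inter> {?m..}"
      using False C bdd by (intro closed_contains_Inf) auto
    then obtain c where c: "c \<in> C" "c \<ge> ?m" and min: "\<And>y. y \<in> C \<Longrightarrow> y \<ge> ?m \<Longrightarrow> c \<le> y"
      using cInf_lower[OF _ bdd] by (metis Int_iff atLeast_iff)
    obtain \<theta> where \<theta>: "\<theta> * c - \<Lambda> \<theta> > \<alpha>" using ex[OF c(1)] by blast
    \<comment> \<open>The tangent at \<open>0\<close> gives
      \<open>\<theta> * ?m \<le> \<Lambda> \<theta>\<close>; a negative slope at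
      \<open>c \<ge> ?m\<close> would therefore yield a value at most \<open>0\<close>, against
      \<open>\<alpha> \<ge> 0\<close>.\<close>
    have "\<theta> \<ge> 0"
    proof (rule ccontr)
      assume "\<not> \<theta> \<ge> 0"
      hence "\<theta> * c \<le> \<theta> * ?m" using c(2) by (intro mult_left_mono_neg) auto
      thus False using tang[of \<theta>] \<theta> \<alpha>(1) by simp
    qed
    hence "\<forall>y\<in>C. y \<ge> ?m \<longrightarrow> \<theta> * y - \<Lambda> \<theta> \<ge> \<theta> * c - \<Lambda> \<theta>" using min by (auto intro!: mult_left_mono)
    thus ?thesis using \<theta> by blast
  qed
  then obtain \<theta>1 \<beta>1 where 1: "\<beta>1 > \<alpha>" "\<And>y. y \<in> C \<Longrightarrow> y \<ge> ?m \<Longrightarrow> \<theta>1 * y - \<Lambda> \<theta>1 \<ge> \<beta>1" by blast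
  have "\<exists>\<theta> \<beta>. \<beta> > \<alpha> \<and> (\<forall>y\<in>C. y \<le> ?m \<longrightarrow> \<theta> * y - \<Lambda> \<theta> \<ge> \<beta>)"
  proof (cases "C \<inter> {..?m} = {}")
    case True thus ?thesis by (auto intro!: exI[of _ 0] exI[of _ "\<alpha> + 1"])
  next
    case False
    have bdd: "bdd_above (C \<inter> {..?m})" by (auto intro!: bdd_aboveI[of _ ?m])
    have "Sup (C \<inter> {..?m}) \<in> C \<inter> {..?m}"
      using False C bdd by (intro closed_contains_Sup) auto
    then obtain c where c: "c \<in> C" "c \<le> ?m" and max: "\<And>y. y \<in> C \<Longrightarrow> y \<le> ?m \<Longrightarrow> y \<le> c"
      using cSup_upper[OF _ bdd] by (metis Int_iff atMost_iff)
    obtain \<theta> where \<theta>: "\<theta> * c - \<Lambda> \<theta> > \<alpha>" using ex[OF c(1)] by blast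
    have "\<theta> \<le> 0"
    proof (rule ccontr)
      assume "\<not> \<theta> \<le> 0"
      hence "\<theta> * c \<le> \<theta> * ?m" using c(2) by (intro mult_left_mono) auto
      thus False using tang[of \<theta>] \<theta> \<alpha>(1) by simp
    qed
    hence "\<forall>y\<in>C. y \<le> ?m \<longrightarrow> \<theta> * y - \<Lambda> \<theta> \<ge> \<theta> * c - \<Lambda> \<theta>" using max by (auto intro!: mult_left_mono_neg)
    thus ?thesis using \<theta> by blast
  qed
  then obtain \<theta>2 \<beta>2 where 2: "\<beta>2 > \<alpha>" "\<And>y. y \<in> C \<Longrightarrow> y \<le> ?m \<Longrightarrow> \<theta>2 * y - \<Lambda> \<theta>2 \<ge> \<beta>2" by blast
  define \<beta> where "\<beta> = min \<beta>1 \<beta>2"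
  \<comment> \<open>Half of the slack: one half absorbs the error in the moments, the other the
    factor \<open>2\<close> from adding two bounds.\<close>
  define \<gamma> where "\<gamma> = (\<beta> - \<alpha>) / 2"
  have \<gamma>: "\<gamma> > 0" "\<beta> - \<gamma> = \<alpha> + \<gamma>" using 1(1) 2(1) by (auto simp: \<gamma>_def \<beta>_def field_simps)
  have ev: "eventually (\<lambda>L. exp (L * (\<Lambda> \<theta>1 - \<gamma>)) \<le> mgf L \<theta>1 \<and> mgf L \<theta>1 \<le> exp (L * (\<Lambda> \<theta>1 + \<gamma>))) at_top"
    "eventually (\<lambda>L. exp (L * (\<Lambda> \<theta>2 - \<gamma>)) \<le> mgf L \<theta>2 \<and> mgf L \<theta>2 \<le> exp (L * (\<Lambda> \<theta>2 + \<gamma>))) at_top"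
    using \<gamma> by (intro eventually_mgf; simp)+
  have "eventually (\<lambda>L. L \<ge> ln 2 / \<gamma>) at_top" by (rule eventually_ge_at_top)
  with ev eventually_gt_at_top[of "0::real"] show ?thesis
  proof eventually_elim
    case (elim L)
    note L = \<open>L > 0\<close>
    let ?A = "{\<omega>\<in>space M. N L \<omega> / L \<in> A}"
    have Am: "?A \<in> sets M" using N_meas[OF L] meas by measurable
    have int: "integrable M (\<lambda>\<omega>. exp (- L * (\<Lambda> \<theta>1 + \<beta>)) * exp (\<theta>1 * N L \<omega>) + exp (- L * (\<Lambda> \<theta>2 + \<beta>)) * exp (\<theta>2 * N L \<omega>))"
      by (intro Bochner_Integration.integrable_add integrable_mult_right integrable_exp L)
    have "prob ?A = (\<integral>\<omega>. indicator ?A \<omega> \<partial>M)" using Am by simp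
    also have "\<dots> \<le> (\<integral>\<omega>. exp (- L * (\<Lambda> \<theta>1 + \<beta>)) * exp (\<theta>1 * N L \<omega>) + exp (- L * (\<Lambda> \<theta>2 + \<beta>)) * exp (\<theta>2 * N L \<omega>) \<partial>M)"
    proof (rule integral_mono[OF _ int])
      show "integrable M (indicator ?A :: _ \<Rightarrow> real)" using Am by (simp add: emeasure_eq_measure)
      fix \<omega> assume \<omega>: "\<omega> \<in> space M"
      define u where "u = N L \<omega> / L"
      have Nu: "N L \<omega> = L * u" using L by (simp add: u_def)
      show "indicator ?A \<omega> \<le> exp (- L * (\<Lambda> \<theta>1 + \<beta>)) * exp (\<theta>1 * N L \<omega>) + exp (- L * (\<Lambda> \<theta>2 + \<beta>)) * exp (\<theta>2 * N L \<omega>)"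
      proof (cases "\<omega> \<in> ?A")
        case True
        hence u: "u \<in> C" using AC by (auto simp: u_def)
        have e: "1 \<le> exp (- L * (\<Lambda> \<theta> + \<beta>)) * exp (\<theta> * N L \<omega>)" if "\<beta> \<le> \<theta> * u - \<Lambda> \<theta>" for \<theta>
        proof -
          have "0 \<le> L * (\<theta> * u - \<Lambda> \<theta> - \<beta>)" using that L by simp
          thus ?thesis unfolding exp_add[symmetric] one_le_exp_iff by (simp add: Nu algebra_simps)
        qed
        show ?thesis
        proof (cases "u \<ge> ?m")
          case True
          hence "1 \<le> exp (- L * (\<Lambda> \<theta>1 + \<beta>)) * exp (\<theta>1 * N L \<omega>)" using e 1(2)[OF u] by (simp add: \<beta>_def)
          moreover have "0 \<le> exp (- L * (\<Lambda> \<theta>2 + \<beta>)) * exp (\<theta>2 * N L \<omega>)" by simp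
          moreover have "indicator ?A \<omega> \<le> (1::real)" by (simp add: indicator_def)
          ultimately show ?thesis by linarith
        next
          case False
          hence "1 \<le> exp (- L * (\<Lambda> \<theta>2 + \<beta>)) * exp (\<theta>2 * N L \<omega>)" using e 2(2)[OF u] by (simp add: \<beta>_def)
          moreover have "0 \<le> exp (- L * (\<Lambda> \<theta>1 + \<beta>)) * exp (\<theta>1 * N L \<omega>)" by simp
          moreover have "indicator ?A \<omega> \<le> (1::real)" by (simp add: indicator_def)
          ultimately show ?thesis by linarith
        qed
      qed auto
    qed
    also have "\<dots> = exp (- L * (\<Lambda> \<theta>1 + \<beta>)) * mgf L \<theta>1 + exp (- L * (\<Lambda> \<theta>2 + \<beta>)) * mgf L \<theta>2"
      using integrable_exp[OF L] by (simp add: mgf_def)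
    also have "\<dots> \<le> exp (- L * (\<Lambda> \<theta>1 + \<beta>)) * exp (L * (\<Lambda> \<theta>1 + \<gamma>)) + exp (- L * (\<Lambda> \<theta>2 + \<beta>)) * exp (L * (\<Lambda> \<theta>2 + \<gamma>))"
      using elim by (intro add_mono mult_left_mono) auto
    also have "\<dots> = 2 * exp (L * - (\<beta> - \<gamma>))" unfolding exp_add[symmetric] by (simp add: algebra_simps)
    also have "\<dots> = exp (ln 2 - L * \<gamma>) * exp (L * - \<alpha>)" unfolding \<gamma>(2) by (simp add: exp_add exp_diff exp_minus field_simps)
    also have "\<dots> \<le> 1 * exp (L * - \<alpha>)" using elim \<gamma> by (intro mult_right_mono) (auto simp: field_simps)
    finally show ?case by simp
  qed
qed

theorem ldp: "large_deviations_principle M (\<lambda>L \<omega>. N L \<omega> / L) {0..} J"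
  unfolding large_deviations_principle_def
proof (intro ballI conjI)
  fix A :: "real set" assume A: "A \<in> sets (restrict_space borel {0..})"
  let ?f = "\<lambda>L. ereal (1 / L) * elog (prob {\<omega>\<in>space M. N L \<omega> / L \<in> A})"
  have A': "A \<in> sets borel" "A \<subseteq> {0..}" using A by (auto simp: sets_restrict_space)
  show "Liminf at_top ?f \<le> Limsup at_top ?f" by (rule Liminf_le_Limsup) simp
  have "- Liminf at_top ?f \<le> (INF x\<in>(top_of_set {0..}) interior_of A. J x)"
  proof (rule INF_greatest)
    fix x assume "x \<in> (top_of_set {0..}) interior_of A"
    then obtain U where U: "openin (top_of_set {0..}) U" "x \<in> U" "U \<subseteq> A" by (auto simp: interior_of_def)
    from U(1) obtain V where V: "open V" "U = {0..} \<inter> V" by (auto simp: openin_open)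
    with U(2) obtain d where "d > 0" "ball x d \<subseteq> V" by (auto simp: open_contains_ball)
    hence "- J x \<le> Liminf at_top ?f" using U V A' by (intro lower_bound[of x d]) auto
    thus "- Liminf at_top ?f \<le> J x" by (simp add: ereal_uminus_le_reorder)
  qed
  thus "- (INF x\<in>(top_of_set {0..}) interior_of A. J x) \<le> Liminf at_top ?f" by (simp add: ereal_uminus_le_reorder)
  let ?C = "(top_of_set {0..}) closure_of A"
  have clC: "closed ?C" by (rule closedin_closed_trans[OF closedin_closure_of closed_atLeast])
  have AC: "A \<subseteq> ?C" using A'(2) by (intro closure_of_subset) simp
  have nonpos: "Limsup at_top ?f \<le> 0"
  proof (rule Limsup_bounded)
    show "\<forall>\<^sub>F L in at_top. ?f L \<le> 0"
      using eventually_gt_at_top[of "0::real"]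
      by eventually_elim (simp add: elog_nonpos ereal_mult_le_0_iff)
  qed
  show "Limsup at_top ?f \<le> - (INF x\<in>?C. J x)"
  proof (rule ccontr)
    assume "\<not> ?thesis"
    hence "- (INF x\<in>?C. J x) < Limsup at_top ?f" by simp
    \<comment> \<open>Probabilities are at most \<open>1\<close>, so \<open>r\<close> is negative;
      this supplies \<open>0 \<le> \<alpha>\<close> for \<open>\<alpha> = - r\<close> in
      \<open>upper_bound\<close>.\<close>
    then obtain r where r: "- (INF x\<in>?C. J x) < ereal r" "ereal r < Limsup at_top ?f" using ereal_dense2 by blast
    have nr: "0 \<le> - r" using less_le_trans[OF r(2) nonpos] by (simp add: zero_ereal_def)
    have lt: "ereal (-r) < J x" if "x \<in> ?C" for x
    proof -
      have "ereal (-r) < (INF x\<in>?C. J x)" using r(1) by (metis ereal_uminus_less_reorder uminus_ereal.simps(1))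
      also have "\<dots> \<le> J x" using that by (rule INF_lower)
      finally show ?thesis .
    qed
    have ub: "\<forall>\<^sub>F L in at_top. prob {\<omega>\<in>space M. N L \<omega> / L \<in> A} \<le> exp (L * - (- r))"
      by (rule upper_bound[OF clC AC A'(1) nr]) (rule lt)
    have "\<forall>\<^sub>F L in at_top. ?f L \<le> ereal r"
      using ub eventually_gt_at_top[of "0::real"]
    proof eventually_elim
      case (elim L) thus ?case by (intro elog_le) auto
    qed
    hence "Limsup at_top ?f \<le> ereal r" by (rule Limsup_bounded)
    with r(2) show False by simp
  qed
qed

end

section \<open>Iterated kernels\<close>

lemma integrable_inverse_square:
  fixes b :: real
  assumes "b \<noteq> 0"
  shows "integrable lborel (\<lambda>x. 1 / ((x - c)\<^sup>2 + b\<^sup>2))"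
proof -
  have D: "(arctan has_real_derivative 1 / (1 + x\<^sup>2)) (at x)" for x
    by (rule DERIV_cong[OF DERIV_arctan]) (simp add: divide_inverse)
  have "set_integrable lborel (einterval (-\<infinity>) \<infinity>) (\<lambda>x. 1 / (1 + x\<^sup>2))"
  proof (rule interval_integral_FTC_nonneg)
    show "((arctan \<circ> real_of_ereal) \<longlongrightarrow> - (pi / 2)) (at_right (-\<infinity>))" "((arctan \<circ> real_of_ereal) \<longlongrightarrow> pi / 2) (at_left \<infinity>)"
      unfolding ereal_tendsto_simps by (rule tendsto_arctan_at_top tendsto_arctan_at_bot)+
    show "isCont (\<lambda>x. 1 / (1 + x\<^sup>2)) x" for x :: real
      by (intro continuous_intros) (simp add: add_nonneg_eq_0_iff)
    show "(-\<infinity>::ereal) < \<infinity>" by simp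
  qed (auto simp: D)
  hence 1: "integrable lborel (\<lambda>x::real. 1 / (1 + x\<^sup>2))" by (simp add: set_integrable_def)
  have "integrable lborel (\<lambda>x::real. 1 / (1 + (- c / b + (1 / b) * x)\<^sup>2))"
    using assms by (intro lborel_integrable_real_affine[OF 1]) simp
  hence "integrable lborel (\<lambda>x::real. (1 / b\<^sup>2) * (1 / (1 + (- c / b + (1 / b) * x)\<^sup>2)))"
    by (rule integrable_mult_right)
  moreover have "(1 / b\<^sup>2) * (1 / (1 + (- c / b + (1 / b) * x)\<^sup>2)) = 1 / ((x - c)\<^sup>2 + b\<^sup>2)" for x
  proof -
    have "- c / b + (1 / b) * x = (x - c) / b" by (simp add: diff_divide_distrib)
    hence "b\<^sup>2 * (1 + (- c / b + (1 / b) * x)\<^sup>2) = (x - c)\<^sup>2 + b\<^sup>2"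
      using assms by (simp add: power_divide distrib_left)
    thus ?thesis by (simp add: divide_divide_eq_left mult.commute[of "b\<^sup>2"])
  qed
  ultimately show ?thesis by simp
qed

lemma filterlim_of_real_at_infinity_at_bot: "filterlim (of_real :: real \<Rightarrow> 'a::real_normed_algebra_1) at_infinity at_bot"
  unfolding filterlim_at_bot_mirror filterlim_at_infinity_conv_norm_at_top
  by (simp add: filterlim_abs_real)

text \<open>The factors \<open>\<i>\<close> and \<open>-\<i>\<close> rotate both arguments into the
  right half-plane, so the branch cut of \<open>Ln\<close> is never met. The total change
  \<open>2 * pi * \<i>\<close> of the difference along the line plays the part of a residue.\<close>

lemma Ln_half_planes_tendsto:
  fixes p q :: complex
  assumes p: "Im p > 0" and q: "Im q < 0"
  shows "((\<lambda>x::real. Ln (\<i> * (of_real x - p)) - Ln (-\<i> * (of_real x - q))) \<longlongrightarrow> \<i> * pi) at_top"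
    and "((\<lambda>x::real. Ln (\<i> * (of_real x - p)) - Ln (-\<i> * (of_real x - q))) \<longlongrightarrow> - \<i> * pi) at_bot"
proof -
  have z: "((\<lambda>x::real. r / of_real x :: complex) \<longlongrightarrow> 0) at_top" "((\<lambda>x::real. r / of_real x :: complex) \<longlongrightarrow> 0) at_bot" for r
    by (intro tendsto_divide_0[OF tendsto_const] filterlim_of_real_at_infinity filterlim_of_real_at_infinity_at_bot)+
  have Lni: "Ln \<i> - Ln (-\<i>) = \<i> * pi" by (simp add: complex_eq_iff)
  have lim: "((\<lambda>x. Ln (e * (1 - p / of_real x)) - Ln (- e * (1 - q / of_real x))) \<longlongrightarrow> Ln (e * (1 - 0)) - Ln (- e * (1 - 0))) F"
    if "e = \<i> \<or> e = -\<i>" "\<And>r. ((\<lambda>x::real. r / of_real x :: complex) \<longlongrightarrow> 0) F" for e F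
  proof (rule tendsto_diff[OF tendsto_Ln tendsto_Ln])
    show "((\<lambda>x. e * (1 - p / of_real x)) \<longlongrightarrow> e * (1 - 0)) F" "((\<lambda>x. - e * (1 - q / of_real x)) \<longlongrightarrow> - e * (1 - 0)) F"
      by (rule tendsto_mult tendsto_const tendsto_diff that(2))+
  qed (use that(1) in \<open>auto simp: complex_nonpos_Reals_iff\<close>)
  show "((\<lambda>x::real. Ln (\<i> * (of_real x - p)) - Ln (-\<i> * (of_real x - q))) \<longlongrightarrow> \<i> * pi) at_top"
  proof (rule Lim_transform_eventually)
    show "((\<lambda>x. Ln (\<i> * (1 - p / of_real x)) - Ln (- \<i> * (1 - q / of_real x))) \<longlongrightarrow> \<i> * pi) at_top"
      using lim[of \<i> at_top] z(1) Lni by simp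
    show "\<forall>\<^sub>F x in at_top. Ln (\<i> * (1 - p / of_real x)) - Ln (- \<i> * (1 - q / of_real x)) =
      Ln (\<i> * (of_real x - p)) - Ln (-\<i> * (of_real x - q))"
      using eventually_gt_at_top[of "0::real"]
    proof eventually_elim
      case (elim x)
      have nz: "1 - p / of_real x \<noteq> 0" "1 - q / of_real x \<noteq> 0" using p q elim by auto
      \<comment> \<open>Both logarithms contain the same real term \<open>ln x\<close>, which
        cancels in the difference.\<close>
      have "\<i> * (of_real x - p) = of_real x * (\<i> * (1 - p / of_real x))"
        "- \<i> * (of_real x - q) = of_real x * (- \<i> * (1 - q / of_real x))" using elim by (auto simp: field_simps)
      hence "Ln (\<i> * (of_real x - p)) = Ln (of_real x * (\<i> * (1 - p / of_real x)))"
        "Ln (- \<i> * (of_real x - q)) = Ln (of_real x * (- \<i> * (1 - q / of_real x)))" by (simp_all only:)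
      moreover have "Ln (of_real x * (\<i> * (1 - p / of_real x))) = of_real (ln x) + Ln (\<i> * (1 - p / of_real x))"
        using nz elim by (subst Ln_times_of_real) (simp_all add: Ln_of_real)
      moreover have "Ln (of_real x * (- \<i> * (1 - q / of_real x))) = of_real (ln x) + Ln (- \<i> * (1 - q / of_real x))"
        using nz elim by (subst Ln_times_of_real) (simp_all add: Ln_of_real)
      ultimately have "Ln (\<i> * (of_real x - p)) = of_real (ln x) + Ln (\<i> * (1 - p / of_real x))"
        "Ln (- \<i> * (of_real x - q)) = of_real (ln x) + Ln (- \<i> * (1 - q / of_real x))" by (simp_all only:)
      thus ?case by simp
    qed
  qed
  show "((\<lambda>x::real. Ln (\<i> * (of_real x - p)) - Ln (-\<i> * (of_real x - q))) \<longlongrightarrow> - \<i> * pi) at_bot"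
  proof (rule Lim_transform_eventually)
    show "((\<lambda>x. Ln (-\<i> * (1 - p / of_real x)) - Ln (\<i> * (1 - q / of_real x))) \<longlongrightarrow> - \<i> * pi) at_bot"
      using lim[of "-\<i>" at_bot] z(2) Lni by simp
    show "\<forall>\<^sub>F x in at_bot. Ln (- \<i> * (1 - p / of_real x)) - Ln (\<i> * (1 - q / of_real x)) =
      Ln (\<i> * (of_real x - p)) - Ln (-\<i> * (of_real x - q))"
      using eventually_gt_at_bot[of "0::real"]
    proof eventually_elim
      case (elim x)
      have nz: "1 - p / of_real x \<noteq> 0" "1 - q / of_real x \<noteq> 0" using p q elim by auto
      have "\<i> * (of_real x - p) = of_real (-x) * (- \<i> * (1 - p / of_real x))"
        "- \<i> * (of_real x - q) = of_real (-x) * (\<i> * (1 - q / of_real x))" using elim by (auto simp: field_simps)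
      hence "Ln (\<i> * (of_real x - p)) = Ln (of_real (-x) * (- \<i> * (1 - p / of_real x)))"
        "Ln (- \<i> * (of_real x - q)) = Ln (of_real (-x) * (\<i> * (1 - q / of_real x)))" by (simp_all only:)
      moreover have "Ln (of_real (-x) * (- \<i> * (1 - p / of_real x))) = of_real (ln (-x)) + Ln (- \<i> * (1 - p / of_real x))"
        using Ln_of_real[of "-x"] nz elim by (subst Ln_times_of_real) simp_all
      moreover have "Ln (of_real (-x) * (\<i> * (1 - q / of_real x))) = of_real (ln (-x)) + Ln (\<i> * (1 - q / of_real x))"
        using Ln_of_real[of "-x"] nz elim by (subst Ln_times_of_real) simp_all
      ultimately have "Ln (\<i> * (of_real x - p)) = of_real (ln (-x)) + Ln (- \<i> * (1 - p / of_real x))"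
        "Ln (- \<i> * (of_real x - q)) = of_real (ln (-x)) + Ln (\<i> * (1 - q / of_real x))" by (simp_all only:)
      thus ?case by simp
    qed
  qed
qed

text \<open>Partial fractions give a primitive: with \<open>A\<close>, \<open>B\<close> the two
  linear factors, \<open>1 / (A * B)^2\<close> equals \<open>(1 / A - 1 / B)^2 / (B - A)^2\<close>.
  The rational terms vanish at both ends, so only the change of the logarithms contributes.\<close>

lemma integral_inverse_squares:
  fixes p q :: complex
  assumes p: "Im p > 0" and q: "Im q < 0"
  shows "(\<integral>x. 1 / ((of_real x - p)\<^sup>2 * (of_real x - q)\<^sup>2) \<partial>lborel) = - 4 * pi * \<i> / (p - q)^3"
proof -
  define f where "f x = 1 / ((of_real x - p)\<^sup>2 * (of_real x - q)\<^sup>2)" for x :: real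
  have nz: "of_real x - p \<noteq> 0" "of_real x - q \<noteq> 0" for x :: real
    using p q by (auto simp: complex_eq_iff)
  have pq0: "p - q \<noteq> 0" using p q by auto
  have contf: "continuous_on UNIV f" unfolding f_def by (intro continuous_intros) (use nz in auto)
  have f_int: "integrable lborel f"
  proof (rule Bochner_Integration.integrable_bound)
    show "integrable lborel (\<lambda>x. (1 / (Im q)\<^sup>2) * (1 / ((x - Re p)\<^sup>2 + (Im p)\<^sup>2)))"
      using p by (intro integrable_mult_right integrable_inverse_square) simp
    show "f \<in> borel_measurable lborel" using contf by (simp add: borel_measurable_continuous_onI)
    show "AE x in lborel. norm (f x) \<le> norm ((1 / (Im q)\<^sup>2) * (1 / ((x - Re p)\<^sup>2 + (Im p)\<^sup>2)))"
    proof (intro AE_I2)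
      fix x
      have 1: "norm ((of_real x - p)\<^sup>2) = (x - Re p)\<^sup>2 + (Im p)\<^sup>2" by (simp add: norm_power cmod_power2)
      have 2: "norm ((of_real x - q)\<^sup>2) \<ge> (Im q)\<^sup>2" by (simp add: norm_power cmod_power2)
      have pos: "(x - Re p)\<^sup>2 + (Im p)\<^sup>2 > 0" "(Im q)\<^sup>2 > 0" using p q by (auto intro: add_nonneg_pos)
      have "norm (f x) = 1 / (((x - Re p)\<^sup>2 + (Im p)\<^sup>2) * norm ((of_real x - q)\<^sup>2))"
        by (simp add: f_def norm_divide norm_mult 1)
      also have "\<dots> \<le> 1 / (((x - Re p)\<^sup>2 + (Im p)\<^sup>2) * (Im q)\<^sup>2)"
        using 2 pos by (intro divide_left_mono mult_left_mono mult_pos_pos) auto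
      finally show "norm (f x) \<le> norm ((1 / (Im q)\<^sup>2) * (1 / ((x - Re p)\<^sup>2 + (Im p)\<^sup>2)))" using pos by (simp add: mult.commute)
    qed
  qed
  define F where "F x = (1 / (p - q)\<^sup>2) * (- 1 / (of_real x - p) + - 1 / (of_real x - q) -
     2 / (p - q) * (Ln (\<i> * (of_real x - p)) - Ln (-\<i> * (of_real x - q))))" for x :: real
  have F: "(F has_vector_derivative f x) (at x)" for x
  proof -
    have d1: "((\<lambda>z. Ln (\<i> * (z - p))) has_field_derivative 1 / (of_real x - p)) (at (of_real x))"
    proof (rule DERIV_cong[OF DERIV_chain2[OF has_field_derivative_Ln]])
      show "((\<lambda>z. \<i> * (z - p)) has_field_derivative \<i>) (at (of_real x))" by (auto intro!: derivative_eq_intros)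
    qed (use nz[of x] p in \<open>auto simp: complex_nonpos_Reals_iff divide_simps\<close>)
    have d2: "((\<lambda>z. Ln (-\<i> * (z - q))) has_field_derivative 1 / (of_real x - q)) (at (of_real x))"
    proof (rule DERIV_cong[OF DERIV_chain2[OF has_field_derivative_Ln]])
      show "((\<lambda>z. -\<i> * (z - q)) has_field_derivative -\<i>) (at (of_real x))" by (auto intro!: derivative_eq_intros)
    qed (use nz[of x] q in \<open>auto simp: complex_nonpos_Reals_iff divide_simps\<close>)
    have d3: "((\<lambda>z. - 1 / (z - r)) has_field_derivative 1 / (of_real x - r)\<^sup>2) (at (of_real x))"
      if "of_real x - r \<noteq> 0" for r :: complex
      using that by (auto intro!: derivative_eq_intros simp: power2_eq_square)
    have "((\<lambda>z. (1 / (p - q)\<^sup>2) * (- 1 / (z - p) + - 1 / (z - q) -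
     2 / (p - q) * (Ln (\<i> * (z - p)) - Ln (-\<i> * (z - q))))) has_field_derivative
      (1 / (p - q)\<^sup>2) * (1 / (of_real x - p)\<^sup>2 + 1 / (of_real x - q)\<^sup>2 - 2 / (p - q) * (1 / (of_real x - p) - 1 / (of_real x - q)))) (at (of_real x))"
      by (intro DERIV_cmult DERIV_diff DERIV_add d1 d2 d3 nz pq0)
    moreover have "(1 / (p - q)\<^sup>2) * (1 / (of_real x - p)\<^sup>2 + 1 / (of_real x - q)\<^sup>2 - 2 / (p - q) * (1 / (of_real x - p) - 1 / (of_real x - q))) = f x"
    proof -
      define A where "A = of_real x - p"
      define B where "B = of_real x - q"
      have nzAB: "A \<noteq> 0" "B \<noteq> 0" "B - A \<noteq> 0" and pq: "p - q = B - A" using nz[of x] pq0 by (auto simp: A_def B_def)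
      have 1: "1 / A - 1 / B = (B - A) / (A * B)" using nzAB by (simp add: field_simps)
      have "2 / (B - A) * (1 / A - 1 / B) = 2 * (1 / A) * (1 / B)" unfolding 1 using nzAB by (simp add: divide_simps)
      hence "1 / A\<^sup>2 + 1 / B\<^sup>2 - 2 / (B - A) * (1 / A - 1 / B) = (1 / A - 1 / B)\<^sup>2"
        by (simp add: power2_diff power_divide)
      also have "\<dots> = (B - A)\<^sup>2 / (A\<^sup>2 * B\<^sup>2)" unfolding 1 by (simp add: power_divide power_mult_distrib)
      finally show ?thesis unfolding f_def pq A_def[symmetric] B_def[symmetric] using nzAB by simp
    qed
    ultimately show ?thesis unfolding F_def by (intro has_vector_derivative_real_field) simp
  qed
  have z: "((\<lambda>x::real. c / (of_real x - r) :: complex) \<longlongrightarrow> 0) at_top" "((\<lambda>x::real. c / (of_real x - r) :: complex) \<longlongrightarrow> 0) at_bot" for c r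
    using tendsto_divide_0[OF tendsto_const tendsto_add_filterlim_at_infinity'[OF filterlim_of_real_at_infinity tendsto_const], of c "- r"]
      tendsto_divide_0[OF tendsto_const tendsto_add_filterlim_at_infinity'[OF filterlim_of_real_at_infinity_at_bot tendsto_const], of c "- r"]
    by simp_all
  have lim: "(F \<longlongrightarrow> (1 / (p - q)\<^sup>2) * (0 + 0 - 2 / (p - q) * (\<i> * pi))) at_top"
    "(F \<longlongrightarrow> (1 / (p - q)\<^sup>2) * (0 + 0 - 2 / (p - q) * (- \<i> * pi))) at_bot"
    unfolding F_def
    by (rule tendsto_mult tendsto_const tendsto_diff tendsto_add z Ln_half_planes_tendsto[OF p q])+
  have "(LBINT x=-\<infinity>..\<infinity>. f x) = (1 / (p - q)\<^sup>2) * (0 + 0 - 2 / (p - q) * (\<i> * pi)) - (1 / (p - q)\<^sup>2) * (0 + 0 - 2 / (p - q) * (- \<i> * pi))"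
  proof (rule interval_integral_FTC_integrable)
    show "isCont f x" for x using contf by (simp add: continuous_on_eq_continuous_at)
    show "set_integrable lborel (einterval (-\<infinity>) \<infinity>) f" using f_int by (simp add: set_integrable_def)
    show "((F \<circ> real_of_ereal) \<longlongrightarrow> (1 / (p - q)\<^sup>2) * (0 + 0 - 2 / (p - q) * (- \<i> * pi))) (at_right (-\<infinity>))"
      "((F \<circ> real_of_ereal) \<longlongrightarrow> (1 / (p - q)\<^sup>2) * (0 + 0 - 2 / (p - q) * (\<i> * pi))) (at_left \<infinity>)"
      unfolding ereal_tendsto_simps by (rule lim)+
    show "(-\<infinity>::ereal) < \<infinity>" by simp
  qed (rule F)
  also have "\<dots> = - 4 * pi * \<i> / (p - q)^3"
    by (simp add: power2_eq_square power3_eq_cube mult_ac)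
  finally have "(\<integral>x. f x \<partial>lborel) = - 4 * pi * \<i> / (p - q)^3"
    by (simp add: interval_lebesgue_integral_def set_lebesgue_integral_def)
  thus ?thesis by (simp add: f_def)
qed

section \<open>Iterated integration over real and imaginary parts\<close>

lemma lborel_complex_eq_distr: "(lborel :: complex measure) = distr (lborel \<Otimes>\<^sub>M lborel) borel (\<lambda>(x, y). Complex x y)"
proof (rule lborel_eqI)
  have m: "(\<lambda>(x, y). Complex x y) \<in> borel_measurable (lborel \<Otimes>\<^sub>M lborel)"
    by (simp add: Complex_eq case_prod_unfold)
  fix l u :: complex assume le: "\<And>b. b \<in> Basis \<Longrightarrow> l \<bullet> b \<le> u \<bullet> b"
  have "(\<lambda>(x, y). Complex x y) -` box l u \<inter> space (lborel \<Otimes>\<^sub>M lborel) = {Re l<..<Re u} \<times> {Im l<..<Im u}"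
    by (auto simp: box_def Basis_complex_def inner_complex_def space_pair_measure)
  thus "emeasure (distr (lborel \<Otimes>\<^sub>M lborel) borel (\<lambda>(x, y). Complex x y)) (box l u) = (\<Prod>b\<in>Basis. (u - l) \<bullet> b)"
    using le[of 1] le[of \<i>] 
    by (simp add: emeasure_distr[OF m] lborel.emeasure_pair_measure_Times Basis_complex_def inner_complex_def ennreal_mult'')
qed simp

lemma measurable_Complex [measurable]: "(\<lambda>(x, y). Complex x y) \<in> borel_measurable (borel \<Otimes>\<^sub>M borel)"
  by (simp add: Complex_eq case_prod_unfold)

lemma integral_complex_iterated:
  fixes f :: "complex \<Rightarrow> 'b::{banach, second_countable_topology}"
  assumes "integrable lborel f"
  shows "(\<integral>z. f z \<partial>lborel) = (\<integral>y. (\<integral>x. f (Complex x y) \<partial>lborel) \<partial>lborel)"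
proof -
  have m: "(\<lambda>(x, y). Complex x y) \<in> borel_measurable (lborel \<Otimes>\<^sub>M lborel)"
    by (simp add: Complex_eq case_prod_unfold)
  have fm: "f \<in> borel_measurable borel" using borel_measurable_integrable[OF assms] by simp
  have "integrable (distr (lborel \<Otimes>\<^sub>M lborel) borel (\<lambda>(x, y). Complex x y)) f"
    using assms by (simp add: lborel_complex_eq_distr[symmetric])
  hence 1: "integrable (lborel \<Otimes>\<^sub>M lborel) (\<lambda>(x, y). f (Complex x y))"
    using fm by (subst (asm) integrable_distr_eq[OF m]) (auto simp: case_prod_unfold)
  have "(\<integral>z. f z \<partial>lborel) = (\<integral>z. f (case z of (x, y) \<Rightarrow> Complex x y) \<partial>(lborel \<Otimes>\<^sub>M lborel))"
    by (subst lborel_complex_eq_distr, rule integral_distr[OF m fm])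
  also have "\<dots> = (\<integral>y. (\<integral>x. f (Complex x y) \<partial>lborel) \<partial>lborel)"
    using lborel_pair.integral_snd[OF 1] by (simp add: case_prod_unfold)
  finally show "(\<integral>z. f z \<partial>lborel) = (\<integral>y. (\<integral>x. f (Complex x y) \<partial>lborel) \<partial>lborel)" .
qed

lemma integrable_complexI:
  fixes f :: "complex \<Rightarrow> 'b::{banach, second_countable_topology}"
  assumes "integrable (lborel \<Otimes>\<^sub>M lborel) (\<lambda>(x, y). f (Complex x y))" "f \<in> borel_measurable borel"
  shows "integrable lborel f"
proof -
  have m: "(\<lambda>(x, y). Complex x y) \<in> borel_measurable (lborel \<Otimes>\<^sub>M lborel)"
    by (simp add: Complex_eq case_prod_unfold)
  show ?thesis
    using assms by (subst lborel_complex_eq_distr, subst integrable_distr_eq[OF m]) (auto simp: case_prod_unfold)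
qed

text \<open>The kernel of the operator power \<open>n + 1\<close>: the identity operator has no such
  kernel, so the count starts at the kernel itself. This shift causes every \<open>Suc k\<close> in
  the trace formulas below.\<close>

primrec iter_kernel :: "('a::euclidean_space \<Rightarrow> 'a \<Rightarrow> complex) \<Rightarrow> nat \<Rightarrow> 'a \<Rightarrow> 'a \<Rightarrow> complex" where
  "iter_kernel k 0 z w = k z w"
| "iter_kernel k (Suc n) z w = (\<integral>v. k z v * iter_kernel k n v w \<partial>lborel)"

lemma iter_kernel_measurable:
  assumes k: "case_prod k \<in> borel_measurable (lborel \<Otimes>\<^sub>M lborel)"
  shows "case_prod (iter_kernel k n) \<in> borel_measurable (lborel \<Otimes>\<^sub>M lborel)"
proof (induction n)
  case (Suc n)
  note [measurable] = Suc k
  have "(\<lambda>p. \<integral>v. k (fst p) v * iter_kernel k n v (snd p) \<partial>lborel) \<in> borel_measurable (lborel \<Otimes>\<^sub>M lborel)"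
    by measurable
  thus ?case by (simp add: case_prod_unfold)
qed (use k in simp)

text \<open>Each integration costs one row mass, at most \<open>C\<close>, and the last factor is
  bounded pointwise by \<open>M\<close>. When \<open>D\<close> ignores the window, the bound is
  uniform in its length.\<close>

lemma iter_kernel_bound:
  assumes k: "case_prod k \<in> borel_measurable (lborel \<Otimes>\<^sub>M lborel)"
    and D: "\<And>z v. norm (k z v) \<le> D z v" "\<And>z. integrable lborel (D z)" "\<And>z. (\<integral>v. D z v \<partial>lborel) \<le> C"
    and M: "\<And>z v. norm (k z v) \<le> M"
  shows "norm (iter_kernel k n z w) \<le> M * C ^ n"
proof -
  have M0: "0 \<le> M" using order_trans[OF norm_ge_zero M] .
  have "0 \<le> (\<integral>v. D undefined v \<partial>lborel)" by (intro integral_nonneg_AE AE_I2) (rule order_trans[OF norm_ge_zero D(1)])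
  hence C0: "0 \<le> C" using D(3)[of undefined] by linarith
  have int: "integrable lborel (\<lambda>v. k z v * iter_kernel k n v w)"
    if "\<And>z. norm (iter_kernel k n z w) \<le> M * C ^ n" for n z
  proof (rule Bochner_Integration.integrable_bound)
    show "integrable lborel (\<lambda>v. D z v * (M * C ^ n))" using D(2) by simp
    note [measurable] = k iter_kernel_measurable[OF k, of n]
    show "(\<lambda>v. k z v * iter_kernel k n v w) \<in> borel_measurable lborel" by measurable
    show "AE v in lborel. norm (k z v * iter_kernel k n v w) \<le> norm (D z v * (M * C ^ n))"
      unfolding norm_mult using M0 C0
      by (intro AE_I2 mult_mono order_trans[OF D(1)] order_trans[OF that]) auto
  qed
  have bound: "norm (iter_kernel k n z w) \<le> M * C ^ n" for n z
  proof (induction n arbitrary: z)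
    case (Suc n)
    have "norm (iter_kernel k (Suc n) z w) \<le> (\<integral>v. D z v * (M * C ^ n) \<partial>lborel)"
      unfolding iter_kernel.simps
    proof (rule Bochner_Integration.integral_norm_bound_integral)
      show "integrable lborel (\<lambda>v. D z v * (M * C ^ n))" using D(2) by simp
      show "norm (k z v * iter_kernel k n v w) \<le> D z v * (M * C ^ n)" for v
        unfolding norm_mult using M0 C0 by (intro mult_mono D Suc order_trans[OF norm_ge_zero D(1)]) auto
    qed (rule int[OF Suc])
    also have "\<dots> = (\<integral>v. D z v \<partial>lborel) * (M * C ^ n)" by simp
    also have "\<dots> \<le> C * (M * C ^ n)" using D(3) M0 C0 by (intro mult_right_mono) auto
    finally show ?case by (simp add: mult_ac)
  qed (use M in simp)
  show "norm (iter_kernel k n z w) \<le> M * C ^ n" by (rule bound)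
qed

text \<open>The uniform bound on the lower iterates turns a multiple of \<open>D z\<close> into a
  majorant at every power.\<close>

lemma iter_kernel_tendsto:
  assumes k: "\<And>i. case_prod (k i) \<in> borel_measurable (lborel \<Otimes>\<^sub>M lborel)"
    and k': "case_prod k' \<in> borel_measurable (lborel \<Otimes>\<^sub>M lborel)"
    and D: "\<And>i z v. norm (k i z v) \<le> D z v" "\<And>z. integrable lborel (D z)" "\<And>z. (\<integral>v. D z v \<partial>lborel) \<le> C"
    and M: "\<And>i z v. norm (k i z v) \<le> M"
    and lim: "\<And>z v. (\<lambda>i. k i z v) \<longlonglongrightarrow> k' z v"
  shows "(\<lambda>i. iter_kernel (k i) n z w) \<longlonglongrightarrow> iter_kernel k' n z w"
proof (induction n arbitrary: z)
  case (Suc n)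
  have M0: "0 \<le> M" using order_trans[OF norm_ge_zero M] .
  show ?case unfolding iter_kernel.simps
  proof (rule integral_dominated_convergence)
    note [measurable] = k iter_kernel_measurable[OF k, of _ n] k' iter_kernel_measurable[OF k', of n]
    show "(\<lambda>v. k' z v * iter_kernel k' n v w) \<in> borel_measurable lborel"
      "(\<lambda>v. k i z v * iter_kernel (k i) n v w) \<in> borel_measurable lborel" for i by measurable
    show "integrable lborel (\<lambda>v. D z v * (M * C ^ n))" using D(2) by simp
    show "AE v in lborel. (\<lambda>i. k i z v * iter_kernel (k i) n v w) \<longlonglongrightarrow> k' z v * iter_kernel k' n v w"
      by (intro AE_I2 tendsto_mult lim Suc)
    show "AE v in lborel. norm (k i z v * iter_kernel (k i) n v w) \<le> D z v * (M * C ^ n)" for i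
      unfolding norm_mult
      by (intro AE_I2 mult_mono D iter_kernel_bound[OF k D M] order_trans[OF norm_ge_zero D(1)]) auto
  qed
qed (use lim in simp)

lemma iter_kernel_translate:
  assumes k: "case_prod k \<in> borel_measurable (lborel \<Otimes>\<^sub>M lborel)"
  shows "iter_kernel (\<lambda>z w. k (z + s) (w + s)) n z w = iter_kernel k n (z + s) (w + s)"
proof (induction n arbitrary: z)
  case (Suc n)
  note [measurable] = k iter_kernel_measurable[OF k, of n]
  have m: "(\<lambda>v. k (z + s) v * iter_kernel k n v (w + s)) \<in> borel_measurable lborel" by measurable
  have "iter_kernel k (Suc n) (z + s) (w + s) = (\<integral>v. k (z + s) v * iter_kernel k n v (w + s) \<partial>distr lborel borel ((+) s))"
    by (simp add: lborel_distr_plus)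
  also have "\<dots> = (\<integral>v. k (z + s) (s + v) * iter_kernel k n (s + v) (w + s) \<partial>lborel)"
    by (rule integral_distr) (use m in auto)
  finally show ?case using Suc by (simp add: add.commute)
qed simp

lemma iter_kernel_eq_0: "(\<And>v. k z v = 0) \<Longrightarrow> iter_kernel k n z w = 0"
  by (cases n) auto

section \<open>Traces of the restricted kernel\<close>

lemma
  fixes g h :: "real \<Rightarrow> real"
  assumes g: "integrable lborel g" and h: "integrable lborel h"
  shows integrable_complex_Re_Im: "integrable lborel (\<lambda>z. g (Re z) * h (Im z))"
    and integral_complex_Re_Im: "(\<integral>z. g (Re z) * h (Im z) \<partial>lborel) = (\<integral>x. g x \<partial>lborel) * (\<integral>y. h y \<partial>lborel)"
proof -
  have [measurable]: "g \<in> borel_measurable borel" "h \<in> borel_measurable borel"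
    using borel_measurable_integrable[OF g] borel_measurable_integrable[OF h] by auto
  have "integrable (lborel \<Otimes>\<^sub>M lborel) (\<lambda>(x, y). g x * h y)"
  proof (rule lborel_pair.Fubini_integrable)
    show "(\<lambda>(x, y). g x * h y) \<in> borel_measurable (lborel \<Otimes>\<^sub>M lborel)" by measurable
    show "integrable lborel (\<lambda>x. \<integral>y. norm (case (x, y) of (x, y) \<Rightarrow> g x * h y) \<partial>lborel)"
      using g h by (simp add: abs_mult)
    show "AE x in lborel. integrable lborel (\<lambda>y. case (x, y) of (x, y) \<Rightarrow> g x * h y)"
      using h by simp
  qed
  thus 1: "integrable lborel (\<lambda>z. g (Re z) * h (Im z))"
    by (intro integrable_complexI) auto
  show "(\<integral>z. g (Re z) * h (Im z) \<partial>lborel) = (\<integral>x. g x \<partial>lborel) * (\<integral>y. h y \<partial>lborel)"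
    by (simp add: integral_complex_iterated[OF 1])
qed

lemma integrable_indicator_Icc: "integrable lborel (indicator {r..s::real} :: real \<Rightarrow> real)"
  by (rule integrable_real_indicator) (auto simp: emeasure_lborel_Icc_eq)

lemma K_H_translate: "K_H (z + of_real s) (w + of_real s) = K_H z w"
  by (simp add: K_H_def)

lemma norm_K_H: "norm (K_H z w) = 1 / (pi * ((Re w - Re z)\<^sup>2 + (Im z + Im w)\<^sup>2))"
proof -
  have "norm ((z - cnj w)\<^sup>2) = (Re z - Re w)\<^sup>2 + (Im z + Im w)\<^sup>2" by (simp add: norm_power cmod_power2)
  thus ?thesis by (simp add: K_H_def norm_divide norm_mult power2_commute)
qed

lemma K_H_measurable [measurable]: "case_prod K_H \<in> borel_measurable (borel \<Otimes>\<^sub>M borel)"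
proof -
  have [measurable]: "cnj \<in> borel_measurable borel"
    by (intro borel_measurable_continuous_onI continuous_intros)
  show ?thesis unfolding K_H_def by measurable
qed

definition restrict_kernel :: "complex set \<Rightarrow> complex \<Rightarrow> complex \<Rightarrow> complex" where
  "restrict_kernel W z w = (if z \<in> W \<and> w \<in> W then K_H z w else 0)"

definition strip :: "real \<Rightarrow> complex set" where
  "strip a = {z. 1 \<le> Im z \<and> Im z \<le> a}"

definition window :: "real \<Rightarrow> real \<Rightarrow> real \<Rightarrow> complex set" where
  "window a r s = {z. r \<le> Re z \<and> Re z \<le> s \<and> 1 \<le> Im z \<and> Im z \<le> a}"

lemma strip_borel [measurable]: "strip a \<in> sets borel"
  unfolding strip_def by measurable

lemma window_borel [measurable]: "window a r s \<in> sets borel"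
  unfolding window_def by measurable

lemma window_subset_strip: "window a r s \<subseteq> strip a"
  by (auto simp: window_def strip_def)

lemma restrict_kernel_measurable:
  assumes [measurable]: "W \<in> sets borel"
  shows "case_prod (restrict_kernel W) \<in> borel_measurable (lborel \<Otimes>\<^sub>M lborel)"
  unfolding restrict_kernel_def by measurable

text \<open>On a strip both heights are at least \<open>1\<close>, whence the constant
  \<open>2^2\<close> in place of the squared sum of heights. The product form makes the integral
  factor, and nothing depends on the length of a window.\<close>

definition kernel_majorant :: "real \<Rightarrow> complex \<Rightarrow> complex \<Rightarrow> real" where
  "kernel_majorant a z v = 1 / ((Re v - Re z)\<^sup>2 + 2\<^sup>2) * (indicator {1..a} (Im v) / pi)"

definition majorant_mass :: "real \<Rightarrow> real" where
  "majorant_mass a = (\<integral>x. 1 / (x\<^sup>2 + 2\<^sup>2) \<partial>lborel) * (\<integral>y. indicator {1..a} y / pi \<partial>lborel)"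

lemma
  shows kernel_majorant_integrable: "integrable lborel (kernel_majorant a z)"
    and kernel_majorant_integral: "(\<integral>v. kernel_majorant a z v \<partial>lborel) = majorant_mass a"
proof -
  have 1: "integrable lborel (\<lambda>x. 1 / ((x - Re z)\<^sup>2 + 2\<^sup>2))" by (rule integrable_inverse_square) simp
  have 2: "integrable lborel (\<lambda>y. indicator {1..a} y / pi)"
    by (intro integrable_divide integrable_indicator_Icc)
  show "integrable lborel (kernel_majorant a z)"
    unfolding kernel_majorant_def using integrable_complex_Re_Im[OF 1 2] .
  have "(\<integral>x. 1 / ((x - Re z)\<^sup>2 + 2\<^sup>2) \<partial>lborel) = (\<integral>x. 1 / (x\<^sup>2 + 2\<^sup>2) \<partial>lborel)"
    by (subst lborel_integral_real_affine[where c = 1 and t = "Re z"]) auto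
  thus "(\<integral>v. kernel_majorant a z v \<partial>lborel) = majorant_mass a"
    unfolding kernel_majorant_def majorant_mass_def using integral_complex_Re_Im[OF 1 2] by simp
qed

lemma restrict_kernel_majorant:
  assumes "W \<subseteq> strip a"
  shows "norm (restrict_kernel W z v) \<le> kernel_majorant a z v"
proof (cases "z \<in> W \<and> v \<in> W")
  case True
  hence i: "1 \<le> Im z" "1 \<le> Im v" "Im v \<le> a" using assms by (auto simp: strip_def)
  have "(2::real)\<^sup>2 \<le> (Im z + Im v)\<^sup>2" using i by (intro power_mono) auto
  moreover have "(0::real) < 2\<^sup>2" by simp
  ultimately have "0 < (Im z + Im v)\<^sup>2" by (rule less_le_trans[rotated])
  hence "1 / (pi * ((Re v - Re z)\<^sup>2 + (Im z + Im v)\<^sup>2)) \<le> 1 / (pi * ((Re v - Re z)\<^sup>2 + 2\<^sup>2))"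
    using \<open>2\<^sup>2 \<le> _\<close> by (intro divide_left_mono mult_left_mono mult_pos_pos) (auto intro: add_nonneg_pos)
  thus ?thesis using True i by (simp add: restrict_kernel_def kernel_majorant_def norm_K_H mult.commute)
qed (auto simp: restrict_kernel_def kernel_majorant_def)

lemma kernel_majorant_le: "kernel_majorant a z v \<le> 1"
proof -
  have "1 / ((Re v - Re z)\<^sup>2 + 2\<^sup>2) \<le> 1 / 1" by (intro divide_left_mono) (auto intro: add_nonneg_pos)
  moreover have "indicator {1..a} (Im v) / pi \<le> 1" using pi_ge_two by (auto simp: indicator_def)
  ultimately show ?thesis unfolding kernel_majorant_def
    by (intro mult_le_one) (auto simp: indicator_def)
qed

lemmas restrict_kernel_le_1 = order_trans[OF restrict_kernel_majorant kernel_majorant_le]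

text \<open>Closed form of the iterated kernels of the strip, as functions of \<open>z - cnj w\<close>: the \<open>n\<close>-th one is
  \<open>(1/\<pi>) \<integral> \<xi> exp (i \<xi> u) m(\<xi>)\<^sup>n d\<xi>\<close> over \<open>\<xi> > 0\<close> with \<open>m(\<xi>) = exp (-2 \<xi>) - exp (-2 a \<xi>)\<close>, and multiplication
  of the integrand by \<open>m\<close> becomes a difference of translates.\<close>

primrec bulk :: "real \<Rightarrow> nat \<Rightarrow> complex \<Rightarrow> complex" where
  "bulk a 0 u = - 1 / (complex_of_real pi * u\<^sup>2)"
| "bulk a (Suc n) u = bulk a n (u + 2 * \<i>) - bulk a n (u + 2 * \<i> * a)"

lemma bulk_measurable [measurable]: "bulk a n \<in> borel_measurable borel"
proof (induction n)
  case 0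
  have "bulk a 0 = (\<lambda>u. - 1 / (complex_of_real pi * u\<^sup>2))" by auto
  thus ?case by simp
next
  case (Suc n)
  note [measurable] = Suc
  have "bulk a (Suc n) = (\<lambda>u. bulk a n (u + 2 * \<i>) - bulk a n (u + 2 * \<i> * a))" by auto
  thus ?case by simp
qed

text \<open>At height \<open>y\<close> the integral along the horizontal line has the pole
  \<open>z + \<i> * y\<close> above and \<open>w - \<i> * y\<close> below. It is a multiple of the
  inverse cube of \<open>z - w + 2 * \<i> * y\<close>, whose primitive in \<open>y\<close> leaves
  just the end points \<open>1\<close> and \<open>a\<close>: the two translates in the recursion for
  \<open>bulk\<close>.\<close>

lemma bulk_convolution_0:
  assumes a: "a > 1" and z: "z \<in> strip a" and w: "Im w \<le> - 1"
  shows "integrable lborel (\<lambda>v. restrict_kernel (strip a) z v * bulk a 0 (v - w))"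
    and "(\<integral>v. restrict_kernel (strip a) z v * bulk a 0 (v - w) \<partial>lborel) = bulk a (Suc 0) (z - w)"
proof -
  let ?f = "\<lambda>v. restrict_kernel (strip a) z v * bulk a 0 (v - w)"
  note [measurable] = restrict_kernel_measurable[OF strip_borel, of a]
  show int: "integrable lborel ?f"
  proof (rule Bochner_Integration.integrable_bound[OF kernel_majorant_integrable[of a z]])
    show "?f \<in> borel_measurable lborel" by measurable
    show "AE v in lborel. norm (?f v) \<le> norm (kernel_majorant a z v)"
    proof (intro AE_I2)
      fix v
      show "norm (?f v) \<le> norm (kernel_majorant a z v)"
      proof (cases "v \<in> strip a")
        case True
        have "1 \<le> Im (v - w)" using True w by (simp add: strip_def)
        also have "\<dots> \<le> norm (v - w)" using abs_Im_le_cmod[of "v - w"] by simp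
        finally have "1 \<le> (norm (v - w))\<^sup>2" by simp
        hence "1 * 1 \<le> pi * (norm (v - w))\<^sup>2" using pi_ge_two by (intro mult_mono) auto
        hence "norm (bulk a 0 (v - w)) \<le> 1" by (simp add: norm_divide norm_mult norm_power)
        hence "norm (?f v) \<le> norm (restrict_kernel (strip a) z v) * 1" unfolding norm_mult by (intro mult_left_mono) auto
        also have "\<dots> \<le> norm (kernel_majorant a z v)" using restrict_kernel_majorant[of "strip a" a z v] by simp
        finally show ?thesis .
      qed (simp add: restrict_kernel_def)
    qed
  qed
  have inner: "(\<integral>x. ?f (Complex x y) \<partial>lborel) = indicator {1..a} y *\<^sub>R (- 4 * \<i> / (pi * (z - w + 2 * \<i> * y) ^ 3))" for y
  proof (cases "y \<in> {1..a}")
    case True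
    let ?p = "z + \<i> * y" and ?q = "w - \<i> * y"
    have "?f (Complex x y) = 1 / (of_real pi * of_real pi) * (1 / ((of_real x - ?p)\<^sup>2 * (of_real x - ?q)\<^sup>2))" for x
    proof -
      define v where "v = Complex x y"
      have v: "z - cnj v = - (of_real x - ?p)" "v - w = of_real x - ?q" "v \<in> strip a"
        using True by (auto simp: v_def complex_eq_iff strip_def)
      show ?thesis unfolding v_def[symmetric] using z by (simp add: restrict_kernel_def K_H_def v power2_minus del: minus_diff_eq)
    qed
    hence "(\<integral>x. ?f (Complex x y) \<partial>lborel) = 1 / (of_real pi * of_real pi) * (\<integral>x. 1 / ((of_real x - ?p)\<^sup>2 * (of_real x - ?q)\<^sup>2) \<partial>lborel)"
      by (simp only: Bochner_Integration.integral_mult_right_zero)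
    also have "(\<integral>x. 1 / ((of_real x - ?p)\<^sup>2 * (of_real x - ?q)\<^sup>2) \<partial>lborel) = - 4 * pi * \<i> / (?p - ?q)^3"
      using True z w by (intro integral_inverse_squares) (auto simp: strip_def)
    also have "?p - ?q = z - w + 2 * \<i> * y" by simp
    finally show ?thesis using True by (simp add: field_simps)
  next
    case False
    hence "restrict_kernel (strip a) z (Complex x y) = 0" for x by (auto simp: restrict_kernel_def strip_def)
    thus ?thesis using False by simp
  qed
  have nz: "z - w + 2 * \<i> * of_real y \<noteq> 0" if "1 \<le> y" for y
  proof
    assume "z - w + 2 * \<i> * of_real y = 0"
    hence "Im (z - w + 2 * \<i> * of_real y) = 0" by simp
    thus False using z w that by (simp add: strip_def)
  qed
  have "(\<integral>y. indicator {1..a} y *\<^sub>R (- 4 * \<i> / (pi * (z - w + 2 * \<i> * y) ^ 3)) \<partial>lborel)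
      = 1 / (pi * (z - w + 2 * \<i> * a)\<^sup>2) - 1 / (pi * (z - w + 2 * \<i> * 1)\<^sup>2)"
  proof (subst integral_FTC_atLeastAtMost[where F = "\<lambda>y. 1 / (pi * (z - w + 2 * \<i> * of_real y)\<^sup>2)"])
    fix y assume y: "1 \<le> y" "y \<le> a"
    have "((\<lambda>u. 1 / (pi * (z - w + 2 * \<i> * u)\<^sup>2)) has_field_derivative (- 4 * \<i> / (pi * (z - w + 2 * \<i> * y) ^ 3))) (at (of_real y))"
      using nz[OF y(1)] by (auto intro!: derivative_eq_intros simp: divide_simps power2_eq_square power3_eq_cube)
    hence "((\<lambda>y. 1 / (pi * (z - w + 2 * \<i> * of_real y)\<^sup>2)) has_vector_derivative (- 4 * \<i> / (pi * (z - w + 2 * \<i> * y) ^ 3))) (at y)"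
      by (rule has_vector_derivative_real_field)
    thus "((\<lambda>y. 1 / (pi * (z - w + 2 * \<i> * of_real y)\<^sup>2)) has_vector_derivative (- 4 * \<i> / (pi * (z - w + 2 * \<i> * y) ^ 3))) (at y within {1..a})"
      by (rule has_vector_derivative_at_within)
  qed (use a nz in \<open>auto intro!: continuous_intros\<close>)
  hence "(\<integral>v. ?f v \<partial>lborel) = 1 / (pi * (z - w + 2 * \<i> * a)\<^sup>2) - 1 / (pi * (z - w + 2 * \<i> * 1)\<^sup>2)"
    by (simp only: integral_complex_iterated[OF int] inner)
  thus "(\<integral>v. ?f v \<partial>lborel) = bulk a (Suc 0) (z - w)" by simp
qed

text \<open>The recursion moves \<open>w\<close> down by \<open>2 * \<i>\<close> and by
  \<open>2 * \<i> * a\<close>, out of the conjugate strip; the induction therefore runs over all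
  \<open>w\<close> with \<open>Im w \<le> - 1\<close>.\<close>

lemma bulk_convolution:
  assumes a: "a > 1" and z: "z \<in> strip a" and w: "Im w \<le> - 1"
  shows "integrable lborel (\<lambda>v. restrict_kernel (strip a) z v * bulk a n (v - w)) \<and>
     (\<integral>v. restrict_kernel (strip a) z v * bulk a n (v - w) \<partial>lborel) = bulk a (Suc n) (z - w)"
  using w
proof (induction n arbitrary: w)
  case 0 thus ?case using bulk_convolution_0[OF a z] by blast
next
  case (Suc n)
  have 1: "Im (w - 2 * \<i>) \<le> - 1" "Im (w - 2 * \<i> * a) \<le> - 1" using Suc.prems a by auto
  note IH = Suc.IH[OF 1(1)] Suc.IH[OF 1(2)]
  have e: "v - w + 2 * \<i> = v - (w - 2 * \<i>)" "v - w + 2 * \<i> * a = v - (w - 2 * \<i> * a)" for v by auto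
  have eq: "restrict_kernel (strip a) z v * bulk a (Suc n) (v - w) =
    restrict_kernel (strip a) z v * bulk a n (v - (w - 2 * \<i>)) - restrict_kernel (strip a) z v * bulk a n (v - (w - 2 * \<i> * a))" for v
    by (simp only: bulk.simps(2) e right_diff_distrib)
  show ?case unfolding eq
    using IH by (subst Bochner_Integration.integral_diff) (auto simp only: Bochner_Integration.integrable_diff bulk.simps(2)[of a "Suc n" "z - w"] e)
qed

lemma iter_kernel_strip:
  assumes a: "a > 1" and z: "z \<in> strip a" and w: "w \<in> strip a"
  shows "iter_kernel (restrict_kernel (strip a)) n z w = bulk a n (z - cnj w)"
  using z
proof (induction n arbitrary: z)
  case 0 thus ?case using w by (simp add: restrict_kernel_def K_H_def)
next
  case (Suc n)
  have eq: "restrict_kernel (strip a) z v * iter_kernel (restrict_kernel (strip a)) n v w = restrict_kernel (strip a) z v * bulk a n (v - cnj w)" for v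
    by (cases "v \<in> strip a") (simp_all add: Suc.IH restrict_kernel_def)
  have "Im (cnj w) \<le> - 1" using w by (simp add: strip_def)
  thus ?case unfolding iter_kernel.simps(2) eq using bulk_convolution[OF a Suc.prems, of "cnj w" n] by blast
qed

text \<open>Up to sign a primitive of \<open>bulk\<close> along the imaginary axis. It obeys the
  same recursion and is a Laplace transform of a power of the symbol, so it links the closed form of
  the kernel with moments.\<close>

primrec bulk_primitive :: "real \<Rightarrow> nat \<Rightarrow> real \<Rightarrow> real" where
  "bulk_primitive a 0 c = 1 / (pi * c)"
| "bulk_primitive a (Suc n) c = bulk_primitive a n (c + 2) - bulk_primitive a n (c + 2 * a)"

lemma bulk_imaginary_axis:
  assumes a: "a > 1" and c: "c > 0"
  shows "(bulk_primitive a n has_real_derivative - Re (bulk a n (\<i> * c))) (at c)" "Im (bulk a n (\<i> * c)) = 0"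
  using c
proof (induction n arbitrary: c)
  case 0
  {
    case 1
    have "bulk_primitive a 0 = (\<lambda>c. 1 / (pi * c))" by auto
    moreover have "((\<lambda>c. 1 / (pi * c)) has_real_derivative - (1 / (pi * c\<^sup>2))) (at c)"
      using 1 by (auto intro!: derivative_eq_intros simp: field_simps power2_eq_square)
    ultimately show ?case by (simp add: power_mult_distrib flip: of_real_power of_real_mult)
  next
    case 2 show ?case by (simp add: power_mult_distrib flip: of_real_power of_real_mult)
  }
next
  case (Suc n)
  have e: "\<i> * of_real c + 2 * \<i> = \<i> * of_real (c + 2)" "\<i> * of_real c + 2 * \<i> * of_real a = \<i> * of_real (c + 2 * a)" for c
    by (auto simp: algebra_simps)
  {
    case 1
    have d: "((\<lambda>c. bulk_primitive a n (c + r)) has_real_derivative - Re (bulk a n (\<i> * of_real (c + r)))) (at c)" if "r > 0" for r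
      using DERIV_shift[THEN iffD1, OF Suc(1)[of "c + r"]] 1 that by simp
    have "bulk_primitive a (Suc n) = (\<lambda>c. bulk_primitive a n (c + 2) - bulk_primitive a n (c + 2 * a))" by auto
    thus ?case using DERIV_diff[OF d[of 2] d[of "2*a"]] a by (simp only: bulk.simps(2) e) simp
  next
    case 2 thus ?case using Suc(2)[of "c + 2"] Suc(2)[of "c + 2 * a"] a by (simp only: bulk.simps(2) e) simp
  }
qed

text \<open>Equals \<open>2 * \<xi> * exp (- 2 * \<xi> * y)\<close> integrated over
  \<open>1 \<le> y \<le> a\<close>: the share of the strip in the squared norm of the mode of
  frequency \<open>\<xi>\<close>.\<close>

definition symbol :: "real \<Rightarrow> real \<Rightarrow> real" where
  "symbol a \<xi> = exp (- 2 * \<xi>) - exp (- 2 * a * \<xi>)"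

lemma symbol_bounds:
  assumes "a > 1" "\<xi> > 0"
  shows "0 < symbol a \<xi>" "symbol a \<xi> < 1"
proof -
  have "exp (- 2 * a * \<xi>) < exp (- 2 * \<xi>)" "exp (- 2 * \<xi>) < 1" using assms by auto
  thus "0 < symbol a \<xi>" "symbol a \<xi> < 1" unfolding symbol_def using exp_gt_zero[of "- 2 * a * \<xi>"] by linarith+
qed

lemma symbol_measurable [measurable]: "symbol a \<in> borel_measurable borel"
  unfolding symbol_def by measurable

lemma
  fixes c :: real
  assumes c: "c > 0"
  shows exp_integrable: "set_integrable lborel {0<..} (\<lambda>\<xi>. exp (- c * \<xi>))"
    and exp_integral: "(LBINT \<xi>:{0<..}. exp (- c * \<xi>)) = 1 / c"
proof -
  have lim: "((\<lambda>\<xi>. - exp (- c * \<xi>) / c) \<longlongrightarrow> - 0 / c) at_top"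
  proof (intro tendsto_intros)
    show "((\<lambda>\<xi>. exp (- c * \<xi>)) \<longlongrightarrow> 0) at_top"
      by (rule filterlim_compose[OF exp_at_bot]) (use c in \<open>simp add: filterlim_uminus_at_bot filterlim_tendsto_pos_mult_at_top[OF tendsto_const _ filterlim_ident]\<close>)
  qed (use c in simp)
  have lim0: "((\<lambda>\<xi>. - exp (- c * \<xi>) / c) \<longlongrightarrow> - exp (- c * 0) / c) (at_right 0)"
    by (intro tendsto_intros) (use c in simp)
  have 1: "set_integrable lborel (einterval 0 \<infinity>) (\<lambda>\<xi>. exp (- c * \<xi>))" "(LBINT \<xi>=0..\<infinity>. exp (- c * \<xi>)) = - 0 / c - - exp (- c * 0) / c"
    using c lim lim0 
    by (intro interval_integral_FTC_nonneg[where F = "\<lambda>\<xi>. - exp (- c * \<xi>) / c"];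
        auto intro!: derivative_eq_intros simp: ereal_tendsto_simps zero_ereal_def)+
  have e: "einterval 0 \<infinity> = {0<..}" by (auto simp: einterval_def)
  from 1 show "set_integrable lborel {0<..} (\<lambda>\<xi>. exp (- c * \<xi>))" "(LBINT \<xi>:{0<..}. exp (- c * \<xi>)) = 1 / c"
    by (simp_all add: e interval_lebesgue_integral_def)
qed

lemma exp_symbol_integrable:
  assumes a: "a > 1" and c: "c > 0"
  shows "set_integrable lborel {0<..} (\<lambda>\<xi>. exp (- c * \<xi>) * symbol a \<xi> ^ n)"
proof (rule set_integrable_bound[OF exp_integrable[OF c]])
  show "set_borel_measurable lborel {0<..} (\<lambda>\<xi>. exp (- c * \<xi>) * symbol a \<xi> ^ n)"
    unfolding set_borel_measurable_def by measurable
  show "AE x in lborel. x \<in> {0<..} \<longrightarrow> norm (exp (- c * x) * symbol a x ^ n) \<le> norm (exp (- c * x))"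
    using symbol_bounds[OF a] by (auto intro!: power_le_one mult_left_le simp: abs_mult less_imp_le)
qed

text \<open>Multiplying \<open>exp (- c * \<xi>)\<close> by the symbol produces the difference of
  the shifts of \<open>c\<close> by \<open>2\<close> and by \<open>2 * a\<close>, which is the
  recursion of \<open>bulk_primitive\<close>.\<close>

lemma bulk_primitive_eq:
  assumes a: "a > 1" and c: "c > 0"
  shows "bulk_primitive a n c = (1 / pi) * (LBINT \<xi>:{0<..}. exp (- c * \<xi>) * symbol a \<xi> ^ n)"
  using c
proof (induction n arbitrary: c)
  case 0 thus ?case using exp_integral[of c] by simp
next
  case (Suc n)
  have "exp (- c * \<xi>) * symbol a \<xi> ^ Suc n = exp (- (c + 2) * \<xi>) * symbol a \<xi> ^ n - exp (- (c + 2 * a) * \<xi>) * symbol a \<xi> ^ n" for \<xi>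
  proof -
    have "exp (- c * \<xi>) * symbol a \<xi> = exp (- (c + 2) * \<xi>) - exp (- (c + 2 * a) * \<xi>)"
      unfolding symbol_def right_diff_distrib exp_add[symmetric] by (simp add: algebra_simps)
    thus ?thesis by (simp only: power_Suc mult.assoc[symmetric] left_diff_distrib)
  qed
  moreover have "(LBINT \<xi>:{0<..}. exp (- (c + 2) * \<xi>) * symbol a \<xi> ^ n - exp (- (c + 2 * a) * \<xi>) * symbol a \<xi> ^ n) =
    (LBINT \<xi>:{0<..}. exp (- (c + 2) * \<xi>) * symbol a \<xi> ^ n) - (LBINT \<xi>:{0<..}. exp (- (c + 2 * a) * \<xi>) * symbol a \<xi> ^ n)"
    using Suc.prems a by (intro set_integral_diff exp_symbol_integrable) auto
  ultimately show ?case using Suc.IH[of "c + 2"] Suc.IH[of "c + 2 * a"] Suc.prems a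
    by (simp add: right_diff_distrib del: power_Suc)
qed

text \<open>The trace per unit length of the power \<open>n + 1\<close> on the strip, with the index
  shift of \<open>iter_kernel\<close>; \<open>1 / (2 * pi)\<close> is the Fourier density of
  frequencies.\<close>

definition symbol_moment :: "real \<Rightarrow> nat \<Rightarrow> real" where
  "symbol_moment a n = (1 / (2 * pi)) * (LBINT \<xi>:{0<..}. symbol a \<xi> ^ Suc n)"

lemma symbol_power_integrable:
  assumes a: "a > 1"
  shows "set_integrable lborel {0<..} (\<lambda>\<xi>. symbol a \<xi> ^ Suc n)"
proof -
  have eq: "symbol a \<xi> ^ Suc n = exp (- 2 * \<xi>) * symbol a \<xi> ^ n - exp (- (2 * a) * \<xi>) * symbol a \<xi> ^ n" for \<xi>
    by (simp add: symbol_def algebra_simps)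
  show ?thesis unfolding eq by (intro set_integral_diff exp_symbol_integrable) (use a in auto)
qed

text \<open>On the diagonal, \<open>z - cnj z\<close> is \<open>2 * \<i> * y\<close>. The difference
  of the primitive at \<open>c = 2\<close> and \<open>c = 2 * a\<close> contributes one further
  factor of the symbol, hence the exponent \<open>Suc n\<close>.\<close>

lemma integral_bulk_diagonal:
  assumes a: "a > 1"
  shows "(\<integral>y. indicator {1..a} y *\<^sub>R bulk a n (2 * \<i> * y) \<partial>lborel) = of_real (symbol_moment a n)"
proof -
  have eq: "symbol a \<xi> ^ Suc n = exp (- 2 * \<xi>) * symbol a \<xi> ^ n - exp (- (2 * a) * \<xi>) * symbol a \<xi> ^ n" for \<xi>
    by (simp add: symbol_def algebra_simps)
  have F: "((\<lambda>y. - bulk_primitive a n (2 * y) / 2) has_real_derivative Re (bulk a n (2 * \<i> * y))) (at y)" if "1 \<le> y" for y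
  proof -
    have "(bulk_primitive a n has_real_derivative - Re (bulk a n (2 * \<i> * y))) (at (2 * y))"
      using bulk_imaginary_axis(1)[OF a, of "2 * y" n] that by (simp add: mult_ac)
    hence "((\<lambda>y. bulk_primitive a n (2 * y)) has_real_derivative - Re (bulk a n (2 * \<i> * y)) * 2) (at y)"
      by (rule DERIV_chain2) (auto intro!: derivative_eq_intros)
    thus ?thesis by (auto intro!: derivative_eq_intros)
  qed
  have cont: "continuous_on {1..a} (\<lambda>y. Re (bulk a n (2 * \<i> * of_real y)))"
  proof -
    have "continuous_on {1..a} (\<lambda>y. bulk a n (\<i> * of_real (2 * y + c)))" if "c \<ge> 0" for c using that
    proof (induction n arbitrary: c)
      case 0
      have "\<i> * complex_of_real (2 * y + c) \<noteq> 0" if "y \<in> {1..a}" for y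
        using that 0 by (simp del: of_real_add of_real_mult)
      thus ?case unfolding bulk.simps by (intro continuous_intros ballI) simp
    next
      case (Suc n)
      have e: "\<i> * of_real (2 * y + c) + 2 * \<i> = \<i> * of_real (2 * y + (c + 2))"
        "\<i> * of_real (2 * y + c) + 2 * \<i> * of_real a = \<i> * of_real (2 * y + (c + 2 * a))" for y
        by (auto simp: algebra_simps)
      show ?case unfolding bulk.simps(2) e using Suc.prems a by (intro continuous_intros Suc.IH) auto
    qed
    from this[of 0] show ?thesis by (intro continuous_intros) (simp add: mult_ac)
  qed
  have "(\<integral>y. indicator {1..a} y *\<^sub>R Re (bulk a n (2 * \<i> * y)) \<partial>lborel) = - bulk_primitive a n (2 * a) / 2 - - bulk_primitive a n (2 * 1) / 2"
    by (rule integral_FTC_atLeastAtMost[OF _ _ cont])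
       (use a F in \<open>auto simp: has_real_derivative_iff_has_vector_derivative[symmetric] intro: DERIV_subset\<close>)
  also have "\<dots> = (1 / (2 * pi)) * ((LBINT \<xi>:{0<..}. exp (- 2 * \<xi>) * symbol a \<xi> ^ n) - (LBINT \<xi>:{0<..}. exp (- (2 * a) * \<xi>) * symbol a \<xi> ^ n))"
    using a by (simp add: bulk_primitive_eq field_simps)
  also have "\<dots> = symbol_moment a n"
    unfolding symbol_moment_def eq
    using a set_integral_diff(2)[OF exp_symbol_integrable[OF a, of 2 n] exp_symbol_integrable[OF a, of "2 * a" n]] by simp
  finally have R: "(\<integral>y. indicator {1..a} y *\<^sub>R Re (bulk a n (2 * \<i> * y)) \<partial>lborel) = symbol_moment a n" .
  have "indicator {1..a} y *\<^sub>R bulk a n (2 * \<i> * y) = of_real (indicator {1..a} y *\<^sub>R Re (bulk a n (2 * \<i> * y)))" for y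
    using bulk_imaginary_axis(2)[OF a, of "2 * y" n] by (auto simp: complex_eq_iff indicator_def mult_ac)
  hence "(\<integral>y. indicator {1..a} y *\<^sub>R bulk a n (2 * \<i> * y) \<partial>lborel) = (\<integral>y. complex_of_real (indicator {1..a} y *\<^sub>R Re (bulk a n (2 * \<i> * y))) \<partial>lborel)"
    by simp
  also have "\<dots> = of_real (symbol_moment a n)" unfolding integral_complex_of_real R ..
  finally show ?thesis .
qed

section \<open>Traces over long windows\<close>

definition trace_power :: "real \<Rightarrow> real \<Rightarrow> nat \<Rightarrow> complex" where
  "trace_power a L n = (\<integral>z. iter_kernel (restrict_kernel (window a 0 L)) n z z \<partial>lborel)"

lemma iter_restrict_kernel_bound:
  assumes "W \<in> sets borel" "W \<subseteq> strip a"
  shows "norm (iter_kernel (restrict_kernel W) n z w) \<le> majorant_mass a ^ n"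
  using iter_kernel_bound[OF restrict_kernel_measurable[OF assms(1)] restrict_kernel_majorant[OF assms(2)]
      kernel_majorant_integrable eq_refl[OF kernel_majorant_integral] restrict_kernel_le_1[OF assms(2)], of n z w] by simp

lemma iter_restrict_kernel_diag_measurable:
  assumes "W \<in> sets borel"
  shows "(\<lambda>z. iter_kernel (restrict_kernel W) n z z) \<in> borel_measurable borel"
  using measurable_compose[OF _ iter_kernel_measurable[OF restrict_kernel_measurable[OF assms], of n], of "\<lambda>z. (z, z)" lborel]
  by simp

lemma majorant_mass_nonneg: "0 \<le> majorant_mass a"
  unfolding majorant_mass_def by (intro mult_nonneg_nonneg integral_nonneg_AE AE_I2) (auto simp: indicator_def)

lemma window_integrable: "integrable lborel (indicator (window a r s) :: complex \<Rightarrow> real)"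
proof -
  have "integrable lborel (\<lambda>z. indicator {r..s} (Re z) * indicator {1..a} (Im z) :: real)"
    by (intro integrable_complex_Re_Im integrable_indicator_Icc)
  moreover have "(\<lambda>z. indicator {r..s} (Re z) * indicator {1..a} (Im z) :: real) = indicator (window a r s)"
    by (auto simp: fun_eq_iff window_def indicator_def)
  ultimately show ?thesis by simp
qed

text \<open>Seen from the point at relative position \<open>s\<close>, the window reaches from
  \<open>- L * s\<close> to \<open>L * (1 - s)\<close>, so for \<open>0 < s < 1\<close> it exhausts
  the strip.\<close>

lemma iter_kernel_window_shift:
  "iter_kernel (restrict_kernel (window a 0 L)) n (Complex (L * s) y) (Complex (L * s) y) =
   iter_kernel (restrict_kernel (window a (- L * s) (L * (1 - s)))) n (Complex 0 y) (Complex 0 y)"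
proof -
  have "restrict_kernel (window a (- L * s) (L * (1 - s))) = (\<lambda>z w. restrict_kernel (window a 0 L) (z + of_real (L * s)) (w + of_real (L * s)))"
    unfolding restrict_kernel_def K_H_translate by (auto simp: fun_eq_iff window_def algebra_simps)
  hence "iter_kernel (restrict_kernel (window a (- L * s) (L * (1 - s)))) n (Complex 0 y) (Complex 0 y) =
    iter_kernel (restrict_kernel (window a 0 L)) n (Complex 0 y + of_real (L * s)) (Complex 0 y + of_real (L * s))"
    by (simp only: iter_kernel_translate[OF restrict_kernel_measurable[OF window_borel]])
  also have "Complex 0 y + of_real (L * s) = Complex (L * s) y" by (simp add: complex_eq_iff)
  finally show ?thesis by simp
qed

lemma trace_power_scaled:
  assumes L: "L > 0"
  shows "trace_power a L n = of_real L * (\<integral>y. (\<integral>s. iter_kernel (restrict_kernel (window a (- L * s) (L * (1 - s)))) n (Complex 0 y) (Complex 0 y) \<partial>lborel) \<partial>lborel)"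
proof -
  let ?W = "window a 0 L"
  define G where "G z = iter_kernel (restrict_kernel ?W) n z z" for z
  have int: "integrable lborel G"
  proof (rule Bochner_Integration.integrable_bound)
    show "integrable lborel (\<lambda>z. majorant_mass a ^ n * indicator ?W z)" using window_integrable by simp
    show "G \<in> borel_measurable lborel" unfolding G_def using iter_restrict_kernel_diag_measurable[of ?W n] by simp
    show "AE z in lborel. norm (G z) \<le> norm (majorant_mass a ^ n * indicator ?W z)"
    proof (intro AE_I2)
      fix z show "norm (G z) \<le> norm (majorant_mass a ^ n * indicator ?W z)"
      proof (cases "z \<in> ?W")
        case True thus ?thesis using iter_restrict_kernel_bound[OF window_borel window_subset_strip, of a 0 L n z z] majorant_mass_nonneg
          by (simp add: G_def)
      next
        case False
        hence "G z = 0" unfolding G_def by (intro iter_kernel_eq_0) (simp add: restrict_kernel_def)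
        thus ?thesis by simp
      qed
    qed
  qed
  have "trace_power a L n = (\<integral>z. G z \<partial>lborel)" by (simp add: trace_power_def G_def)
  also have "\<dots> = (\<integral>y. (\<integral>x. G (Complex x y) \<partial>lborel) \<partial>lborel)" by (rule integral_complex_iterated[OF int])
  also have "\<dots> = (\<integral>y. of_real L * (\<integral>s. G (Complex (L * s) y) \<partial>lborel) \<partial>lborel)"
  proof (intro Bochner_Integration.integral_cong refl)
    fix y show "(\<integral>x. G (Complex x y) \<partial>lborel) = of_real L * (\<integral>s. G (Complex (L * s) y) \<partial>lborel)"
      using L by (subst lborel_integral_real_affine[where c = L and t = 0]) (auto simp: scaleR_conv_of_real)
  qed
  also have "\<dots> = of_real L * (\<integral>y. (\<integral>s. G (Complex (L * s) y) \<partial>lborel) \<partial>lborel)" by simp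
  finally show ?thesis by (simp only: G_def iter_kernel_window_shift)
qed

text \<open>After rescaling, the integrand at each \<open>0 < s < 1\<close> converges to the
  diagonal of the strip kernel. Edge effects survive only at \<open>s = 0\<close> and
  \<open>s = 1\<close>, a null set, and the majorant is supported on a fixed rectangle.\<close>

theorem trace_power_limit:
  assumes a: "a > 1"
  shows "((\<lambda>L. trace_power a L n / of_real L) \<longlongrightarrow> of_real (symbol_moment a n)) at_top"
proof (rule tendsto_at_topI_sequentially)
  fix X :: "nat \<Rightarrow> real" assume X: "filterlim X at_top sequentially"
  \<comment> \<open>Positive lengths for every index, so that the scaling identity and the bounds
    hold throughout; \<open>Y\<close> and \<open>X\<close> agree from some index on.\<close>
  define Y where "Y i = max 1 (X i)" for i
  have Y: "Y i \<ge> 1" for i by (simp add: Y_def)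
  have ev: "eventually (\<lambda>i. Y i = X i) sequentially"
    using X by (auto simp: filterlim_at_top Y_def elim!: allE[of _ 1] eventually_mono)
  have Ytop: "filterlim Y at_top sequentially"
    by (rule filterlim_at_top_mono[OF X]) (simp add: Y_def)
  let ?W = "\<lambda>i s. window a (- Y i * s) (Y i * (1 - s))"
  define g where "g i s y = iter_kernel (restrict_kernel (?W i s)) n (Complex 0 y) (Complex 0 y)" for i s y
  have g_G: "g i s y = iter_kernel (restrict_kernel (window a 0 (Y i))) n (Complex (Y i * s) y) (Complex (Y i * s) y)" for i s y
    unfolding g_def by (rule iter_kernel_window_shift[symmetric])
  \<comment> \<open>Joint measurability is read off the unshifted form, in which the window does not
    vary with \<open>s\<close>.\<close>
  have gm: "(\<lambda>(s, y). g i s y) \<in> borel_measurable (lborel \<Otimes>\<^sub>M lborel)" for i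
  proof -
    note [measurable] = iter_restrict_kernel_diag_measurable[OF window_borel, of a 0 "Y i" n]
    have "(\<lambda>p. (Y i * fst p, snd p)) \<in> lborel \<Otimes>\<^sub>M lborel \<rightarrow>\<^sub>M borel \<Otimes>\<^sub>M borel" by simp
    from measurable_compose[OF measurable_compose[OF this measurable_Complex] iter_restrict_kernel_diag_measurable[OF window_borel, of a 0 "Y i" n]]
    show ?thesis by (simp add: g_G case_prod_unfold)
  qed
  have gb: "norm (g i s y) \<le> (majorant_mass a ^ n * indicator {1..a} y) * indicator {0..1::real} s" for i s y
  proof (cases "y \<in> {1..a} \<and> s \<in> {0..1}")
    case True thus ?thesis unfolding g_def using iter_restrict_kernel_bound[OF window_borel window_subset_strip] by simp
  next
    case False
    have "Complex 0 y \<notin> ?W i s" using False Y[of i] by (auto simp: window_def zero_le_mult_iff mult_le_0_iff)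
    hence "g i s y = 0" unfolding g_def by (intro iter_kernel_eq_0) (simp add: restrict_kernel_def)
    thus ?thesis using majorant_mass_nonneg[of a] by simp
  qed
  have glim: "(\<lambda>i. g i s y) \<longlonglongrightarrow> indicator {0..1::real} s *\<^sub>R (indicator {1..a} y *\<^sub>R bulk a n (2 * \<i> * y))" if s: "s \<noteq> 0" "s \<noteq> 1" for s y
  proof (cases "y \<in> {1..a} \<and> s \<in> {0..1}")
    case True
    hence s': "0 < s" "s < 1" using s by auto
    have "(\<lambda>i. restrict_kernel (?W i s) z v) \<longlonglongrightarrow> restrict_kernel (strip a) z v" for z v
    proof (rule tendsto_eventually)
      have t: "eventually (\<lambda>i. - Y i * s \<le> r \<and> r \<le> Y i * (1 - s)) sequentially" for r
      proof -
        have "eventually (\<lambda>i. Y i \<ge> - r / s) sequentially" "eventually (\<lambda>i. Y i \<ge> r / (1 - s)) sequentially"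
          using Ytop unfolding filterlim_at_top by blast+
        thus ?thesis by eventually_elim (use s' in \<open>auto simp: field_simps\<close>)
      qed
      show "\<forall>\<^sub>F i in sequentially. restrict_kernel (?W i s) z v = restrict_kernel (strip a) z v"
        using t[of "Re z"] t[of "Re v"] by eventually_elim (simp add: restrict_kernel_def window_def strip_def)
    qed
    hence "(\<lambda>i. g i s y) \<longlonglongrightarrow> iter_kernel (restrict_kernel (strip a)) n (Complex 0 y) (Complex 0 y)"
      unfolding g_def
      by (intro iter_kernel_tendsto[where D = "kernel_majorant a" and M = 1 and C = "majorant_mass a"] restrict_kernel_measurable window_borel strip_borel
          restrict_kernel_majorant restrict_kernel_le_1[where a = a] window_subset_strip kernel_majorant_integrable
          eq_refl[OF kernel_majorant_integral])
    also have "iter_kernel (restrict_kernel (strip a)) n (Complex 0 y) (Complex 0 y) = bulk a n (Complex 0 y - cnj (Complex 0 y))"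
      using True by (intro iter_kernel_strip a) (auto simp: strip_def)
    also have "Complex 0 y - cnj (Complex 0 y) = 2 * \<i> * y" by (simp add: complex_eq_iff)
    finally show ?thesis using True by simp
  next
    case False
    have "g i s y = 0" for i using gb[of i s y] False by auto
    thus ?thesis using False by auto
  qed
  have "(\<lambda>i. \<integral>y. (\<integral>s. g i s y \<partial>lborel) \<partial>lborel) \<longlonglongrightarrow> (\<integral>y. indicator {1..a} y *\<^sub>R bulk a n (2 * \<i> * y) \<partial>lborel)"
  proof (rule integral_dominated_convergence)
    note [measurable] = gm
    show "(\<lambda>y. \<integral>s. g i s y \<partial>lborel) \<in> borel_measurable lborel" for i by measurable
    show "(\<lambda>y. indicator {1..a} y *\<^sub>R bulk a n (2 * \<i> * y)) \<in> borel_measurable lborel" by measurable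
    show "integrable lborel (\<lambda>y. majorant_mass a ^ n * indicator {1..a} y)"
      by (intro integrable_mult_right integrable_indicator_Icc)
    show "AE y in lborel. norm (\<integral>s. g i s y \<partial>lborel) \<le> majorant_mass a ^ n * indicator {1..a} y" for i
    proof (intro AE_I2)
      fix y
      have "norm (\<integral>s. g i s y \<partial>lborel) \<le> (\<integral>s. norm (g i s y) \<partial>lborel)" by (rule integral_norm_bound)
      also have "\<dots> \<le> (\<integral>s. (majorant_mass a ^ n * indicator {1..a} y) * indicator {0..1::real} s \<partial>lborel)"
      proof (rule integral_mono_AE')
        show "integrable lborel (\<lambda>s. (majorant_mass a ^ n * indicator {1..a} y) * indicator {0..1::real} s)"
          by (intro integrable_mult_right integrable_indicator_Icc)
      qed (use gb majorant_mass_nonneg[of a] in auto)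
      finally show "norm (\<integral>s. g i s y \<partial>lborel) \<le> majorant_mass a ^ n * indicator {1..a} y" by simp
    qed
    show "AE y in lborel. (\<lambda>i. \<integral>s. g i s y \<partial>lborel) \<longlonglongrightarrow> indicator {1..a} y *\<^sub>R bulk a n (2 * \<i> * y)"
    proof (intro AE_I2)
      fix y
      have "(\<lambda>i. \<integral>s. g i s y \<partial>lborel) \<longlonglongrightarrow> (\<integral>s. indicator {0..1::real} s *\<^sub>R (indicator {1..a} y *\<^sub>R bulk a n (2 * \<i> * y)) \<partial>lborel)"
      proof (rule integral_dominated_convergence)
        show "(\<lambda>s. g i s y) \<in> borel_measurable lborel" for i using gm[of i] by measurable
        show "integrable lborel (\<lambda>s. (majorant_mass a ^ n * indicator {1..a} y) * indicator {0..1::real} s)"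
          by (intro integrable_mult_right integrable_indicator_Icc)
        show "AE s in lborel. (\<lambda>i. g i s y) \<longlonglongrightarrow> indicator {0..1::real} s *\<^sub>R (indicator {1..a} y *\<^sub>R bulk a n (2 * \<i> * y))"
          using AE_lborel_singleton[of 0] AE_lborel_singleton[of 1] by eventually_elim (rule glim)
      qed (use gb in auto)
      thus "(\<lambda>i. \<integral>s. g i s y \<partial>lborel) \<longlonglongrightarrow> indicator {1..a} y *\<^sub>R bulk a n (2 * \<i> * y)" by simp
    qed
  qed
  hence "(\<lambda>i. trace_power a (Y i) n / of_real (Y i)) \<longlonglongrightarrow> of_real (symbol_moment a n)"
  proof -
    have "trace_power a (Y i) n / of_real (Y i) = (\<integral>y. (\<integral>s. g i s y \<partial>lborel) \<partial>lborel)" for i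
      using Y[of i] trace_power_scaled[of "Y i" a n] by (simp add: g_def)
    thus ?thesis using \<open>_ \<longlonglongrightarrow> (\<integral>y. _ y \<partial>lborel)\<close> integral_bulk_diagonal[OF a, of n] by simp
  qed
  thus "(\<lambda>i. trace_power a (X i) n / of_real (X i)) \<longlonglongrightarrow> of_real (symbol_moment a n)"
    by (rule Lim_transform_eventually) (use ev in \<open>auto elim!: eventually_mono\<close>)
qed

section \<open>Correlation functions and discretisation\<close>

text \<open>The Cayley transform maps the half-plane to the unit disc, where the Bergman kernel
  \<open>(1 - \<zeta> \<omega>)\<^bsup>-2\<^esup>\<close> has a power series with positive coefficients.\<close>

lemma K_H_sums:
  assumes z: "Im z > 0" and w: "Im w > 0"
  defines "\<phi> \<equiv> \<lambda>n z. ((z - \<i>) / (z + \<i>)) ^ n / (z + \<i>)\<^sup>2"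
  shows "(\<lambda>n. of_real (4 * real (Suc n) / pi) * (\<phi> n z * cnj (\<phi> n w))) sums K_H z w"
proof -
  define A where "A = z + \<i>"
  define B where "B = cnj w - \<i>"
  have nz: "A \<noteq> 0" "B \<noteq> 0" using z w by (auto simp: A_def B_def complex_eq_iff)
  have lt: "norm ((z - \<i>) / (z + \<i>)) < 1" if "Im z > 0" for z
  proof -
    have "(norm (z - \<i>))\<^sup>2 < (norm (z + \<i>))\<^sup>2" using that unfolding cmod_power2 by (simp add: power2_eq_square algebra_simps)
    hence "norm (z - \<i>) < norm (z + \<i>)" by (rule power_less_imp_less_base) simp
    moreover from this have "norm (z + \<i>) > 0" by (rule le_less_trans[OF norm_ge_zero])
    ultimately show ?thesis by (simp add: norm_divide divide_less_eq)
  qed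
  define \<zeta> where "\<zeta> = (z - \<i>) / (z + \<i>)"
  define \<omega> where "\<omega> = cnj ((w - \<i>) / (w + \<i>))"
  have "norm (\<zeta> * \<omega>) < 1" using lt[OF z] lt[OF w] unfolding \<zeta>_def \<omega>_def norm_mult complex_mod_cnj
    using mult_strict_mono[of "norm ((z - \<i>) / (z + \<i>))" 1 "norm ((w - \<i>) / (w + \<i>))" 1] by simp
  hence s: "(\<lambda>n. of_nat (Suc n) * (\<zeta> * \<omega>) ^ n) sums (1 / (1 - \<zeta> * \<omega>)\<^sup>2)" by (rule geometric_deriv_sums)
  \<comment> \<open>Squared, this relates the Bergman kernels of disc and half-plane; the factors
    \<open>A\<close> and \<open>B\<close> go into \<open>\<phi>\<close>, and
    \<open>(- 2 * \<i>)^2 = - 4\<close> produces the constant \<open>4 / pi\<close>.\<close>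
  have "1 - \<zeta> * \<omega> = - 2 * \<i> * (z - cnj w) / (A * B)"
  proof -
    have *: "\<zeta> = (A - 2 * \<i>) / A" "\<omega> = (B + 2 * \<i>) / B" "z - cnj w = A - B - 2 * \<i>"
      by (simp_all add: \<zeta>_def \<omega>_def A_def B_def)
    have "1 - (A - 2 * \<i>) / A * ((B + 2 * \<i>) / B) = (A * B - (A - 2 * \<i>) * (B + 2 * \<i>)) / (A * B)"
    proof -
      have "A * B / (A * B) = 1" using nz by simp
      thus ?thesis unfolding times_divide_times_eq diff_divide_distrib[of "A * B"] by simp
    qed
    also have "A * B - (A - 2 * \<i>) * (B + 2 * \<i>) = - 2 * \<i> * (A - B - 2 * \<i>)" by (simp add: algebra_simps)
    finally show ?thesis unfolding * .
  qed
  hence "(1 - \<zeta> * \<omega>)\<^sup>2 = - 4 * (z - cnj w)\<^sup>2 / (A\<^sup>2 * B\<^sup>2)"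
    by (simp add: power_divide power_mult_distrib)
  hence K: "4 / of_real pi / (A\<^sup>2 * B\<^sup>2) * (1 / (1 - \<zeta> * \<omega>)\<^sup>2) = K_H z w"
    using nz by (simp add: K_H_def)
  have "(\<lambda>n. 4 / of_real pi / (A\<^sup>2 * B\<^sup>2) * (of_nat (Suc n) * (\<zeta> * \<omega>) ^ n)) sums (4 / of_real pi / (A\<^sup>2 * B\<^sup>2) * (1 / (1 - \<zeta> * \<omega>)\<^sup>2))"
    by (rule sums_mult[OF s])
  also have "(\<lambda>n. 4 / of_real pi / (A\<^sup>2 * B\<^sup>2) * (of_nat (Suc n) * (\<zeta> * \<omega>) ^ n)) =
    (\<lambda>n. of_real (4 * real (Suc n) / pi) * (\<phi> n z * cnj (\<phi> n w)))"
  proof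
    fix n
    have "\<phi> n z = \<zeta> ^ n / A\<^sup>2" "cnj (\<phi> n w) = \<omega> ^ n / B\<^sup>2"
      by (simp_all add: \<phi>_def \<zeta>_def \<omega>_def A_def B_def)
    thus "4 / of_real pi / (A\<^sup>2 * B\<^sup>2) * (of_nat (Suc n) * (\<zeta> * \<omega>) ^ n) = of_real (4 * real (Suc n) / pi) * (\<phi> n z * cnj (\<phi> n w))"
      by (simp add: power_mult_distrib field_simps)
  qed
  finally show ?thesis unfolding K .
qed

text \<open>Every term of the series is a rank-one form with a positive weight, so the quadratic
  form is a sum of squares; its imaginary part is a sum of zeros.\<close>

lemma K_H_psd:
  assumes x: "\<And>i. i < n \<Longrightarrow> Im (x i) > 0"
  shows "\<exists>r\<ge>0. (\<Sum>i<n. \<Sum>j<n. cnj (v i) * K_H (x i) (x j) * v j) = complex_of_real r"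
proof -
  define \<phi> where "\<phi> m z = ((z - \<i>) / (z + \<i>)) ^ m / (z + \<i>)\<^sup>2" for m z
  let ?S = "\<Sum>i<n. \<Sum>j<n. cnj (v i) * K_H (x i) (x j) * v j"
  have "(\<lambda>m. \<Sum>i<n. \<Sum>j<n. cnj (v i) * (of_real (4 * real (Suc m) / pi) * (\<phi> m (x i) * cnj (\<phi> m (x j)))) * v j) sums ?S"
    unfolding \<phi>_def by (rule sums_sum, rule sums_sum, rule sums_mult2, rule sums_mult, rule K_H_sums) (auto simp: x)
  also have "(\<lambda>m. \<Sum>i<n. \<Sum>j<n. cnj (v i) * (of_real (4 * real (Suc m) / pi) * (\<phi> m (x i) * cnj (\<phi> m (x j)))) * v j) =
    (\<lambda>m. complex_of_real (4 * real (Suc m) / pi * (cmod (\<Sum>i<n. cnj (v i) * \<phi> m (x i)))\<^sup>2))"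
  proof
    fix m
    define u where "u = (\<Sum>i<n. cnj (v i) * \<phi> m (x i))"
    have "(\<Sum>i<n. \<Sum>j<n. cnj (v i) * (of_real (4 * real (Suc m) / pi) * (\<phi> m (x i) * cnj (\<phi> m (x j)))) * v j) =
      of_real (4 * real (Suc m) / pi) * ((\<Sum>i<n. cnj (v i) * \<phi> m (x i)) * (\<Sum>j<n. v j * cnj (\<phi> m (x j))))"
      unfolding sum_product by (simp add: sum_distrib_left mult_ac)
    also have "(\<Sum>j<n. v j * cnj (\<phi> m (x j))) = cnj u" by (simp add: u_def cnj_sum)
    also have "(\<Sum>i<n. cnj (v i) * \<phi> m (x i)) * cnj u = complex_of_real ((cmod u)\<^sup>2)"
      by (simp only: complex_norm_square u_def)
    finally show "(\<Sum>i<n. \<Sum>j<n. cnj (v i) * (of_real (4 * real (Suc m) / pi) * (\<phi> m (x i) * cnj (\<phi> m (x j)))) * v j) =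
      complex_of_real (4 * real (Suc m) / pi * (cmod (\<Sum>i<n. cnj (v i) * \<phi> m (x i)))\<^sup>2)"
      by (simp only: of_real_mult u_def)
  qed
  finally have S: "(\<lambda>m. complex_of_real (4 * real (Suc m) / pi * (cmod (\<Sum>i<n. cnj (v i) * \<phi> m (x i)))\<^sup>2)) sums ?S" .
  have "(\<lambda>m. 4 * real (Suc m) / pi * (cmod (\<Sum>i<n. cnj (v i) * \<phi> m (x i)))\<^sup>2) sums Re ?S"
    using sums_Re[OF S] by (simp only: Re_complex_of_real)
  from sums_le[OF _ sums_zero this] have re: "Re ?S \<ge> 0" by simp
  have "(\<lambda>m. 0) sums Im ?S" using sums_Im[OF S] by (simp only: Im_complex_of_real)
  hence "Im ?S = 0" using sums_unique2[OF _ sums_zero] by blast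
  thus ?thesis using re by (intro exI[of _ "Re ?S"]) (simp add: complex_eq_iff)
qed

section \<open>Correlation functions: positivity, bounds, regularity\<close>

definition correlation :: "nat \<Rightarrow> (nat \<Rightarrow> complex) \<Rightarrow> real" where
  "correlation n x = Re (Determinant.det (Matrix.mat n n (\<lambda>(i, j). K_H (x i) (x j))))"

lemma correlation_cong: "(\<And>i. i < n \<Longrightarrow> x i = y i) \<Longrightarrow> correlation n x = correlation n y"
  unfolding correlation_def by (intro arg_cong[where f = Re] arg_cong[where f = Determinant.det] cong_mat) auto

lemma
  assumes x: "\<And>i. i < n \<Longrightarrow> Im (x i) > 0"
  shows correlation_nonneg: "correlation n x \<ge> 0"
    and det_K_H: "Determinant.det (Matrix.mat n n (\<lambda>(i, j). K_H (x i) (x j))) = complex_of_real (correlation n x)"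
proof -
  let ?A = "Matrix.mat n n (\<lambda>(i, j). K_H (x i) (x j))"
  have A: "?A \<in> carrier_mat n n" by simp
  have psd: "\<exists>r\<ge>0. (\<Sum>i<n. \<Sum>j<n. cnj (v i) * ?A $$ (i, j) * v j) = complex_of_real r" for v
    using K_H_psd[of n x v, OF x] by simp
  obtain l where l: "\<And>i. i < n \<Longrightarrow> 0 \<le> l i"
    and det: "\<And>s t :: real. Determinant.det (complex_of_real s \<cdot>\<^sub>m 1\<^sub>m n + complex_of_real t \<cdot>\<^sub>m ?A) = complex_of_real (\<Prod>i<n. s + t * l i)"
    by (rule psd_spectrum[OF A psd], rule that)
  have "complex_of_real 0 \<cdot>\<^sub>m 1\<^sub>m n + complex_of_real 1 \<cdot>\<^sub>m ?A = ?A" by (intro eq_matI) auto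
  hence "Determinant.det ?A = complex_of_real (\<Prod>i<n. l i)" using det[of 0 1] by simp
  moreover have "(\<Prod>i<n. l i) \<ge> 0" using l by (intro prod_nonneg) auto
  ultimately show "correlation n x \<ge> 0" "Determinant.det ?A = complex_of_real (correlation n x)"
    by (simp_all add: correlation_def del: of_real_prod)
qed

text \<open>The threshold \<open>1/2\<close> leaves room below the window, whose heights are at
  least \<open>1\<close>, for the sample points that replace its points.\<close>

lemma norm_K_H_le_1:
  assumes "Im z \<ge> 1/2" "Im w \<ge> 1/2"
  shows "norm (K_H z w) \<le> 1"
proof -
  have "1\<^sup>2 \<le> (Im z + Im w)\<^sup>2" using assms by (intro power_mono) auto
  hence "1 * 1 \<le> pi * ((Re w - Re z)\<^sup>2 + (Im z + Im w)\<^sup>2)"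
    using pi_ge_two by (intro mult_mono) (auto intro: add_nonneg_pos order_trans[OF _ le_add_same_cancel2[THEN iffD2]])
  thus ?thesis by (simp add: norm_K_H)
qed

text \<open>The Leibniz formula has \<open>n!\<close> terms of modulus at most \<open>1\<close>;
  crude, but constant, hence an integrable majorant on products of sets of finite area.\<close>

lemma correlation_bound:
  assumes "\<And>i. i < n \<Longrightarrow> Im (x i) \<ge> 1/2"
  shows "\<bar>correlation n x\<bar> \<le> fact n"
proof -
  let ?A = "Matrix.mat n n (\<lambda>(i, j). K_H (x i) (x j))"
  have "\<bar>correlation n x\<bar> \<le> norm (Determinant.det ?A)" unfolding correlation_def by (rule abs_Re_le_cmod)
  also have "\<dots> = norm (\<Sum>p | p permutes {0..<n}. of_int (sign p) * (\<Prod>i = 0..<n. ?A $$ (i, p i)))"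
    by (simp add: Determinant.det_def)
  also have "\<dots> \<le> (\<Sum>p | p permutes {0..<n}. 1)"
  proof (rule sum_norm_le)
    fix p assume p: "p \<in> {p. p permutes {0..<n}}"
    have "norm (\<Prod>i = 0..<n. ?A $$ (i, p i)) \<le> 1"
      unfolding prod_norm[symmetric]
    proof (rule prod_le_1)
      fix i assume i: "i \<in> {0..<n}"
      hence "p i < n" using p permutes_in_image[of p "{0..<n}" i] by simp
      thus "0 \<le> norm (?A $$ (i, p i)) \<and> norm (?A $$ (i, p i)) \<le> 1" using i assms by (simp add: norm_K_H_le_1)
    qed
    moreover have "norm (of_int (sign p) :: complex) = 1" by (simp add: sign_def)
    ultimately show "norm (of_int (sign p) * (\<Prod>i = 0..<n. ?A $$ (i, p i))) \<le> 1" by (simp add: norm_mult)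
  qed
  also have "\<dots> = fact n" by (simp add: card_permutations)
  finally show ?thesis .
qed

text \<open>As a finite expression in values of the kernel, the correlation inherits measurability
  and pointwise limits from it.\<close>

lemma correlation_eq_sum:
  "correlation n x = Re (\<Sum>p | p permutes {..<n}. of_int (sign p) * (\<Prod>i<n. K_H (x i) (x (p i))))"
proof -
  have "(\<Sum>p | p permutes {0..<n}. of_int (sign p) * (\<Prod>i = 0..<n. Matrix.mat n n (\<lambda>(i, j). K_H (x i) (x j)) $$ (i, p i))) =
    (\<Sum>p | p permutes {0..<n}. of_int (sign p) * (\<Prod>i = 0..<n. K_H (x i) (x (p i))))"
  proof (intro sum.cong refl arg_cong2[where f = "(*)"] prod.cong)
    fix p i assume p: "p \<in> {p. p permutes {0..<n}}" and i: "i \<in> {0..<n}"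
    hence "p i < n" using permutes_in_image[of p "{0..<n}" i] by simp
    thus "Matrix.mat n n (\<lambda>(i, j). K_H (x i) (x j)) $$ (i, p i) = K_H (x i) (x (p i))" using i by simp
  qed
  thus ?thesis by (simp add: correlation_def Determinant.det_def lessThan_atLeast0)
qed

lemma halfplane_component_measurable:
  assumes "i < n" "f \<in> borel_measurable borel"
  shows "(\<lambda>x. f (x i)) \<in> borel_measurable (Pi\<^sub>M {..<n} (\<lambda>_. halfplane_measure))"
proof (rule measurable_compose[OF measurable_component_singleton])
  show "f \<in> borel_measurable halfplane_measure"
    unfolding halfplane_measure_def using assms(2) by (intro measurable_restrict_space1) simp
qed (use assms in simp)

lemma correlation_measurable:
  assumes g: "g \<in> borel_measurable borel"
  shows "(\<lambda>x. correlation n (\<lambda>i. g (x i))) \<in> borel_measurable (Pi\<^sub>M {..<n} (\<lambda>_. halfplane_measure))"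
proof -
  have K: "(\<lambda>x. K_H (g (x i)) (g (x j))) \<in> borel_measurable (Pi\<^sub>M {..<n} (\<lambda>_. halfplane_measure))" if "i < n" "j < n" for i j
  proof -
    note [measurable] = halfplane_component_measurable[OF that(1) g] halfplane_component_measurable[OF that(2) g]
    show ?thesis by measurable
  qed
  have "(\<lambda>x. \<Sum>p | p permutes {..<n}. of_int (sign p) * (\<Prod>i<n. K_H (g (x i)) (g (x (p i)))))
    \<in> borel_measurable (Pi\<^sub>M {..<n} (\<lambda>_. halfplane_measure))"
    by (intro borel_measurable_sum borel_measurable_times borel_measurable_const borel_measurable_prod K)
       (auto dest: permutes_in_image)
  thus ?thesis unfolding correlation_eq_sum by measurable
qed

lemma K_H_tendsto:
  assumes "(f \<longlongrightarrow> z) F" "(g \<longlongrightarrow> w) F" "Im z > 0" "Im w > 0"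
  shows "((\<lambda>i. K_H (f i) (g i)) \<longlongrightarrow> K_H z w) F"
proof -
  have "z - cnj w \<noteq> 0" using assms(3,4) by (auto simp: complex_eq_iff)
  thus ?thesis unfolding K_H_def using assms(1,2)
    by (intro tendsto_divide tendsto_mult tendsto_power tendsto_diff tendsto_cnj tendsto_const tendsto_minus) auto
qed

section \<open>Discretised kernels as finite matrices\<close>

lemma sigma_finite_halfplane: "sigma_finite_measure halfplane_measure"
  unfolding halfplane_measure_def
  by (rule sigma_finite_measure_restrict_space[OF lborel.sigma_finite_measure_axioms]) simp

interpretation halfplane: product_sigma_finite "\<lambda>_::nat. halfplane_measure"
  by (rule product_sigma_finite.intro) (rule sigma_finite_halfplane)

lemma
  assumes "C \<in> sets borel" "C \<subseteq> {z. Im z > 0}"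
  shows emeasure_halfplane: "emeasure halfplane_measure C = emeasure lborel C"
    and measure_halfplane: "measure halfplane_measure C = measure lborel C"
    and sets_halfplane: "C \<in> sets halfplane_measure"
  using assms by (auto simp: halfplane_measure_def emeasure_restrict_space measure_restrict_space sets_restrict_space_iff)

lemma simple_range_enum:
  assumes "finite (range g)"
  obtains d e where "inj_on e {..<d::nat}" "range g = e ` {..<d}"
  using ex_bij_betw_nat_finite[OF assms] that by (auto simp: bij_betw_def lessThan_atLeast0)

text \<open>Only the arguments of the kernel are discretised: the cut-off looks at the true points,
  the kernel at their sample points. A finite range of \<open>g\<close> makes the operator one of
  finite rank.\<close>

definition step_kernel :: "complex set \<Rightarrow> (complex \<Rightarrow> complex) \<Rightarrow> complex \<Rightarrow> complex \<Rightarrow> complex" where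
  "step_kernel B g z w = (if z \<in> B \<and> w \<in> B then K_H (g z) (g w) else 0)"

text \<open>With \<open>g\<close> the identity, this is the expected number of
  \<open>n\<close>-point subsets of the process in \<open>B\<close>, and the coefficient of
  \<open>t ^ n\<close> in the Fredholm determinant.\<close>

definition correlation_integral :: "complex set \<Rightarrow> (complex \<Rightarrow> complex) \<Rightarrow> nat \<Rightarrow> real" where
  "correlation_integral B g n =
    (\<integral>x. (\<Prod>i<n. indicator B (x i)) * correlation n (\<lambda>i. g (x i)) \<partial>Pi\<^sub>M {..<n} (\<lambda>_. halfplane_measure)) / fact n"

locale step_approximation =
  fixes B :: "complex set" and g :: "complex \<Rightarrow> complex" and d :: nat and e :: "nat \<Rightarrow> complex"
  assumes B [measurable]: "B \<in> sets borel" and B_sub: "B \<subseteq> {z. Im z > 0}" and B_fin: "emeasure lborel B < \<infinity>"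
    and g [measurable]: "g \<in> borel_measurable borel" and g_half: "\<And>z. Im (g z) > 0"
    and e_inj: "inj_on e {..<d}" and g_range: "range g = e ` {..<d}"
begin

definition cell :: "nat \<Rightarrow> complex set" where "cell i = B \<inter> g -` {e i}"

definition weight :: "nat \<Rightarrow> real" where "weight i = measure lborel (cell i)"

lemma e_half: "i < d \<Longrightarrow> Im (e i) > 0"
  using g_half g_range by (metis image_eqI lessThan_iff rangeE)

lemma cell_sets: "cell i \<in> sets borel"
proof -
  have "g -` {e i} \<inter> space borel \<in> sets borel" by (rule measurable_sets[OF g]) simp
  thus ?thesis unfolding cell_def using B by auto
qed

lemma cell_fin: "emeasure lborel (cell i) < \<infinity>"
  by (rule le_less_trans[OF emeasure_mono B_fin]) (auto simp: cell_def B)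

lemma weight_nonneg: "weight i \<ge> 0"
  by (simp add: weight_def)

lemma cell_index: "\<exists>i<d. g v = e i \<and> (\<forall>j<d. v \<in> cell j \<longleftrightarrow> v \<in> B \<and> j = i)"
proof -
  have "g v \<in> e ` {..<d}" using g_range by auto
  then obtain i where i: "i < d" "g v = e i" by auto
  have "v \<in> cell j \<longleftrightarrow> v \<in> B \<and> j = i" if "j < d" for j
    using that i inj_onD[OF e_inj, of i j] by (auto simp: cell_def)
  thus ?thesis using i by auto
qed

lemma step_integral:
  fixes f :: "complex \<Rightarrow> complex"
  shows "(\<integral>v. indicator B v *\<^sub>R f (g v) \<partial>lborel) = (\<Sum>i<d. weight i *\<^sub>R f (e i))"
proof -
  have eq: "indicator B v *\<^sub>R f (g v) = (\<Sum>j<d. indicator (cell j) v *\<^sub>R f (e j))" for v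
  proof -
    obtain i where i: "i < d" "g v = e i" "\<And>j. j < d \<Longrightarrow> v \<in> cell j \<longleftrightarrow> v \<in> B \<and> j = i"
      using cell_index[of v] by blast
    have "(\<Sum>j<d. indicator (cell j) v *\<^sub>R f (e j)) = (\<Sum>j<d. if j = i then indicator B v *\<^sub>R f (e i) else 0)"
      by (intro sum.cong refl) (auto simp: i(3) indicator_def)
    thus ?thesis using i by simp
  qed
  have "(\<integral>v. (\<Sum>j<d. indicator (cell j) v *\<^sub>R f (e j)) \<partial>lborel) = (\<Sum>j<d. \<integral>v. indicator (cell j) v *\<^sub>R f (e j) \<partial>lborel)"
    using cell_sets cell_fin by (intro Bochner_Integration.integral_sum integrable_scaleR_left integrable_real_indicator) auto
  also have "\<dots> = (\<Sum>i<d. weight i *\<^sub>R f (e i))"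
    using cell_sets cell_fin by (intro sum.cong refl) (simp add: weight_def)
  finally show ?thesis by (simp only: eq)
qed

text \<open>The step operator in the basis of normalised cell indicators. The square roots keep the
  matrix Hermitian, and a cell of measure zero gives a zero row and column.\<close>

definition gram :: "complex mat" where
  "gram = Matrix.mat d d (\<lambda>(i, j). of_real (sqrt (weight i) * sqrt (weight j)) * K_H (e i) (e j))"

lemma gram_carrier: "gram \<in> carrier_mat d d"
  by (simp add: gram_def)

lemma gram_psd: "\<exists>r\<ge>0. (\<Sum>i<d. \<Sum>j<d. cnj (v i) * gram $$ (i, j) * v j) = complex_of_real r"
proof -
  have "(\<Sum>i<d. \<Sum>j<d. cnj (v i) * gram $$ (i, j) * v j) =
    (\<Sum>i<d. \<Sum>j<d. cnj (of_real (sqrt (weight i)) * v i) * K_H (e i) (e j) * (of_real (sqrt (weight j)) * v j))"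
    by (intro sum.cong refl) (simp add: gram_def mult_ac)
  thus ?thesis using K_H_psd[of d e "\<lambda>i. of_real (sqrt (weight i)) * v i", OF e_half] by simp
qed

text \<open>Rows and columns each contribute the square roots of the chosen weights, and permuting
  the columns does not change their product.\<close>

lemma det_gram:
  assumes c: "c \<in> {..<n} \<rightarrow>\<^sub>E {..<d}"
  shows "Determinant.det (Matrix.mat n n (\<lambda>(i, j). gram $$ (c i, c j))) =
    of_real ((\<Prod>i<n. weight (c i)) * correlation n (\<lambda>i. e (c i)))"
proof -
  have cd: "c i < d" if "i < n" for i using c that by auto
  let ?a = "\<lambda>i. complex_of_real (sqrt (weight (c i)))"
  have sq: "(\<Prod>i = 0..<n. ?a i) * (\<Prod>i = 0..<n. ?a i) = of_real (\<Prod>i<n. weight (c i))"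
    unfolding prod.distrib[symmetric] of_real_prod lessThan_atLeast0
    by (intro prod.cong refl) (simp add: weight_nonneg flip: of_real_mult)
  have "Determinant.det (Matrix.mat n n (\<lambda>(i, j). gram $$ (c i, c j))) =
     (\<Sum>p | p permutes {0..<n}. of_int (sign p) * (\<Prod>i = 0..<n. Matrix.mat n n (\<lambda>(i, j). gram $$ (c i, c j)) $$ (i, p i)))"
    by (simp add: Determinant.det_def)
  also have "\<dots> = (\<Sum>p | p permutes {0..<n}. of_real (\<Prod>i<n. weight (c i)) * (of_int (sign p) *
      (\<Prod>i = 0..<n. Matrix.mat n n (\<lambda>(i, j). K_H (e (c i)) (e (c j))) $$ (i, p i))))"
  proof (rule sum.cong[OF refl])
    fix p assume "p \<in> {p. p permutes {0..<n}}"
    hence p: "p permutes {0..<n}" by simp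
    have "(\<Prod>i = 0..<n. Matrix.mat n n (\<lambda>(i, j). gram $$ (c i, c j)) $$ (i, p i)) =
      (\<Prod>i = 0..<n. (?a i * ?a (p i)) * Matrix.mat n n (\<lambda>(i, j). K_H (e (c i)) (e (c j))) $$ (i, p i))"
    proof (rule prod.cong[OF refl])
      fix i assume i: "i \<in> {0..<n}"
      hence "p i < n" using p permutes_in_image[of p "{0..<n}" i] by simp
      thus "Matrix.mat n n (\<lambda>(i, j). gram $$ (c i, c j)) $$ (i, p i) =
        (?a i * ?a (p i)) * Matrix.mat n n (\<lambda>(i, j). K_H (e (c i)) (e (c j))) $$ (i, p i)"
        using i cd by (simp add: gram_def)
    qed
    also have "\<dots> = ((\<Prod>i = 0..<n. ?a i) * (\<Prod>i = 0..<n. ?a (p i))) *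
       (\<Prod>i = 0..<n. Matrix.mat n n (\<lambda>(i, j). K_H (e (c i)) (e (c j))) $$ (i, p i))"
      by (simp only: prod.distrib)
    also have "(\<Prod>i = 0..<n. ?a (p i)) = (\<Prod>i = 0..<n. ?a i)"
      using prod.permute[OF p, of ?a] by (simp add: comp_def)
    finally show "of_int (sign p) * (\<Prod>i = 0..<n. Matrix.mat n n (\<lambda>(i, j). gram $$ (c i, c j)) $$ (i, p i)) =
      of_real (\<Prod>i<n. weight (c i)) * (of_int (sign p) *
      (\<Prod>i = 0..<n. Matrix.mat n n (\<lambda>(i, j). K_H (e (c i)) (e (c j))) $$ (i, p i)))"
      unfolding sq by (simp only: mult_ac)
  qed
  also have "\<dots> = of_real (\<Prod>i<n. weight (c i)) * Determinant.det (Matrix.mat n n (\<lambda>(i, j). K_H (e (c i)) (e (c j))))"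
    by (simp add: Determinant.det_def sum_distrib_left)
  also have "\<dots> = of_real ((\<Prod>i<n. weight (c i)) * correlation n (\<lambda>i. e (c i)))"
    using det_K_H[of n "\<lambda>i. e (c i)"] e_half cd by simp
  finally show ?thesis .
qed

lemma correlation_integral_step:
  "correlation_integral B g n = (\<Sum>c\<in>{..<n} \<rightarrow>\<^sub>E {..<d}. (\<Prod>i<n. weight (c i)) * correlation n (\<lambda>i. e (c i))) / fact n"
proof -
  let ?P = "Pi\<^sub>M {..<n} (\<lambda>_. halfplane_measure)"
  have fin: "finite ({..<n} \<rightarrow>\<^sub>E {..<d})" by (intro finite_PiE) auto
  have eq: "(\<Prod>i<n. indicator B (x i)) * correlation n (\<lambda>i. g (x i)) =
    (\<Sum>c\<in>{..<n} \<rightarrow>\<^sub>E {..<d}. (\<Prod>i<n. indicator (cell (c i)) (x i)) * correlation n (\<lambda>i. e (c i)))" for x :: "nat \<Rightarrow> complex"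
  proof -
    have "\<exists>i. i < d \<and> g v = e i \<and> (\<forall>j<d. v \<in> cell j \<longleftrightarrow> v \<in> B \<and> j = i)" for v using cell_index[of v] by blast
    hence "\<exists>h. \<forall>v. h v < d \<and> g v = e (h v) \<and> (\<forall>j<d. v \<in> cell j \<longleftrightarrow> v \<in> B \<and> j = h v)" by (intro choice allI)
    then obtain h where h: "\<And>v. h v < d" "\<And>v. g v = e (h v)" "\<And>v j. j < d \<Longrightarrow> v \<in> cell j \<longleftrightarrow> v \<in> B \<and> j = h v" by blast
    \<comment> \<open>The cells that contain the given points; any other assignment misplaces some
      point, and its product of indicators vanishes.\<close>
    define c0 where "c0 = restrict (\<lambda>i. h (x i)) {..<n}"
    have c0: "c0 \<in> {..<n} \<rightarrow>\<^sub>E {..<d}" unfolding c0_def restrict_PiE_iff using h(1) by simp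
    have "(\<Sum>c\<in>{..<n} \<rightarrow>\<^sub>E {..<d}. (\<Prod>i<n. indicator (cell (c i)) (x i)) * correlation n (\<lambda>i. e (c i))) =
      (\<Sum>c\<in>{..<n} \<rightarrow>\<^sub>E {..<d}. if c = c0 then (\<Prod>i<n. indicator B (x i)) * correlation n (\<lambda>i. e (c0 i)) else 0)"
    proof (rule sum.cong[OF refl])
      fix c assume c: "c \<in> {..<n} \<rightarrow>\<^sub>E {..<d}"
      have ind: "indicator (cell (c i)) (x i) = (if c i = h (x i) then indicator B (x i) else (0::real))" if "i < n" for i
      proof -
        have "c i < d" using PiE_mem[OF c, of i] that by simp
        thus ?thesis using h(3)[of "c i" "x i"] by (simp add: indicator_def)
      qed
      show "(\<Prod>i<n. indicator (cell (c i)) (x i)) * correlation n (\<lambda>i. e (c i)) =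
        (if c = c0 then (\<Prod>i<n. indicator B (x i)) * correlation n (\<lambda>i. e (c0 i)) else 0)"
      proof (cases "c = c0")
        case True
        hence "(\<Prod>i<n. indicator (cell (c i)) (x i) :: real) = (\<Prod>i<n. indicator B (x i))"
          using ind by (intro prod.cong refl) (auto simp: c0_def)
        thus ?thesis using True by simp
      next
        case False
        then obtain i where "i < n" "c i \<noteq> c0 i" using PiE_ext[OF c c0] by auto
        hence "(\<Prod>i<n. indicator (cell (c i)) (x i) :: real) = 0"
          using ind[of i] by (intro prod_zero) (auto simp: c0_def intro!: bexI[of _ i])
        thus ?thesis using False by simp
      qed
    qed
    also have "\<dots> = (\<Prod>i<n. indicator B (x i)) * correlation n (\<lambda>i. e (c0 i))" using c0 fin by simp
    also have "correlation n (\<lambda>i. e (c0 i)) = correlation n (\<lambda>i. g (x i))"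
      by (rule correlation_cong) (simp add: c0_def h(2))
    finally show ?thesis by simp
  qed
  have cellH: "cell j \<subseteq> {z. Im z > 0}" for j using B_sub by (auto simp: cell_def)
  have ind: "integrable halfplane_measure (indicator (cell j) :: complex \<Rightarrow> real)" for j
    using sets_halfplane[OF cell_sets cellH] emeasure_halfplane[OF cell_sets cellH] cell_fin
    by (intro integrable_real_indicator) auto
  have cell_int: "(\<integral>v. indicator (cell j) v \<partial>halfplane_measure) = weight j" for j
    using measure_halfplane[OF cell_sets cellH] sets_halfplane[OF cell_sets cellH] emeasure_halfplane[OF cell_sets cellH] cell_fin
    by (simp add: weight_def sets.Int_space_eq2)
  have int: "integrable ?P (\<lambda>x. (\<Prod>i<n. indicator (cell (c i)) (x i)) :: real)" for c
    by (rule halfplane.product_integrable_prod[OF finite_lessThan ind])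
  have "(\<integral>x. (\<Prod>i<n. indicator (cell (c i)) (x i) :: real) \<partial>?P) = (\<Prod>i<n. weight (c i))" for c
  proof -
    have "(\<integral>x. (\<Prod>i<n. indicator (cell (c i)) (x i) :: real) \<partial>?P) = (\<Prod>i<n. \<integral>v. indicator (cell (c i)) v \<partial>halfplane_measure)"
      by (rule halfplane.product_integral_prod[OF finite_lessThan ind])
    thus ?thesis by (simp only: cell_int)
  qed
  thus ?thesis unfolding correlation_integral_def eq
    using int by (subst Bochner_Integration.integral_sum) simp_all
qed

fun gram_iter :: "nat \<Rightarrow> complex \<Rightarrow> complex \<Rightarrow> complex" where
  "gram_iter 0 p q = K_H p q"
| "gram_iter (Suc k) p q = (\<Sum>i<d. weight i *\<^sub>R (K_H p (e i) * gram_iter k (e i) q))"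

lemma iter_step_kernel:
  "iter_kernel (step_kernel B g) k z w = (if z \<in> B \<and> w \<in> B then gram_iter k (g z) (g w) else 0)"
proof (induction k arbitrary: z)
  case (Suc k)
  have "step_kernel B g z v * iter_kernel (step_kernel B g) k v w =
    (if z \<in> B \<and> w \<in> B then indicator B v *\<^sub>R (K_H (g z) (g v) * gram_iter k (g v) (g w)) else 0)" for v
    by (simp add: Suc step_kernel_def)
  thus ?case using step_integral[of "\<lambda>v. K_H (g z) v * gram_iter k v (g w)"]
    by (cases "z \<in> B \<and> w \<in> B") (simp_all only: iter_kernel.simps gram_iter.simps if_True if_False simp_thms Bochner_Integration.integral_zero)
qed (simp add: step_kernel_def)

lemma gram_pow:
  assumes "i < d" "j < d"
  shows "(gram ^\<^sub>m Suc k) $$ (i, j) = of_real (sqrt (weight i) * sqrt (weight j)) * gram_iter k (e i) (e j)"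
  using assms
proof (induction k arbitrary: i)
  case 0
  thus ?case using gram_carrier by (simp add: gram_def)
next
  case (Suc k)
  \<comment> \<open>Matrix powers multiply on the right, while \<open>gram_iter\<close> splits off
    its first factor on the left.\<close>
  have comm: "gram ^\<^sub>m Suc k = gram * gram ^\<^sub>m k" for k
  proof (induction k)
    case (Suc k)
    have "gram ^\<^sub>m Suc (Suc k) = gram * gram ^\<^sub>m k * gram" using Suc by simp
    also have "\<dots> = gram * gram ^\<^sub>m Suc k" using gram_carrier by (simp add: assoc_mult_mat[of _ d d _ d _ d])
    finally show ?case .
  qed (use gram_carrier in simp)
  have "(gram ^\<^sub>m Suc (Suc k)) $$ (i, j) = (\<Sum>m<d. gram $$ (i, m) * (gram ^\<^sub>m Suc k) $$ (m, j))"
    unfolding comm[of "Suc k"] using Suc.prems gram_carrier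
    by (simp add: scalar_prod_def lessThan_atLeast0 del: pow_mat.simps)
  also have "\<dots> = (\<Sum>m<d. of_real (sqrt (weight i) * sqrt (weight j)) * (weight m *\<^sub>R (K_H (e i) (e m) * gram_iter k (e m) (e j))))"
  proof (rule sum.cong[OF refl])
    fix m assume "m \<in> {..<d}"
    hence m: "m < d" by simp
    have "complex_of_real (weight m) = of_real (sqrt (weight m)) * of_real (sqrt (weight m))"
      by (simp add: weight_nonneg flip: of_real_mult)
    thus "gram $$ (i, m) * (gram ^\<^sub>m Suc k) $$ (m, j) =
      of_real (sqrt (weight i) * sqrt (weight j)) * (weight m *\<^sub>R (K_H (e i) (e m) * gram_iter k (e m) (e j)))"
      unfolding Suc.IH[OF m Suc.prems(2)] using m Suc.prems by (simp add: gram_def scaleR_conv_of_real mult_ac)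
  qed
  finally show ?case by (simp only: sum_distrib_left gram_iter.simps)
qed

text \<open>One and the same list of eigenvalues factors the generating polynomial and gives the
  traces of all powers; through it the logarithm of the former is expressed by the latter.\<close>

theorem step_spectrum:
  obtains l :: "nat \<Rightarrow> real" where "\<And>i. i < d \<Longrightarrow> 0 \<le> l i"
    and "\<And>t. (\<Prod>i<d. 1 + t * l i) = (\<Sum>n\<le>d. correlation_integral B g n * t ^ n)"
    and "\<And>k. (\<integral>z. iter_kernel (step_kernel B g) k z z \<partial>lborel) = of_real (\<Sum>i<d. l i ^ Suc k)"
proof -
  obtain l where l: "\<And>i. i < d \<Longrightarrow> 0 \<le> l i"
    and det: "\<And>s t :: real. Determinant.det (complex_of_real s \<cdot>\<^sub>m 1\<^sub>m d + complex_of_real t \<cdot>\<^sub>m gram) = complex_of_real (\<Prod>i<d. s + t * l i)"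
    and tr: "\<And>k. (\<Sum>i<d. (gram ^\<^sub>m k) $$ (i, i)) = complex_of_real (\<Sum>i<d. l i ^ k)"
    by (rule psd_spectrum[OF gram_carrier gram_psd], rule that)
  show thesis
  proof (rule that[of l])
    fix t :: real
    have "complex_of_real 1 \<cdot>\<^sub>m 1\<^sub>m d + complex_of_real t \<cdot>\<^sub>m gram = 1\<^sub>m d + of_real t \<cdot>\<^sub>m gram"
      using gram_carrier by (intro eq_matI) auto
    hence "complex_of_real (\<Prod>i<d. 1 + t * l i) = Determinant.det (1\<^sub>m d + of_real t \<cdot>\<^sub>m gram)"
      using det[of 1 t] by (simp only:)
    also have "\<dots> = (\<Sum>n\<le>d. of_real t ^ n / fact n *
     (\<Sum>x\<in>{..<n} \<rightarrow>\<^sub>E {0..<d}. Determinant.det (Matrix.mat n n (\<lambda>(i, j). gram $$ (x i, x j)))))"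
      by (rule det_one_plus_smult_expansion[OF gram_carrier])
    also have "\<dots> = (\<Sum>n\<le>d. of_real t ^ n / fact n *
     (\<Sum>x\<in>{..<n} \<rightarrow>\<^sub>E {..<d}. of_real ((\<Prod>i<n. weight (x i)) * correlation n (\<lambda>i. e (x i)))))"
      unfolding lessThan_atLeast0[symmetric] by (intro sum.cong refl arg_cong2[where f = "(*)"] det_gram)
    also have "\<dots> = of_real (\<Sum>n\<le>d. correlation_integral B g n * t ^ n)"
      unfolding correlation_integral_step of_real_sum by (intro sum.cong refl) (simp add: mult_ac)
    finally show "(\<Prod>i<d. 1 + t * l i) = (\<Sum>n\<le>d. correlation_integral B g n * t ^ n)" by (simp only: of_real_eq_iff)
  next
    fix k
    have "(\<integral>z. iter_kernel (step_kernel B g) k z z \<partial>lborel) = (\<integral>z. indicator B z *\<^sub>R gram_iter k (g z) (g z) \<partial>lborel)"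
      by (intro Bochner_Integration.integral_cong refl) (simp add: iter_step_kernel)
    also have "\<dots> = (\<Sum>i<d. weight i *\<^sub>R gram_iter k (e i) (e i))" by (rule step_integral[of "\<lambda>v. gram_iter k v v"])
    also have "\<dots> = (\<Sum>i<d. (gram ^\<^sub>m Suc k) $$ (i, i))"
      by (intro sum.cong refl) (simp add: gram_pow weight_nonneg scaleR_conv_of_real flip: of_real_mult del: pow_mat.simps)
    finally show "(\<integral>z. iter_kernel (step_kernel B g) k z z \<partial>lborel) = of_real (\<Sum>i<d. l i ^ Suc k)"
      by (simp only: tr)
  qed (rule l)
qed

text \<open>With more points than sample values two of them share a sample point, and the
  determinant has equal rows.\<close>

lemma correlation_integral_eq_0:
  assumes "n > d"
  shows "correlation_integral B g n = 0"
proof -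
  have "correlation n (\<lambda>i. e (c i)) = 0" if c: "c \<in> {..<n} \<rightarrow>\<^sub>E {..<d}" for c
  proof -
    have "\<not> inj_on c {..<n}"
    proof
      assume "inj_on c {..<n}"
      hence "card {..<n} \<le> card {..<d}" using c by (intro card_inj_on_le[of c]) auto
      thus False using assms by simp
    qed
    hence "\<not> inj_on (\<lambda>i. e (c i)) {..<n}" unfolding inj_on_def by metis
    thus ?thesis unfolding correlation_def using det_eq_0_if_not_inj[of "\<lambda>i. e (c i)" n K_H] by simp
  qed
  thus ?thesis by (simp add: correlation_integral_step)
qed

end

section \<open>Refining the discretisation\<close>

lemma simple_approximation_half_plane:
  obtains g :: "nat \<Rightarrow> complex \<Rightarrow> complex" where "\<And>i. g i \<in> borel_measurable borel" "\<And>i. finite (range (g i))"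
    "\<And>i z. Im (g i z) > 1/2" "\<And>z. Im z \<ge> 1 \<Longrightarrow> (\<lambda>i. g i z) \<longlonglongrightarrow> z"
proof -
  obtain F :: "nat \<Rightarrow> complex \<Rightarrow> complex" where F: "\<And>i. simple_function borel (F i)" "\<And>z. (\<lambda>i. F i z) \<longlonglongrightarrow> z"
    using borel_measurable_implies_sequence_metric[of "\<lambda>z::complex. z" borel 0] by auto
  \<comment> \<open>Values that leave the half-plane or come close to its boundary are replaced by
    \<open>\<i>\<close>; at points of height at least \<open>1\<close> this eventually stops
    happening.\<close>
  define g where "g i z = (if Im (F i z) > 1/2 then F i z else \<i>)" for i z
  have Fm [measurable]: "F i \<in> borel_measurable borel" for i using F(1) by (rule borel_measurable_simple_function)
  show thesis
  proof (rule that[of g])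
    show "g i \<in> borel_measurable borel" for i unfolding g_def by measurable
    have "finite (range (F i))" for i using simple_functionD(1)[OF F(1)[of i]] by simp
    moreover have "range (g i) \<subseteq> insert \<i> (range (F i))" for i by (auto simp: g_def)
    ultimately show "finite (range (g i))" for i by (metis finite_insert finite_subset)
    show "Im (g i z) > 1/2" for i z by (simp add: g_def)
    show "(\<lambda>i. g i z) \<longlonglongrightarrow> z" if "Im z \<ge> 1" for z
    proof (rule Lim_transform_eventually[OF F(2)])
      have "(\<lambda>i. Im (F i z)) \<longlonglongrightarrow> Im z" by (intro tendsto_Im F)
      hence "\<forall>\<^sub>F i in sequentially. Im (F i z) > 1/2" using that by (intro order_tendstoD) auto
      thus "\<forall>\<^sub>F i in sequentially. F i z = g i z" by eventually_elim (simp add: g_def)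
    qed
  qed
qed

locale bounded_region =
  fixes B :: "complex set"
  assumes B: "B \<in> sets borel" and B_sub: "B \<subseteq> {z. Im z \<ge> 1}" and B_fin: "emeasure lborel B < \<infinity>"
begin

lemma B_half: "B \<subseteq> {z. Im z > 0}" using B_sub by auto

lemma prod_indicator_integrable:
  fixes n :: nat
  shows "integrable (Pi\<^sub>M {..<n} (\<lambda>_. halfplane_measure)) (\<lambda>x. (\<Prod>i<n. indicator B (x i)) :: real)"
proof (rule halfplane.product_integrable_prod[where f = "\<lambda>_. indicator B", OF finite_lessThan])
  show "integrable halfplane_measure (indicator B :: complex \<Rightarrow> real)"
    using sets_halfplane[OF B B_half] emeasure_halfplane[OF B B_half] B_fin by (intro integrable_real_indicator) auto
qed

lemma prod_indicator_cases:
  fixes n :: nat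
  shows
  "(\<Prod>i<n. indicator B (x i)) = (if \<forall>i<n. x i \<in> B then 1 else (0::real))"
proof (cases "\<forall>i<n. x i \<in> B")
  case False
  then obtain i where "i < n" "x i \<notin> B" by auto
  hence "(\<Prod>i<n. indicator B (x i) :: real) = 0" by (intro prod_zero) (auto intro!: bexI[of _ i])
  thus ?thesis using False by simp
qed simp

lemma prod_indicator_measurable:
  fixes n :: nat
  shows "(\<lambda>x. (\<Prod>i<n. indicator B (x i)) :: real) \<in> borel_measurable (Pi\<^sub>M {..<n} (\<lambda>_. halfplane_measure))"
  using prod_indicator_integrable by (rule borel_measurable_integrable)

lemma correlation_integral_tendsto:
  assumes g: "\<And>i. g i \<in> borel_measurable borel" "\<And>i z. Im (g i z) > 1/2" "\<And>z. Im z \<ge> 1 \<Longrightarrow> (\<lambda>i. g i z) \<longlonglongrightarrow> z"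
  shows "(\<lambda>i. correlation_integral B (g i) n) \<longlonglongrightarrow> correlation_integral B (\<lambda>z. z) n"
  unfolding correlation_integral_def
proof (intro tendsto_divide tendsto_const, rule integral_dominated_convergence)
  let ?P = "Pi\<^sub>M {..<n} (\<lambda>_. halfplane_measure)"
  show "(\<lambda>x. (\<Prod>j<n. indicator B (x j)) * correlation n (\<lambda>j. x j)) \<in> borel_measurable ?P"
    by (intro borel_measurable_times prod_indicator_measurable correlation_measurable[of "\<lambda>z. z"]) simp
  show "(\<lambda>x. (\<Prod>j<n. indicator B (x j)) * correlation n (\<lambda>j. g i (x j))) \<in> borel_measurable ?P" for i
    by (intro borel_measurable_times prod_indicator_measurable correlation_measurable g)
  show "integrable ?P (\<lambda>x. (\<Prod>j<n. indicator B (x j)) * fact n :: real)"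
    using prod_indicator_integrable by simp
  show "AE x in ?P. norm ((\<Prod>j<n. indicator B (x j)) * correlation n (\<lambda>j. g i (x j))) \<le> (\<Prod>j<n. indicator B (x j)) * fact n" for i
    using correlation_bound[of n "\<lambda>j. g i (_ j)"] g(2)
    by (intro AE_I2) (simp add: prod_indicator_cases correlation_bound less_imp_le)
  show "AE x in ?P. (\<lambda>i. (\<Prod>j<n. indicator B (x j)) * correlation n (\<lambda>j. g i (x j)))
      \<longlonglongrightarrow> (\<Prod>j<n. indicator B (x j)) * correlation n (\<lambda>j. x j)"
  proof (intro AE_I2)
    fix x :: "nat \<Rightarrow> complex"
    show "(\<lambda>i. (\<Prod>j<n. indicator B (x j)) * correlation n (\<lambda>j. g i (x j))) \<longlonglongrightarrow> (\<Prod>j<n. indicator B (x j)) * correlation n (\<lambda>j. x j)"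
    proof (cases "\<forall>j<n. x j \<in> B")
      case True
      have "(\<lambda>i. K_H (g i (x j)) (g i (x k))) \<longlonglongrightarrow> K_H (x j) (x k)" if "j < n" "k < n" for j k
      proof -
        have "Im (x j) \<ge> 1" "Im (x k) \<ge> 1" using True that B_sub by auto
        thus ?thesis by (intro K_H_tendsto g) auto
      qed
      hence "(\<lambda>i. correlation n (\<lambda>j. g i (x j))) \<longlonglongrightarrow> correlation n (\<lambda>j. x j)"
        unfolding correlation_eq_sum
        by (intro tendsto_Re tendsto_sum tendsto_mult tendsto_const tendsto_prod) (auto dest: permutes_in_image)
      thus ?thesis by (intro tendsto_mult tendsto_const)
    next
      case False
      show ?thesis unfolding prod_indicator_cases if_not_P[OF False] by simp
    qed
  qed
qed simp

lemma region_kernel_majorant: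
  assumes "\<And>z. z \<in> B \<Longrightarrow> Im (g z) \<ge> 1/2"
  shows "norm (step_kernel B g z v) \<le> indicator B v" "norm (step_kernel B g z v) \<le> 1"
  using norm_K_H_le_1 assms by (auto simp: step_kernel_def)

lemma step_kernel_measurable:
  assumes [measurable]: "g \<in> borel_measurable borel"
  shows "case_prod (step_kernel B g) \<in> borel_measurable (lborel \<Otimes>\<^sub>M lborel)"
proof -
  note [measurable] = B
  show ?thesis unfolding step_kernel_def by measurable
qed

lemma indicator_B_integrable: "integrable lborel (indicator B :: complex \<Rightarrow> real)"
  using B B_fin by (intro integrable_real_indicator) auto

text \<open>The region is fixed in this limit, so the rows may be bounded by the indicator of
  \<open>B\<close>, whose mass is the area of \<open>B\<close>.\<close>

lemma step_trace_tendsto: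
  assumes g: "\<And>i. g i \<in> borel_measurable borel" "\<And>i z. Im (g i z) > 1/2" "\<And>z. Im z \<ge> 1 \<Longrightarrow> (\<lambda>i. g i z) \<longlonglongrightarrow> z"
  shows "(\<lambda>i. \<integral>z. iter_kernel (step_kernel B (g i)) k z z \<partial>lborel) \<longlonglongrightarrow> (\<integral>z. iter_kernel (restrict_kernel B) k z z \<partial>lborel)"
proof -
  have eq: "restrict_kernel B = step_kernel B (\<lambda>z. z)" by (simp add: fun_eq_iff restrict_kernel_def step_kernel_def)
  define C where "C = (\<integral>v. indicator B v \<partial>(lborel :: complex measure) :: real)"
  have m: "(\<lambda>z. iter_kernel (step_kernel B h) k z z) \<in> borel_measurable lborel" if "h \<in> borel_measurable borel" for h
    using measurable_compose[OF _ iter_kernel_measurable[OF step_kernel_measurable[OF that], of k], of "\<lambda>z. (z, z)" lborel] by simp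
  have maj: "norm (step_kernel B (g i) z v) \<le> indicator B v" "norm (step_kernel B (g i) z v) \<le> 1" for i z v
    using region_kernel_majorant[of "g i"] g(2)[of i] by (auto simp: less_imp_le)
  show ?thesis unfolding eq
  proof (rule integral_dominated_convergence)
    show "(\<lambda>z. iter_kernel (step_kernel B (\<lambda>z. z)) k z z) \<in> borel_measurable lborel" by (intro m) simp
    show "(\<lambda>z. iter_kernel (step_kernel B (g i)) k z z) \<in> borel_measurable lborel" for i by (intro m g)
    show "integrable lborel (\<lambda>z. indicator B z * (1 * C ^ k))" using indicator_B_integrable by simp
    show "AE z in lborel. norm (iter_kernel (step_kernel B (g i)) k z z) \<le> indicator B z * (1 * C ^ k)" for i
    proof (intro AE_I2)
      fix z show "norm (iter_kernel (step_kernel B (g i)) k z z) \<le> indicator B z * (1 * C ^ k)"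
      proof (cases "z \<in> B")
        case True
        have "norm (iter_kernel (step_kernel B (g i)) k z z) \<le> 1 * C ^ k"
          by (rule iter_kernel_bound[OF step_kernel_measurable[OF g(1)] maj(1) indicator_B_integrable _ maj(2)]) (simp add: C_def)
        thus ?thesis using True by simp
      next
        case False
        hence "iter_kernel (step_kernel B (g i)) k z z = 0" by (intro iter_kernel_eq_0) (simp add: step_kernel_def)
        thus ?thesis using False by simp
      qed
    qed
    show "AE z in lborel. (\<lambda>i. iter_kernel (step_kernel B (g i)) k z z) \<longlonglongrightarrow> iter_kernel (step_kernel B (\<lambda>z. z)) k z z"
    proof (intro AE_I2 iter_kernel_tendsto)
      show "case_prod (step_kernel B (g i)) \<in> borel_measurable (lborel \<Otimes>\<^sub>M lborel)" for i by (rule step_kernel_measurable[OF g(1)])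
      show "case_prod (step_kernel B (\<lambda>z. z)) \<in> borel_measurable (lborel \<Otimes>\<^sub>M lborel)" by (rule step_kernel_measurable) simp
      show "norm (step_kernel B (g i) z v) \<le> indicator B v" "norm (step_kernel B (g i) z v) \<le> 1" for i z v by (rule maj)+
      show "integrable lborel (indicator B :: complex \<Rightarrow> real)" by (rule indicator_B_integrable)
      show "(\<integral>v. indicator B v \<partial>lborel) \<le> C" by (simp add: C_def)
      show "(\<lambda>i. step_kernel B (g i) z v) \<longlonglongrightarrow> step_kernel B (\<lambda>z. z) z v" for z v
      proof (cases "z \<in> B \<and> v \<in> B")
        case True
        hence "Im z \<ge> 1" "Im v \<ge> 1" using B_sub by auto
        hence "(\<lambda>i. K_H (g i z) (g i v)) \<longlonglongrightarrow> K_H z v" by (intro K_H_tendsto g) auto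
        thus ?thesis using True by (simp add: step_kernel_def)
      next
        case False
        hence "step_kernel B h z v = 0" for h by (auto simp: step_kernel_def)
        thus ?thesis by simp
      qed
    qed
  qed
qed

lemma correlation_integral_nonneg:
  assumes "\<And>z. z \<in> B \<Longrightarrow> Im (g z) > 0"
  shows "correlation_integral B g n \<ge> 0"
  unfolding correlation_integral_def
  by (intro divide_nonneg_pos integral_nonneg_AE AE_I2)
     (auto simp: prod_indicator_cases intro!: correlation_nonneg assms)

end

section \<open>The limiting cumulant generating function\<close>

definition scgf :: "real \<Rightarrow> real \<Rightarrow> real" where
  "scgf a \<theta> = (1 / (2 * pi)) * (LBINT \<xi>:{0<..}. ln (1 + (exp \<theta> - 1) * symbol a \<xi>))"

text \<open>The integrand is the success probability of a Bernoulli variable of parameter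
  \<open>symbol a \<xi>\<close> after tilting by \<open>\<theta>\<close>.\<close>

definition scgf_deriv :: "real \<Rightarrow> real \<Rightarrow> real" where
  "scgf_deriv a \<theta> = (1 / (2 * pi)) * (LBINT \<xi>:{0<..}. exp \<theta> * symbol a \<xi> / (1 + (exp \<theta> - 1) * symbol a \<xi>))"

context
  fixes a :: real
  assumes a: "a > 1"
begin

lemma tilted_symbol_pos:
  assumes "\<xi> > 0"
  shows "1 + (exp \<theta> - 1) * symbol a \<xi> > 0"
proof -
  have "1 + (exp \<theta> - 1) * symbol a \<xi> = (1 - symbol a \<xi>) + exp \<theta> * symbol a \<xi>" by (simp add: algebra_simps)
  also have "\<dots> > 0" using symbol_bounds[OF a assms] by (intro add_pos_pos) auto
  finally show ?thesis .
qed

text \<open>The left side is a convex combination of \<open>1\<close> and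
  \<open>exp \<theta>\<close>.\<close>

lemma tilted_symbol_ge:
  assumes "\<xi> > 0"
  shows "1 + (exp \<theta> - 1) * symbol a \<xi> \<ge> min 1 (exp \<theta>)"
proof (cases "\<theta> \<ge> 0")
  case True
  hence "(exp \<theta> - 1) * symbol a \<xi> \<ge> 0" using symbol_bounds[OF a assms] by (intro mult_nonneg_nonneg) auto
  thus ?thesis by simp
next
  case False
  hence "exp \<theta> \<le> 1" by simp
  have "1 + (exp \<theta> - 1) * symbol a \<xi> = exp \<theta> + (1 - exp \<theta>) * (1 - symbol a \<xi>)" by (simp add: algebra_simps)
  also have "\<dots> \<ge> exp \<theta>" using symbol_bounds[OF a assms] \<open>exp \<theta> \<le> 1\<close> by simp
  finally show ?thesis by simp
qed

lemma symbol_integrable: "set_integrable lborel {0<..} (\<lambda>\<xi>. symbol a \<xi>)"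
  using symbol_power_integrable[OF a, of 0] by simp

lemma tilted_density_bounds:
  assumes \<xi>: "\<xi> > 0"
  shows "0 \<le> exp \<theta> * symbol a \<xi> / (1 + (exp \<theta> - 1) * symbol a \<xi>)"
    "exp \<theta> * symbol a \<xi> / (1 + (exp \<theta> - 1) * symbol a \<xi>) \<le> exp \<bar>\<theta>\<bar> * symbol a \<xi>"
proof -
  have s: "0 < symbol a \<xi>" using symbol_bounds[OF a \<xi>] by simp
  show "0 \<le> exp \<theta> * symbol a \<xi> / (1 + (exp \<theta> - 1) * symbol a \<xi>)"
    using s tilted_symbol_pos[OF \<xi>, of \<theta>] by (intro divide_nonneg_pos) auto
  have "exp \<theta> * symbol a \<xi> \<le> (exp \<bar>\<theta>\<bar> * symbol a \<xi>) * min 1 (exp \<theta>)"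
    using s by (cases "\<theta> \<ge> 0") (auto simp: exp_minus min_def field_simps)
  also have "\<dots> \<le> (exp \<bar>\<theta>\<bar> * symbol a \<xi>) * (1 + (exp \<theta> - 1) * symbol a \<xi>)"
    using s tilted_symbol_ge[OF \<xi>, of \<theta>] by (intro mult_left_mono) auto
  finally show "exp \<theta> * symbol a \<xi> / (1 + (exp \<theta> - 1) * symbol a \<xi>) \<le> exp \<bar>\<theta>\<bar> * symbol a \<xi>"
    using tilted_symbol_pos[OF \<xi>, of \<theta>] by (simp add: divide_le_eq)
qed

lemma log_tilted_deriv:
  assumes "\<xi> > 0"
  shows "((\<lambda>\<theta>. ln (1 + (exp \<theta> - 1) * symbol a \<xi>)) has_real_derivative
     exp \<theta> * symbol a \<xi> / (1 + (exp \<theta> - 1) * symbol a \<xi>)) (at \<theta>)"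
  using tilted_symbol_pos[OF assms, of \<theta>] by (auto intro!: derivative_eq_intros)

text \<open>A mean value bound with constant proportional to the symbol: with
  \<open>\<eta> = 0\<close> it gives integrability of the logarithm, and in general the majorant of
  the difference quotients.\<close>

lemma log_tilted_lipschitz:
  assumes \<xi>: "\<xi> > 0"
  shows "\<bar>ln (1 + (exp \<theta> - 1) * symbol a \<xi>) - ln (1 + (exp \<eta> - 1) * symbol a \<xi>)\<bar> \<le>
    exp (max \<bar>\<theta>\<bar> \<bar>\<eta>\<bar>) * symbol a \<xi> * \<bar>\<theta> - \<eta>\<bar>"
proof -
  let ?f = "\<lambda>\<theta>. ln (1 + (exp \<theta> - 1) * symbol a \<xi>)"
  have "norm (?f \<theta> - ?f \<eta>) \<le> (exp (max \<bar>\<theta>\<bar> \<bar>\<eta>\<bar>) * symbol a \<xi>) * norm (\<theta> - \<eta>)"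
  proof (rule field_differentiable_bound[where S = "{min \<theta> \<eta>..max \<theta> \<eta>}"])
    show "(?f has_field_derivative exp z * symbol a \<xi> / (1 + (exp z - 1) * symbol a \<xi>)) (at z within {min \<theta> \<eta>..max \<theta> \<eta>})" for z
      using log_tilted_deriv[OF \<xi>] by (rule has_field_derivative_at_within)
    fix z assume "z \<in> {min \<theta> \<eta>..max \<theta> \<eta>}"
    hence "\<bar>z\<bar> \<le> max \<bar>\<theta>\<bar> \<bar>\<eta>\<bar>" by auto
    hence "exp \<bar>z\<bar> * symbol a \<xi> \<le> exp (max \<bar>\<theta>\<bar> \<bar>\<eta>\<bar>) * symbol a \<xi>"
      using symbol_bounds[OF a \<xi>] by (intro mult_right_mono) auto
    thus "norm (exp z * symbol a \<xi> / (1 + (exp z - 1) * symbol a \<xi>)) \<le> exp (max \<bar>\<theta>\<bar> \<bar>\<eta>\<bar>) * symbol a \<xi>"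
      unfolding real_norm_def abs_of_nonneg[OF tilted_density_bounds(1)[OF \<xi>]]
      using tilted_density_bounds(2)[OF \<xi>, of z] by linarith
  qed auto
  thus ?thesis by simp
qed

lemma log_tilted_integrable: "set_integrable lborel {0<..} (\<lambda>\<xi>. ln (1 + (exp \<theta> - 1) * symbol a \<xi>))"
proof (rule set_integrable_bound)
  show "set_integrable lborel {0<..} (\<lambda>\<xi>. exp \<bar>\<theta>\<bar> * \<bar>\<theta>\<bar> * symbol a \<xi>)"
    using symbol_integrable by (rule set_integrable_mult_right)
  show "set_borel_measurable lborel {0<..} (\<lambda>\<xi>. ln (1 + (exp \<theta> - 1) * symbol a \<xi>))"
    unfolding set_borel_measurable_def by measurable
  show "AE \<xi> in lborel. \<xi> \<in> {0<..} \<longrightarrow> norm (ln (1 + (exp \<theta> - 1) * symbol a \<xi>)) \<le> norm (exp \<bar>\<theta>\<bar> * \<bar>\<theta>\<bar> * symbol a \<xi>)"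
  proof (intro AE_I2 impI)
    fix \<xi> :: real assume "\<xi> \<in> {0<..}"
    hence \<xi>: "\<xi> > 0" by simp
    show "norm (ln (1 + (exp \<theta> - 1) * symbol a \<xi>)) \<le> norm (exp \<bar>\<theta>\<bar> * \<bar>\<theta>\<bar> * symbol a \<xi>)"
      using log_tilted_lipschitz[OF \<xi>, of \<theta> 0] symbol_bounds[OF a \<xi>] by (simp add: abs_mult mult_ac)
  qed
qed

lemma tilted_density_integrable: "set_integrable lborel {0<..} (\<lambda>\<xi>. exp \<theta> * symbol a \<xi> / (1 + (exp \<theta> - 1) * symbol a \<xi>))"
proof (rule set_integrable_bound)
  show "set_integrable lborel {0<..} (\<lambda>\<xi>. exp \<bar>\<theta>\<bar> * symbol a \<xi>)"
    using symbol_integrable by (rule set_integrable_mult_right)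
  show "set_borel_measurable lborel {0<..} (\<lambda>\<xi>. exp \<theta> * symbol a \<xi> / (1 + (exp \<theta> - 1) * symbol a \<xi>))"
    unfolding set_borel_measurable_def by measurable
  show "AE \<xi> in lborel. \<xi> \<in> {0<..} \<longrightarrow> norm (exp \<theta> * symbol a \<xi> / (1 + (exp \<theta> - 1) * symbol a \<xi>)) \<le> norm (exp \<bar>\<theta>\<bar> * symbol a \<xi>)"
  proof (intro AE_I2 impI)
    fix \<xi> :: real assume "\<xi> \<in> {0<..}"
    hence \<xi>: "\<xi> > 0" by simp
    show "norm (exp \<theta> * symbol a \<xi> / (1 + (exp \<theta> - 1) * symbol a \<xi>)) \<le> norm (exp \<bar>\<theta>\<bar> * symbol a \<xi>)"
      unfolding real_norm_def abs_of_nonneg[OF tilted_density_bounds(1)[OF \<xi>]]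
      using tilted_density_bounds(2)[OF \<xi>, of \<theta>] by linarith
  qed
qed

lemma scgf_has_derivative: "(scgf a has_real_derivative scgf_deriv a \<theta>) (at \<theta>)"
  unfolding DERIV_def tendsto_at_iff_sequentially
proof (intro allI impI)
  fix h :: "nat \<Rightarrow> real" assume h: "\<forall>i. h i \<in> UNIV - {0}" "h \<longlonglongrightarrow> 0"
  let ?f = "\<lambda>\<theta> \<xi>. ln (1 + (exp \<theta> - 1) * symbol a \<xi>)"
  let ?q = "\<lambda>i \<xi>. (?f (\<theta> + h i) \<xi> - ?f \<theta> \<xi>) / h i"
  let ?d = "\<lambda>\<xi>. exp \<theta> * symbol a \<xi> / (1 + (exp \<theta> - 1) * symbol a \<xi>)"
  have hn: "h i \<noteq> 0" for i using h(1) by auto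
  obtain H where H: "\<And>i. \<bar>h i\<bar> \<le> H" using convergent_imp_Bseq[of h] h(2) unfolding convergent_def Bseq_def by auto
  have "(\<lambda>i. LBINT \<xi>:{0<..}. ?q i \<xi>) \<longlonglongrightarrow> (LBINT \<xi>:{0<..}. ?d \<xi>)"
    unfolding set_lebesgue_integral_def
  proof (rule integral_dominated_convergence)
    show "(\<lambda>\<xi>. indicator {0<..} \<xi> *\<^sub>R ?d \<xi>) \<in> borel_measurable lborel"
      "(\<lambda>\<xi>. indicator {0<..} \<xi> *\<^sub>R ?q i \<xi>) \<in> borel_measurable lborel" for i by measurable
    show "integrable lborel (\<lambda>\<xi>. indicator {0<..} \<xi> *\<^sub>R (exp (\<bar>\<theta>\<bar> + H) * symbol a \<xi>))"
      using set_integrable_mult_right[OF symbol_integrable, of "exp (\<bar>\<theta>\<bar> + H)"] unfolding set_integrable_def .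
    show "AE \<xi> in lborel. (\<lambda>i. indicator {0<..} \<xi> *\<^sub>R ?q i \<xi>) \<longlonglongrightarrow> indicator {0<..} \<xi> *\<^sub>R ?d \<xi>"
    proof (intro AE_I2)
      fix \<xi> :: real
      show "(\<lambda>i. indicator {0<..} \<xi> *\<^sub>R ?q i \<xi>) \<longlonglongrightarrow> indicator {0<..} \<xi> *\<^sub>R ?d \<xi>"
      proof (cases "\<xi> > 0")
        case True
        have "((\<lambda>k. (?f (\<theta> + k) \<xi> - ?f \<theta> \<xi>) / k) \<longlongrightarrow> ?d \<xi>) (at 0)"
          using log_tilted_deriv[OF True, of \<theta>] unfolding DERIV_def .
        hence "((\<lambda>k. (?f (\<theta> + k) \<xi> - ?f \<theta> \<xi>) / k) \<circ> h) \<longlonglongrightarrow> ?d \<xi>"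
          using h unfolding tendsto_at_iff_sequentially by blast
        thus ?thesis using True by (simp add: comp_def)
      qed simp
    qed
    show "AE \<xi> in lborel. norm (indicator {0<..} \<xi> *\<^sub>R ?q i \<xi>) \<le> indicator {0<..} \<xi> *\<^sub>R (exp (\<bar>\<theta>\<bar> + H) * symbol a \<xi>)" for i
    proof (intro AE_I2)
      fix \<xi> :: real
      show "norm (indicator {0<..} \<xi> *\<^sub>R ?q i \<xi>) \<le> indicator {0<..} \<xi> *\<^sub>R (exp (\<bar>\<theta>\<bar> + H) * symbol a \<xi>)"
      proof (cases "\<xi> > 0")
        case True
        have "\<bar>?f (\<theta> + h i) \<xi> - ?f \<theta> \<xi>\<bar> \<le> exp (max \<bar>\<theta> + h i\<bar> \<bar>\<theta>\<bar>) * symbol a \<xi> * \<bar>\<theta> + h i - \<theta>\<bar>"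
          by (rule log_tilted_lipschitz[OF True])
        also have "\<dots> \<le> exp (\<bar>\<theta>\<bar> + H) * symbol a \<xi> * \<bar>h i\<bar>"
          using H[of i] symbol_bounds[OF a True] by (intro mult_mono mult_right_mono) auto
        finally have "\<bar>?q i \<xi>\<bar> \<le> exp (\<bar>\<theta>\<bar> + H) * symbol a \<xi>" using hn[of i] by (simp add: divide_le_eq)
        thus ?thesis using True by simp
      qed simp
    qed
  qed
  moreover have "(scgf a (\<theta> + h i) - scgf a \<theta>) / h i = (1 / (2 * pi)) * (LBINT \<xi>:{0<..}. ?q i \<xi>)" for i
  proof -
    have "(LBINT \<xi>:{0<..}. ?q i \<xi>) = (LBINT \<xi>:{0<..}. ?f (\<theta> + h i) \<xi> - ?f \<theta> \<xi>) / h i"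
      by (rule set_integral_divide_zero)
    also have "(LBINT \<xi>:{0<..}. ?f (\<theta> + h i) \<xi> - ?f \<theta> \<xi>) = (LBINT \<xi>:{0<..}. ?f (\<theta> + h i) \<xi>) - (LBINT \<xi>:{0<..}. ?f \<theta> \<xi>)"
      by (intro set_integral_diff log_tilted_integrable)
    finally show ?thesis by (simp add: scgf_def diff_divide_distrib right_diff_distrib)
  qed
  ultimately show "((\<lambda>k. (scgf a (\<theta> + k) - scgf a \<theta>) / k) \<circ> h) \<longlonglongrightarrow> scgf_deriv a \<theta>"
    unfolding comp_def scgf_deriv_def by (simp only:) (intro tendsto_mult tendsto_const)
qed

lemma scgf_deriv_mono: "mono (scgf_deriv a)"
proof (rule monoI)
  fix \<theta> \<eta> :: real assume le: "\<theta> \<le> \<eta>"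
  have "exp \<theta> * symbol a \<xi> / (1 + (exp \<theta> - 1) * symbol a \<xi>) \<le> exp \<eta> * symbol a \<xi> / (1 + (exp \<eta> - 1) * symbol a \<xi>)" if \<xi>: "\<xi> > 0" for \<xi>
  proof -
    have s: "0 < symbol a \<xi>" "symbol a \<xi> < 1" using symbol_bounds[OF a \<xi>] by auto
    \<comment> \<open>After cross-multiplication the terms with
      \<open>exp \<theta> * exp \<eta>\<close> cancel and only this comparison remains.\<close>
    have "exp \<theta> * symbol a \<xi> * (1 - symbol a \<xi>) \<le> exp \<eta> * symbol a \<xi> * (1 - symbol a \<xi>)"
      using le s by (intro mult_right_mono) auto
    hence "exp \<theta> * symbol a \<xi> * (1 + (exp \<eta> - 1) * symbol a \<xi>) \<le> exp \<eta> * symbol a \<xi> * (1 + (exp \<theta> - 1) * symbol a \<xi>)"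
      by (simp add: algebra_simps)
    thus ?thesis using tilted_symbol_pos[OF \<xi>] by (simp add: frac_le_eq divide_le_eq pos_le_divide_eq field_simps del: mult_le_cancel_left mult_le_cancel_right)
  qed
  thus "scgf_deriv a \<theta> \<le> scgf_deriv a \<eta>" unfolding scgf_deriv_def
    by (intro mult_left_mono set_integral_mono tilted_density_integrable) auto
qed

lemma scgf_0: "scgf a 0 = 0"
  by (simp add: scgf_def)

lemma scgf_deriv_0: "scgf_deriv a 0 = 1 / (4 * pi) * (1 - 1 / a)"
proof -
  have "(LBINT \<xi>:{0<..}. symbol a \<xi>) = (LBINT \<xi>:{0<..}. exp (- 2 * \<xi>)) - (LBINT \<xi>:{0<..}. exp (- (2 * a) * \<xi>))"
    using set_integral_diff(2)[OF exp_integrable[of 2] exp_integrable[of "2 * a"]] a by (simp add: symbol_def)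
  also have "\<dots> = 1 / 2 - 1 / (2 * a)" using exp_integral[of 2] exp_integral[of "2 * a"] a by simp
  finally show ?thesis using a by (simp add: scgf_deriv_def field_simps)
qed

lemma scgf_deriv_0_pos: "scgf_deriv a 0 > 0"
  unfolding scgf_deriv_0 using a by simp

text \<open>Superlinear growth at infinity: on a stretch of \<open>\<xi>\<close> of any length
  \<open>R\<close> the symbol stays above some \<open>c > 0\<close>, so the logarithm is at least
  \<open>\<theta> + ln c\<close> there.\<close>

lemma scgf_lower:
  assumes r: "r > 0"
  obtains D where "\<And>\<theta>. \<theta> \<ge> 0 \<Longrightarrow> scgf a \<theta> \<ge> r * \<theta> - D"
proof -
  \<comment> \<open>The length for which the prefactor \<open>1 / (2 * pi)\<close> leaves the slope
    \<open>r\<close>.\<close>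
  define R where "R = 2 * pi * r"
  \<comment> \<open>The symbol is
    \<open>exp (- 2 * \<xi>) * (1 - exp (- 2 * (a - 1) * \<xi>))\<close>; on the stretch the first
    factor is least at \<open>\<xi> = R + 1\<close>, the second at \<open>\<xi> = 1\<close>.\<close>
  define c where "c = exp (- 2 * (R + 1)) - exp (- 2 * (R + 1)) * exp (- 2 * (a - 1))"
  have R: "R > 0" using r by (simp add: R_def)
  have "exp (- 2 * (a - 1)) < 1" using a by simp
  hence c: "c > 0" unfolding c_def using mult_strict_left_mono[of "exp (- 2 * (a - 1))" 1 "exp (- 2 * (R + 1))"] by simp
  have sc: "c \<le> symbol a \<xi>" if "1 \<le> \<xi>" "\<xi> \<le> R + 1" for \<xi>
  proof -
    have "symbol a \<xi> = exp (- 2 * \<xi>) * (1 - exp (- 2 * (a - 1) * \<xi>))"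
      by (simp add: symbol_def right_diff_distrib exp_add[symmetric] algebra_simps)
    moreover have "1 - exp (- 2 * (a - 1)) \<le> 1 - exp (- 2 * (a - 1) * \<xi>)" using that a by simp
    moreover have "exp (- 2 * (R + 1)) \<le> exp (- 2 * \<xi>)" using that by simp
    moreover have "0 \<le> 1 - exp (- 2 * (a - 1))" using a by simp
    ultimately have "exp (- 2 * (R + 1)) * (1 - exp (- 2 * (a - 1))) \<le> symbol a \<xi>" by (simp only:) (intro mult_mono, auto)
    thus ?thesis by (simp add: c_def right_diff_distrib)
  qed
  have "scgf a \<theta> \<ge> r * \<theta> - (- r * ln c)" if \<theta>: "\<theta> \<ge> 0" for \<theta>
  proof -
    have Rint: "(LBINT \<xi>. indicator {1..R + 1} \<xi> * (\<theta> + ln c)) = R * (\<theta> + ln c)" using R by simp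
    have "(LBINT \<xi>. indicator {1..R + 1} \<xi> * (\<theta> + ln c)) \<le> (LBINT \<xi>. indicator {0<..} \<xi> *\<^sub>R ln (1 + (exp \<theta> - 1) * symbol a \<xi>))"
    proof (rule Bochner_Integration.integral_mono)
      show "integrable lborel (\<lambda>\<xi>. indicator {1..R + 1} \<xi> * (\<theta> + ln c))" by (intro integrable_mult_left integrable_indicator_Icc)
      show "integrable lborel (\<lambda>\<xi>. indicator {0<..} \<xi> *\<^sub>R ln (1 + (exp \<theta> - 1) * symbol a \<xi>))"
        using log_tilted_integrable unfolding set_integrable_def .
      fix \<xi> :: real
      show "indicator {1..R + 1} \<xi> * (\<theta> + ln c) \<le> indicator {0<..} \<xi> *\<^sub>R ln (1 + (exp \<theta> - 1) * symbol a \<xi>)"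
      proof (cases "\<xi> \<in> {1..R + 1}")
        case True
        hence \<xi>: "\<xi> > 0" by simp
        have "exp \<theta> * c \<le> exp \<theta> * symbol a \<xi>" using sc True by simp
        also have "\<dots> \<le> 1 + (exp \<theta> - 1) * symbol a \<xi>" using symbol_bounds[OF a \<xi>] by (simp add: algebra_simps)
        finally have "ln (exp \<theta> * c) \<le> ln (1 + (exp \<theta> - 1) * symbol a \<xi>)"
          using c by (intro ln_mono) auto
        thus ?thesis using True c by (simp add: ln_mult)
      next
        case False
        have "0 \<le> ln (1 + (exp \<theta> - 1) * symbol a \<xi>)" if "\<xi> > 0"
          using symbol_bounds[OF a that] \<theta> by (intro ln_ge_zero) auto
        thus ?thesis using False by (auto simp: indicator_def)
      qed
    qed
    hence "R * (\<theta> + ln c) \<le> (LBINT \<xi>:{0<..}. ln (1 + (exp \<theta> - 1) * symbol a \<xi>))"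
      unfolding Rint set_lebesgue_integral_def .
    hence "(1 / (2 * pi)) * (R * (\<theta> + ln c)) \<le> scgf a \<theta>" unfolding scgf_def by (intro mult_left_mono) auto
    thus ?thesis by (simp add: R_def algebra_simps)
  qed
  thus thesis by (rule that)
qed

text \<open>As \<open>\<theta>\<close> decreases the integrand falls towards
  \<open>ln (1 - symbol a \<xi>)\<close>. This is integrable because the symbol keeps a distance
  \<open>\<kappa>\<close> from \<open>1\<close>, so that the logarithm is at least
  \<open>- (symbol a \<xi> / \<kappa>)\<close>.\<close>

lemma scgf_bounded_below:
  obtains D where "\<And>\<theta>. scgf a \<theta> \<ge> - D"
proof -
  \<comment> \<open>The first entry serves \<open>\<xi> \<ge> 1\<close>, where
    \<open>exp (- 2 * \<xi>)\<close> is away from \<open>1\<close>; the second serves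
    \<open>\<xi> < 1\<close>, where the ratio of the two exponentials is bounded below.\<close>
  define \<kappa> where "\<kappa> = min (1 - exp (- 2)) (exp (- 2 * (a - 1)))"
  have \<kappa>: "\<kappa> > 0" by (simp add: \<kappa>_def)
  have gap: "symbol a \<xi> \<le> 1 - \<kappa>" if \<xi>: "\<xi> > 0" for \<xi>
  proof (cases "\<xi> \<ge> 1")
    case True
    hence "exp (- 2 * \<xi>) \<le> exp (- 2)" by simp
    moreover have "symbol a \<xi> \<le> exp (- 2 * \<xi>)" by (simp add: symbol_def)
    moreover have "\<kappa> \<le> 1 - exp (- 2)" by (simp add: \<kappa>_def)
    ultimately show ?thesis by linarith
  next
    case False
    have "symbol a \<xi> = exp (- 2 * \<xi>) * (1 - exp (- 2 * (a - 1) * \<xi>))"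
      by (simp add: symbol_def right_diff_distrib exp_add[symmetric] algebra_simps)
    also have "\<dots> \<le> 1 * (1 - exp (- 2 * (a - 1) * \<xi>))"
    proof (rule mult_right_mono)
      have "0 \<le> (a - 1) * \<xi>" using \<xi> a by simp
      thus "0 \<le> 1 - exp (- 2 * (a - 1) * \<xi>)" by (simp add: algebra_simps)
    qed (use \<xi> in simp)
    finally have "symbol a \<xi> \<le> 1 - exp (- 2 * (a - 1) * \<xi>)" by simp
    moreover have "exp (- 2 * (a - 1) * 1) \<le> exp (- 2 * (a - 1) * \<xi>)"
      unfolding exp_le_cancel_iff using False a by (intro mult_left_mono_neg) auto
    moreover have "\<kappa> \<le> exp (- 2 * (a - 1) * 1)" by (simp add: \<kappa>_def)
    ultimately show ?thesis by linarith
  qed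
  have "scgf a \<theta> \<ge> - ((1 / (2 * pi)) * (LBINT \<xi>:{0<..}. symbol a \<xi> / \<kappa>))" for \<theta>
  proof -
    have "(LBINT \<xi>:{0<..}. - (symbol a \<xi> / \<kappa>)) \<le> (LBINT \<xi>:{0<..}. ln (1 + (exp \<theta> - 1) * symbol a \<xi>))"
    proof (rule set_integral_mono)
      show "set_integrable lborel {0<..} (\<lambda>\<xi>. - (symbol a \<xi> / \<kappa>))"
        using set_integrable_mult_right[OF symbol_integrable, of "- 1 / \<kappa>"] by simp
      fix \<xi> :: real assume "\<xi> \<in> {0<..}"
      hence \<xi>: "\<xi> > 0" by simp
      have m: "0 < symbol a \<xi>" "symbol a \<xi> < 1" using symbol_bounds[OF a \<xi>] by auto
      have "- (symbol a \<xi> / \<kappa>) \<le> - (symbol a \<xi> / (1 - symbol a \<xi>))"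
        using gap[OF \<xi>] m \<kappa> by (simp add: frac_le)
      also have "\<dots> = 1 - inverse (1 - symbol a \<xi>)" using m by (simp add: field_simps)
      also have "\<dots> \<le> ln (1 - symbol a \<xi>)"
        using ln_add_one_self_le_self2[of "inverse (1 - symbol a \<xi>) - 1"] m by (simp add: ln_inverse)
      also have "\<dots> \<le> ln (1 + (exp \<theta> - 1) * symbol a \<xi>)"
      proof (rule ln_mono)
        have "1 + (exp \<theta> - 1) * symbol a \<xi> = (1 - symbol a \<xi>) + exp \<theta> * symbol a \<xi>" by (simp add: algebra_simps)
        thus "1 - symbol a \<xi> \<le> 1 + (exp \<theta> - 1) * symbol a \<xi>" using m by simp
      qed (use m tilted_symbol_pos[OF \<xi>] in auto)
      finally show "- (symbol a \<xi> / \<kappa>) \<le> ln (1 + (exp \<theta> - 1) * symbol a \<xi>)" .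
    qed (rule log_tilted_integrable)
    hence "(1 / (2 * pi)) * (LBINT \<xi>:{0<..}. - (symbol a \<xi> / \<kappa>)) \<le> scgf a \<theta>"
      unfolding scgf_def by (intro mult_left_mono) auto
    thus ?thesis by (simp add: set_lebesgue_integral_def)
  qed
  thus thesis by (rule that)
qed

lemma scgf_legendre: "legendre (scgf a) (scgf_deriv a)"
proof
  fix x :: real assume x: "x \<ge> 0"
  \<comment> \<open>Slope \<open>x + 1\<close> instead of \<open>x\<close> meets the premise
    \<open>r > 0\<close> also at \<open>x = 0\<close>.\<close>
  obtain D1 where D1: "\<And>\<theta>. \<theta> \<ge> 0 \<Longrightarrow> scgf a \<theta> \<ge> (x + 1) * \<theta> - D1" using scgf_lower[of "x + 1"] x by auto
  obtain D2 where D2: "\<And>\<theta>. scgf a \<theta> \<ge> - D2" using scgf_bounded_below by blast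
  have "\<theta> * x - scgf a \<theta> \<le> max D1 D2" for \<theta>
  proof (cases "\<theta> \<ge> 0")
    case True thus ?thesis using D1[of \<theta>] by (simp add: algebra_simps)
  next
    case False
    hence "\<theta> * x \<le> 0" using x by (intro mult_nonpos_nonneg) auto
    thus ?thesis using D2[of \<theta>] by simp
  qed
  thus "\<exists>D. \<forall>\<theta>. \<theta> * x - scgf a \<theta> \<le> D" by blast
qed (rule scgf_has_derivative scgf_deriv_mono scgf_0 scgf_deriv_0_pos)+

end

section \<open>Limits of sums of independent Bernoulli variables\<close>

text \<open>An error proportional to \<open>x\<close> sums to \<open>\<epsilon>\<close> times the
  first power sum, whatever the number \<open>d\<close> of terms.\<close>

lemma bernoulli_sum_log_approx:
  fixes l :: "nat \<Rightarrow> real"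
  assumes l: "\<And>j. j < d \<Longrightarrow> 0 \<le> l j \<and> l j \<le> R" and t: "t > -1" "1 + t * R > 0"
    and q: "\<And>x. 0 \<le> x \<Longrightarrow> x \<le> R \<Longrightarrow> \<bar>ln (1 + t * x) - (\<Sum>k\<le>m. q k * x ^ Suc k)\<bar> \<le> \<epsilon> * x"
  shows "\<bar>ln (\<Prod>j<d. 1 + t * l j) - (\<Sum>k\<le>m. q k * (\<Sum>j<d. l j ^ Suc k))\<bar> \<le> \<epsilon> * (\<Sum>j<d. l j ^ Suc 0)"
proof -
  have pos: "1 + t * l j > 0" if j: "j < d" for j
  proof (cases "t \<ge> 0")
    case True thus ?thesis using l[OF j] by (simp add: add_pos_nonneg)
  next
    case False
    hence "t * R \<le> t * l j" using l[OF j] by (intro mult_left_mono_neg) auto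
    thus ?thesis using t by simp
  qed
  have "ln (\<Prod>j<d. 1 + t * l j) = (\<Sum>j<d. ln (1 + t * l j))"
    by (intro ln_prod) (auto dest!: pos)
  moreover have "(\<Sum>k\<le>m. q k * (\<Sum>j<d. l j ^ Suc k)) = (\<Sum>j<d. \<Sum>k\<le>m. q k * l j ^ Suc k)"
    unfolding sum_distrib_left by (rule sum.swap)
  ultimately have "\<bar>ln (\<Prod>j<d. 1 + t * l j) - (\<Sum>k\<le>m. q k * (\<Sum>j<d. l j ^ Suc k))\<bar> =
    \<bar>\<Sum>j<d. (ln (1 + t * l j) - (\<Sum>k\<le>m. q k * l j ^ Suc k))\<bar>" by (simp only: sum_subtractf)
  also have "\<dots> \<le> (\<Sum>j<d. \<bar>ln (1 + t * l j) - (\<Sum>k\<le>m. q k * l j ^ Suc k)\<bar>)" by (rule sum_abs)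
  also have "\<dots> \<le> (\<Sum>j<d. \<epsilon> * l j)" using l q by (intro sum_mono) auto
  finally show ?thesis by (simp add: sum_distrib_left)
qed

lemma polynomial_approx_log:
  fixes t R :: real
  assumes t: "t > -1" "1 + t * R > 0" and R: "R > 0" and \<epsilon>: "\<epsilon> > 0"
  obtains q m where "\<And>x. 0 \<le> x \<Longrightarrow> x \<le> R \<Longrightarrow> \<bar>ln (1 + t * x) - (\<Sum>k\<le>m. q k * x ^ Suc k)\<bar> \<le> \<epsilon> * x"
proof -
  have pos: "1 + t * x > 0" if "0 \<le> x" "x \<le> R" for x
  proof (cases "t \<ge> 0")
    case True thus ?thesis using that by (simp add: add_pos_nonneg)
  next
    case False
    hence "t * R \<le> t * x" using that by (intro mult_left_mono_neg) auto
    thus ?thesis using t by simp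
  qed
  \<comment> \<open>The removable singularity is filled with the derivative \<open>t\<close>;
    multiplying the approximating polynomial by \<open>x\<close> afterwards produces the exponents
    \<open>Suc k\<close> and the error \<open>\<epsilon> * x\<close>.\<close>
  define h where "h x = (if x = 0 then t else ln (1 + t * x) / x)" for x
  have "continuous (at x within {0..R}) h" if x: "x \<in> {0..R}" for x
  proof (cases "x = 0")
    case True
    have "((\<lambda>x. ln (1 + t * x)) has_real_derivative t) (at 0)"
      by (auto intro!: derivative_eq_intros)
    hence "((\<lambda>k. ln (1 + t * k) / k) \<longlongrightarrow> t) (at 0)" by (simp add: DERIV_def)
    hence "(h \<longlongrightarrow> t) (at 0)"
      by (rule Lim_transform_eventually) (auto simp: h_def eventually_at_filter)
    hence "isCont h 0" by (simp add: isCont_def h_def)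
    thus ?thesis using True by (simp add: continuous_at_imp_continuous_at_within)
  next
    case False
    have "isCont (\<lambda>x. ln (1 + t * x) / x) x" using pos[of x] x False by (intro continuous_intros) auto
    moreover have "\<forall>\<^sub>F y in nhds x. ln (1 + t * y) / y = h y"
      using t1_space_nhds[OF False] by eventually_elim (simp add: h_def)
    ultimately have "isCont h x" using isCont_cong[of "\<lambda>x. ln (1 + t * x) / x" h x] by blast
    thus ?thesis by (rule continuous_at_imp_continuous_at_within)
  qed
  hence cont: "continuous_on {0..R} h" by (simp add: continuous_on_eq_continuous_within)
  obtain g where g: "real_polynomial_function g" "\<And>x. x \<in> {0..R} \<Longrightarrow> \<bar>h x - g x\<bar> < \<epsilon>"
    using Stone_Weierstrass_real_polynomial_function[OF compact_Icc cont \<epsilon>] by auto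
  then obtain q m where gq: "g = (\<lambda>x. \<Sum>k\<le>m. q k * x ^ k)" unfolding real_polynomial_function_iff_sum by blast
  have "\<bar>ln (1 + t * x) - (\<Sum>k\<le>m. q k * x ^ Suc k)\<bar> \<le> \<epsilon> * x" if x: "0 \<le> x" "x \<le> R" for x
  proof (cases "x = 0")
    case False
    have "ln (1 + t * x) - (\<Sum>k\<le>m. q k * x ^ Suc k) = (h x - g x) * x"
    proof -
      have "g x * x = (\<Sum>k\<le>m. q k * x ^ Suc k)" unfolding gq sum_distrib_right by (simp add: mult_ac)
      moreover have "h x * x = ln (1 + t * x)" using False by (simp add: h_def)
      ultimately show ?thesis by (simp only: left_diff_distrib)
    qed
    hence "\<bar>ln (1 + t * x) - (\<Sum>k\<le>m. q k * x ^ Suc k)\<bar> = \<bar>h x - g x\<bar> * x" using x by (simp add: abs_mult)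
    also have "\<dots> \<le> \<epsilon> * x" using g(2)[of x] x by (intro mult_right_mono) auto
    finally show ?thesis .
  qed simp
  thus thesis by (rule that)
qed

text \<open>The variable \<open>N\<close> is a limit in law of sums of independent Bernoulli variables with parameters \<open>l i j\<close>,
  except that \<open>l i j \<le> 1\<close> is not known beforehand; \<open>cs\<close> and \<open>c\<close> are the factorial moments divided by \<open>n!\<close>.\<close>

locale bernoulli_limit = prob_space M for M :: "'w measure" +
  fixes N :: "'w \<Rightarrow> nat" and c :: "nat \<Rightarrow> real"
    and d :: "nat \<Rightarrow> nat" and l :: "nat \<Rightarrow> nat \<Rightarrow> real" and cs :: "nat \<Rightarrow> nat \<Rightarrow> real" and p :: "nat \<Rightarrow> real"
  assumes binomial_integrable: "\<And>n. integrable M (\<lambda>\<omega>. real (N \<omega> choose n))"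
    and binomial_moment: "\<And>n. (\<integral>\<omega>. real (N \<omega> choose n) \<partial>M) = c n"
    and N_meas: "N \<in> measurable M (count_space UNIV)"
    and l_nonneg: "\<And>i j. j < d i \<Longrightarrow> 0 \<le> l i j"
    and gen: "\<And>i t. (\<Prod>j<d i. 1 + t * l i j) = (\<Sum>n\<le>d i. cs i n * t ^ n)"
    and cs_nonneg: "\<And>i n. 0 \<le> cs i n" and cs_zero: "\<And>i n. n > d i \<Longrightarrow> cs i n = 0"
    and cs_lim: "\<And>n. (\<lambda>i. cs i n) \<longlonglongrightarrow> c n"
    and p_lim: "\<And>k. (\<lambda>i. \<Sum>j<d i. l i j ^ Suc k) \<longlonglongrightarrow> p k"
begin

lemma gen_suminf: "(\<Prod>j<d i. 1 + t * l i j) = (\<Sum>n. cs i n * t ^ n)"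
  unfolding gen by (rule suminf_finite[symmetric]) (auto simp: cs_zero not_le)

text \<open>Nonnegative coefficients are controlled by the generating function at any
  \<open>T > 0\<close>, which is at most the exponential of \<open>T\<close> times the first power
  sum; these sums converge, hence are bounded. A free \<open>T\<close> gives decay faster than any
  geometric rate.\<close>

lemma cs_bound:
  obtains C where "C \<ge> 0" "\<And>i n T. T > 0 \<Longrightarrow> cs i n \<le> exp (T * C) / T ^ n"
proof -
  obtain C where C: "\<And>i. \<bar>\<Sum>j<d i. l i j ^ Suc 0\<bar> \<le> C"
    using convergent_imp_Bseq[of "\<lambda>i. \<Sum>j<d i. l i j ^ Suc 0"] p_lim[of 0] unfolding convergent_def Bseq_def by auto
  have "cs i n \<le> exp (T * C) / T ^ n" if T: "T > 0" for i n T
  proof (cases "n \<le> d i")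
    case True
    have "cs i n * T ^ n \<le> (\<Sum>n\<le>d i. cs i n * T ^ n)"
      using T cs_nonneg True by (intro member_le_sum) auto
    also have "\<dots> = (\<Prod>j<d i. 1 + T * l i j)" by (rule gen[symmetric])
    also have "\<dots> \<le> (\<Prod>j<d i. exp (T * l i j))"
      using l_nonneg T by (intro prod_mono) (auto intro: add_nonneg_nonneg)
    also have "\<dots> = exp (T * (\<Sum>j<d i. l i j ^ Suc 0))" by (simp add: exp_sum sum_distrib_left)
    also have "\<dots> \<le> exp (T * C)" using C[of i] T by simp
    finally show ?thesis using T by (simp add: field_simps)
  qed (use cs_zero T in simp)
  moreover have "C \<ge> 0" using C[of 0] by linarith
  ultimately show thesis by (rule that[rotated])
qed

lemma c_nonneg: "0 \<le> c n"
  using cs_lim by (rule LIMSEQ_le_const) (auto simp: cs_nonneg)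

lemma c_bound:
  obtains C where "C \<ge> 0" "\<And>i n T. T > 0 \<Longrightarrow> cs i n \<le> exp (T * C) / T ^ n" "\<And>n T. T > 0 \<Longrightarrow> c n \<le> exp (T * C) / T ^ n"
proof -
  obtain C where C: "C \<ge> 0" "\<And>i n T. T > 0 \<Longrightarrow> cs i n \<le> exp (T * C) / T ^ n" by (rule cs_bound) blast
  moreover have "c n \<le> exp (T * C) / T ^ n" if "T > 0" for n T
    using cs_lim by (rule LIMSEQ_le_const2) (use C that in auto)
  ultimately show thesis by (rule that)
qed

text \<open>The choice \<open>T = 2 * |t| + 1\<close> makes the ratio \<open>|t| / T\<close> at most
  \<open>1/2\<close> and keeps \<open>T\<close> positive at \<open>t = 0\<close>.\<close>

lemma dominated_coeff:
  fixes x t C :: real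
  assumes "0 \<le> x" "\<And>T. T > 0 \<Longrightarrow> x \<le> exp (T * C) / T ^ n"
  shows "x * \<bar>t\<bar> ^ n \<le> exp ((2 * \<bar>t\<bar> + 1) * C) * (1 / 2) ^ n"
proof -
  let ?T = "2 * \<bar>t\<bar> + 1"
  have T: "?T > 0" by simp
  have "x * \<bar>t\<bar> ^ n \<le> exp (?T * C) / ?T ^ n * \<bar>t\<bar> ^ n" using assms(2)[OF T] by (intro mult_right_mono) auto
  also have "\<dots> = exp (?T * C) * (\<bar>t\<bar> / ?T) ^ n" by (simp add: power_divide)
  also have "\<dots> \<le> exp (?T * C) * (1 / 2) ^ n"
    by (intro mult_left_mono power_mono) (auto simp: field_simps)
  finally show ?thesis .
qed

lemma summable_c: "summable (\<lambda>n. c n * \<bar>t\<bar> ^ n)"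
proof -
  obtain C where C: "C \<ge> 0" "\<And>i n T. T > 0 \<Longrightarrow> cs i n \<le> exp (T * C) / T ^ n" "\<And>n T. T > 0 \<Longrightarrow> c n \<le> exp (T * C) / T ^ n" by (rule c_bound) blast
  show ?thesis
  proof (rule summable_comparison_test')
    show "summable (\<lambda>n. exp ((2 * \<bar>t\<bar> + 1) * C) * (1 / 2) ^ n :: real)" by (intro summable_mult summable_geometric) simp
    show "norm (c n * \<bar>t\<bar> ^ n) \<le> exp ((2 * \<bar>t\<bar> + 1) * C) * (1 / 2) ^ n" if "n \<ge> 0" for n
      using dominated_coeff[OF c_nonneg C(3), of n t] c_nonneg[of n] by (simp add: abs_mult)
  qed
qed

text \<open>The binomial theorem inside the expectation; \<open>summable_c\<close> permits
  exchanging the sum with the integral.\<close>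

lemma
  fixes t :: real
  shows pgf_integrable: "integrable M (\<lambda>\<omega>. (1 + t) ^ N \<omega>)"
    and pgf_eq: "(\<integral>\<omega>. (1 + t) ^ N \<omega> \<partial>M) = (\<Sum>n. c n * t ^ n)"
proof -
  have eq: "(1 + t) ^ N \<omega> = (\<Sum>n. real (N \<omega> choose n) * t ^ n)" for \<omega>
  proof -
    have "(1 + t) ^ N \<omega> = (\<Sum>n\<le>N \<omega>. real (N \<omega> choose n) * t ^ n)" using binomial_ring[of t 1 "N \<omega>"] by (simp add: add.commute)
    also have "\<dots> = (\<Sum>n. real (N \<omega> choose n) * t ^ n)"
      by (rule suminf_finite[symmetric]) (auto simp: binomial_eq_0 not_le)
    finally show ?thesis .
  qed
  have int: "integrable M (\<lambda>\<omega>. real (N \<omega> choose n) * t ^ n)" for n using binomial_integrable by simp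
  have ae: "AE \<omega> in M. summable (\<lambda>n. norm (real (N \<omega> choose n) * t ^ n))"
    by (intro AE_I2 summable_finite[of "{..N _}"]) (auto simp: binomial_eq_0 not_le)
  have "(\<integral>\<omega>. norm (real (N \<omega> choose n) * t ^ n) \<partial>M) = c n * \<bar>t\<bar> ^ n" for n
    by (simp add: abs_mult power_abs binomial_moment)
  hence sm: "summable (\<lambda>n. \<integral>\<omega>. norm (real (N \<omega> choose n) * t ^ n) \<partial>M)" using summable_c[of t] by simp
  show "integrable M (\<lambda>\<omega>. (1 + t) ^ N \<omega>)" unfolding eq by (rule integrable_suminf[OF int ae sm])
  show "(\<integral>\<omega>. (1 + t) ^ N \<omega> \<partial>M) = (\<Sum>n. c n * t ^ n)"
    unfolding eq integral_suminf[OF int ae sm] by (simp add: binomial_moment)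
qed

lemma pgf_pos:
  fixes t :: real
  assumes "t > -1"
  shows "(\<integral>\<omega>. (1 + t) ^ N \<omega> \<partial>M) > 0"
proof -
  have "(\<integral>\<omega>. (1 + t) ^ N \<omega> \<partial>M) \<ge> 0" using assms by (intro integral_nonneg_AE) auto
  moreover have "(\<integral>\<omega>. (1 + t) ^ N \<omega> \<partial>M) \<noteq> 0"
  proof
    assume "(\<integral>\<omega>. (1 + t) ^ N \<omega> \<partial>M) = 0"
    hence "AE \<omega> in M. (1 + t) ^ N \<omega> = 0"
      using integral_nonneg_eq_0_iff_AE[OF pgf_integrable[of t]] assms by simp
    hence "AE \<omega> in M. False" using assms by simp
    thus False by simp
  qed
  ultimately show ?thesis by simp
qed

text \<open>Uniformity in \<open>s\<close> is what excludes large parameters, since the zero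
  \<open>s = - 1 / l i j\<close> changes with \<open>i\<close> and \<open>j\<close>. The coefficient
  bounds give one summable majorant for Tannery's theorem.\<close>

lemma gen_uniform:
  assumes "\<epsilon> > 0"
  shows "\<forall>\<^sub>F i in sequentially. \<forall>s. \<bar>s\<bar> \<le> T \<longrightarrow> \<bar>(\<Prod>j<d i. 1 + s * l i j) - (\<Sum>n. c n * s ^ n)\<bar> < \<epsilon>"
proof (cases "T \<ge> 0")
  case T: True
  obtain C where C: "C \<ge> 0" "\<And>i n T. T > 0 \<Longrightarrow> cs i n \<le> exp (T * C) / T ^ n" "\<And>n T. T > 0 \<Longrightarrow> c n \<le> exp (T * C) / T ^ n" by (rule c_bound) blast
  let ?M = "\<lambda>n. 2 * (exp ((2 * \<bar>T\<bar> + 1) * C) * (1 / 2) ^ n)"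
  have le: "\<bar>cs i n - c n\<bar> * T ^ n \<le> ?M n" for i n
  proof -
    have "\<bar>cs i n - c n\<bar> \<le> cs i n + c n" using cs_nonneg[of i n] c_nonneg[of n] by simp
    hence "\<bar>cs i n - c n\<bar> * T ^ n \<le> (cs i n + c n) * T ^ n" using T by (intro mult_right_mono) auto
    also have "\<dots> \<le> ?M n" using dominated_coeff[OF cs_nonneg C(2), of i n T] dominated_coeff[OF c_nonneg C(3), of n T] T
      by (simp add: distrib_right)
    finally show ?thesis .
  qed
  have sM: "summable ?M" by (intro summable_mult summable_geometric) simp
  have sdiff: "summable (\<lambda>n. \<bar>cs i n - c n\<bar> * T ^ n)" for i
    by (rule summable_comparison_test'[OF sM]) (use le T in \<open>simp add: abs_mult\<close>)
  have "(\<lambda>i. \<Sum>n. \<bar>cs i n - c n\<bar> * T ^ n) \<longlonglongrightarrow> (\<Sum>n. \<bar>c n - c n\<bar> * T ^ n)"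
  proof (rule conjunct2[OF conjunct2[OF tannerys_theorem]])
    show "(\<lambda>i. \<bar>cs i n - c n\<bar> * T ^ n) \<longlonglongrightarrow> \<bar>c n - c n\<bar> * T ^ n" for n
      by (intro tendsto_mult tendsto_rabs tendsto_diff cs_lim tendsto_const)
    show "\<forall>\<^sub>F (n, i) in sequentially \<times>\<^sub>F sequentially. norm (\<bar>cs i n - c n\<bar> * T ^ n) \<le> ?M n"
      using le T by (intro always_eventually) (simp add: abs_mult)
    show "summable ?M" by (rule sM)
  qed simp
  hence "\<forall>\<^sub>F i in sequentially. (\<Sum>n. \<bar>cs i n - c n\<bar> * T ^ n) < \<epsilon>" using assms by (intro order_tendstoD) auto
  thus ?thesis
  proof (eventually_elim, intro allI impI)
    fix i s assume less: "(\<Sum>n. \<bar>cs i n - c n\<bar> * T ^ n) < \<epsilon>" and s: "\<bar>s\<bar> \<le> T"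
    have s1: "summable (\<lambda>n. cs i n * s ^ n)" by (rule summable_finite[of "{..d i}"]) (auto simp: cs_zero not_le)
    have s2: "summable (\<lambda>n. c n * s ^ n)"
      by (rule summable_norm_cancel) (use summable_c[of s] c_nonneg in \<open>simp add: abs_mult power_abs\<close>)
    have "(\<Prod>j<d i. 1 + s * l i j) - (\<Sum>n. c n * s ^ n) = (\<Sum>n. cs i n * s ^ n - c n * s ^ n)"
      unfolding gen_suminf by (rule suminf_diff[OF s1 s2])
    also have "\<bar>\<dots>\<bar> \<le> (\<Sum>n. \<bar>cs i n - c n\<bar> * T ^ n)"
    proof -
      have le': "norm (cs i n * s ^ n - c n * s ^ n) \<le> \<bar>cs i n - c n\<bar> * T ^ n" for n
        using s power_mono[OF s, of n] by (simp add: left_diff_distrib[symmetric] abs_mult power_abs mult_left_mono)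
      show ?thesis using norm_suminf_le[OF le' sdiff] unfolding real_norm_def .
    qed
    finally show "\<bar>(\<Prod>j<d i. 1 + s * l i j) - (\<Sum>n. c n * s ^ n)\<bar> < \<epsilon>" using less by simp
  qed
qed (auto intro!: always_eventually)

text \<open>A parameter \<open>l i j > R\<close> would be a zero of the generating function at \<open>t = - 1 / l i j\<close> in \<open>(-1, 0)\<close>.\<close>

lemma eventually_l_le:
  assumes R: "R > 1"
  shows "\<forall>\<^sub>F i in sequentially. \<forall>j<d i. l i j \<le> R"
proof -
  define t0 where "t0 = - 1 / R"
  have t0: "-1 < t0" "t0 < 0" using R by (auto simp: t0_def field_simps)
  define \<epsilon> where "\<epsilon> = (\<integral>\<omega>. (1 + t0) ^ N \<omega> \<partial>M)"
  have \<epsilon>: "\<epsilon> > 0" unfolding \<epsilon>_def by (rule pgf_pos) (use t0 in simp)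
  \<comment> \<open>The expectation of \<open>(1 + s) ^ N\<close> is nondecreasing in
    \<open>s\<close>, so its value at \<open>t0\<close> bounds it below on all of
    \<open>[t0, 0]\<close>.\<close>
  have lb: "\<epsilon> \<le> (\<Sum>n. c n * s ^ n)" if s: "t0 \<le> s" "s \<le> 0" for s
  proof -
    have "\<epsilon> \<le> (\<integral>\<omega>. (1 + s) ^ N \<omega> \<partial>M)" unfolding \<epsilon>_def
      using s t0 by (intro Bochner_Integration.integral_mono pgf_integrable power_mono) auto
    thus ?thesis by (simp only: pgf_eq)
  qed
  show ?thesis using gen_uniform[OF \<epsilon>, of 1]
  proof (eventually_elim, intro allI impI)
    fix i j assume U: "\<forall>s. \<bar>s\<bar> \<le> 1 \<longrightarrow> \<bar>(\<Prod>j<d i. 1 + s * l i j) - (\<Sum>n. c n * s ^ n)\<bar> < \<epsilon>" and j: "j < d i"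
    show "l i j \<le> R"
    proof (rule ccontr)
      assume "\<not> l i j \<le> R"
      hence lR: "l i j > R" by simp
      define s where "s = - 1 / l i j"
      have s: "t0 \<le> s" "s \<le> 0" "\<bar>s\<bar> \<le> 1" using lR R by (auto simp: s_def t0_def field_simps)
      have "1 + s * l i j = 0" using lR R by (simp add: s_def)
      hence "(\<Prod>j<d i. 1 + s * l i j) = 0" using j by (intro prod_zero) auto
      hence "\<bar>0 - (\<Sum>n. c n * s ^ n)\<bar> < \<epsilon>" using U[rule_format, OF s(3)] by (simp only:)
      thus False using lb[OF s(1,2)] by linarith
    qed
  qed
qed

text \<open>At a finite stage parameters slightly above \<open>1\<close> are possible, hence an
  \<open>R > 1\<close> at which \<open>1 + t * R\<close> is still positive. Both sides of the
  estimate for finite products then pass to the limit.\<close>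

theorem log_pgf_approx:
  assumes t: "t > -1" "1 + t * R > 0" and R: "R > 1"
    and q: "\<And>x. 0 \<le> x \<Longrightarrow> x \<le> R \<Longrightarrow> \<bar>ln (1 + t * x) - (\<Sum>k\<le>m. q k * x ^ Suc k)\<bar> \<le> \<epsilon> * x"
  shows "\<bar>ln (\<integral>\<omega>. (1 + t) ^ N \<omega> \<partial>M) - (\<Sum>k\<le>m. q k * p k)\<bar> \<le> \<epsilon> * p 0"
proof (rule tendsto_le[OF sequentially_bot])
  have "(\<lambda>i. \<Prod>j<d i. 1 + t * l i j) \<longlonglongrightarrow> (\<Sum>n. c n * t ^ n)"
    unfolding LIMSEQ_def dist_real_def
  proof (intro allI impI)
    fix r :: real assume "r > 0"
    from gen_uniform[OF this, of "\<bar>t\<bar>"] show "\<exists>no. \<forall>i\<ge>no. \<bar>(\<Prod>j<d i. 1 + t * l i j) - (\<Sum>n. c n * t ^ n)\<bar> < r"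
      unfolding eventually_sequentially by auto
  qed
  hence D: "(\<lambda>i. \<Prod>j<d i. 1 + t * l i j) \<longlonglongrightarrow> (\<integral>\<omega>. (1 + t) ^ N \<omega> \<partial>M)" by (simp only: pgf_eq)
  show "(\<lambda>i. \<bar>ln (\<Prod>j<d i. 1 + t * l i j) - (\<Sum>k\<le>m. q k * (\<Sum>j<d i. l i j ^ Suc k))\<bar>)
     \<longlonglongrightarrow> \<bar>ln (\<integral>\<omega>. (1 + t) ^ N \<omega> \<partial>M) - (\<Sum>k\<le>m. q k * p k)\<bar>"
    using pgf_pos[OF t(1)] by (intro tendsto_rabs tendsto_diff tendsto_ln D tendsto_sum tendsto_mult tendsto_const p_lim) auto
  show "(\<lambda>i. \<epsilon> * (\<Sum>j<d i. l i j ^ Suc 0)) \<longlonglongrightarrow> \<epsilon> * p 0" by (intro tendsto_mult tendsto_const p_lim)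
  show "\<forall>\<^sub>F i in sequentially. \<bar>ln (\<Prod>j<d i. 1 + t * l i j) - (\<Sum>k\<le>m. q k * (\<Sum>j<d i. l i j ^ Suc k))\<bar> \<le> \<epsilon> * (\<Sum>j<d i. l i j ^ Suc 0)"
    using eventually_l_le[OF R]
  proof eventually_elim
    case (elim i)
    show ?case by (rule bernoulli_sum_log_approx[OF _ t q]) (use elim l_nonneg in auto)
  qed
qed

end

section \<open>The counting statistics of the process\<close>

context bounded_region
begin

lemma spectral_approximation:
  obtains d l cs where "\<And>i j. j < d i \<Longrightarrow> 0 \<le> l i j"
    and "\<And>i t. (\<Prod>j<d i. 1 + t * l i j) = (\<Sum>n\<le>d i. cs i n * t ^ n :: real)"
    and "\<And>i n. 0 \<le> cs i n" and "\<And>i n. n > d i \<Longrightarrow> cs i n = 0"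
    and "\<And>n. (\<lambda>i. cs i n) \<longlonglongrightarrow> correlation_integral B (\<lambda>z. z) n"
    and "\<And>k. (\<lambda>i. \<Sum>j<d i. l i j ^ Suc k) \<longlonglongrightarrow> Re (\<integral>z. iter_kernel (restrict_kernel B) k z z \<partial>lborel)"
proof -
  obtain g where g: "\<And>i. g i \<in> borel_measurable borel" "\<And>i. finite (range (g i))"
    "\<And>i z. Im (g i z) > 1/2" "\<And>z. Im z \<ge> 1 \<Longrightarrow> (\<lambda>i. g i z) \<longlonglongrightarrow> z"
    by (rule simple_approximation_half_plane, rule that)
  \<comment> \<open>Dimension and eigenvalues are packed into one pair so that a single choice over
    \<open>i\<close> yields both.\<close>
  let ?P = "\<lambda>i dl. (\<forall>j<fst dl. 0 \<le> snd dl j) \<and>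
      (\<forall>t. (\<Prod>j<fst dl. 1 + t * snd dl j) = (\<Sum>n\<le>fst dl. correlation_integral B (g i) n * t ^ n)) \<and>
      (\<forall>n>fst dl. correlation_integral B (g i) n = 0) \<and>
      (\<forall>k. (\<integral>z. iter_kernel (step_kernel B (g i)) k z z \<partial>lborel) = of_real (\<Sum>j<fst dl. snd dl j ^ Suc k))"
  have "\<exists>dl. ?P i dl" for i
  proof -
    obtain d e where "inj_on e {..<d::nat}" "range (g i) = e ` {..<d}" by (rule simple_range_enum[OF g(2)[of i]], rule that)
    moreover have "Im (g i z) > 0" for z using g(3)[of i z] by simp
    ultimately interpret step_approximation B "g i" d e
      using B B_half B_fin g(1) by unfold_locales auto
    obtain l where "\<And>j. j < d \<Longrightarrow> 0 \<le> l j" "\<And>t. (\<Prod>j<d. 1 + t * l j) = (\<Sum>n\<le>d. correlation_integral B (g i) n * t ^ n)"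
      "\<And>k. (\<integral>z. iter_kernel (step_kernel B (g i)) k z z \<partial>lborel) = of_real (\<Sum>j<d. l j ^ Suc k)"
      by (rule step_spectrum, rule that)
    thus ?thesis using correlation_integral_eq_0 by (intro exI[of _ "(d, l)"]) simp
  qed
  hence "\<exists>dl. \<forall>i. ?P i (dl i)" by (intro choice allI)
  then obtain dl where dl': "\<forall>i. ?P i (dl i)" by (rule exE) (rule that)
  have dl: "?P i (dl i)" for i using dl' by (rule spec)
  show thesis
  proof (rule that[of "\<lambda>i. fst (dl i)" "\<lambda>i. snd (dl i)" "\<lambda>i. correlation_integral B (g i)"])
    show "0 \<le> correlation_integral B (g i) n" for i n
    proof (rule correlation_integral_nonneg)
      show "Im (g i z) > 0" for z using g(3)[of i z] by simp
    qed
    show "(\<lambda>i. correlation_integral B (g i) n) \<longlonglongrightarrow> correlation_integral B (\<lambda>z. z) n" for n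
      by (rule correlation_integral_tendsto[OF g(1,3,4)])
    show "(\<lambda>i. \<Sum>j<fst (dl i). snd (dl i) j ^ Suc k) \<longlonglongrightarrow> Re (\<integral>z. iter_kernel (restrict_kernel B) k z z \<partial>lborel)" for k
    proof -
      have "Re (\<integral>z. iter_kernel (step_kernel B (g i)) k z z \<partial>lborel) = (\<Sum>j<fst (dl i). snd (dl i) j ^ Suc k)" for i
        using dl[of i] by (simp only: Re_complex_of_real)
      thus ?thesis using tendsto_Re[OF step_trace_tendsto[OF g(1,3,4), of k]] by simp
    qed
    show "0 \<le> snd (dl i) j" if "j < fst (dl i)" for i j using dl[of i] that by simp
    show "(\<Prod>j<fst (dl i). 1 + t * snd (dl i) j) = (\<Sum>n\<le>fst (dl i). correlation_integral B (g i) n * t ^ n)" for i t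
      using dl[of i] by (elim conjE) (erule spec)
    show "correlation_integral B (g i) n = 0" if "n > fst (dl i)" for i n using dl[of i] that by simp
  qed
qed

lemma correlation_integrable:
  "integrable (Pi\<^sub>M {..<n} (\<lambda>_. halfplane_measure)) (\<lambda>x. (\<Prod>i<n. indicator B (x i)) * correlation n x)"
proof (rule Bochner_Integration.integrable_bound)
  let ?P = "Pi\<^sub>M {..<n} (\<lambda>_. halfplane_measure)"
  show "integrable ?P (\<lambda>x. (\<Prod>i<n. indicator B (x i)) * fact n :: real)" using prod_indicator_integrable by simp
  show "(\<lambda>x. (\<Prod>i<n. indicator B (x i)) * correlation n x) \<in> borel_measurable ?P"
    using correlation_measurable[of "\<lambda>z. z" n] by (intro borel_measurable_times prod_indicator_measurable) simp
  show "AE x in ?P. norm ((\<Prod>i<n. indicator B (x i)) * correlation n x) \<le> norm ((\<Prod>i<n. indicator B (x i)) * fact n :: real)"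
  proof (intro AE_I2)
    fix x show "norm ((\<Prod>i<n. indicator B (x i)) * correlation n x) \<le> norm ((\<Prod>i<n. indicator B (x i)) * fact n :: real)"
    proof (cases "\<forall>i<n. x i \<in> B")
      case True
      have "\<bar>correlation n x\<bar> \<le> fact n"
      proof (rule correlation_bound)
        fix i assume "i < n"
        hence "Im (x i) \<ge> 1" using True B_sub by auto
        thus "Im (x i) \<ge> 1 / 2" by simp
      qed
      thus ?thesis by (simp add: abs_mult prod_indicator_cases)
    next
      case False
      show ?thesis unfolding prod_indicator_cases if_not_P[OF False] by simp
    qed
  qed
qed

text \<open>The defining identity is tested with the indicator of \<open>B^n\<close>: the inner sum
  counts ordered \<open>n\<close>-tuples of distinct points in \<open>B\<close>, which is
  \<open>n!\<close> times a binomial coefficient. The compact \<open>C\<close> makes the count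
  finite and measurable.\<close>

lemma binomial_moments:
  assumes dp: "determinantal_process M halfplane_measure K_H Z"
    and C: "compact C" "C \<subseteq> {z. Im z > 0}" "B \<subseteq> C"
  shows "has_bochner_integral M (\<lambda>\<omega>. real (card (Z \<omega> \<inter> B) choose n)) (correlation_integral B (\<lambda>z. z) n)"
proof -
  let ?P = "Pi\<^sub>M {..<n} (\<lambda>_. halfplane_measure)"
  have space: "space halfplane_measure = {z. Im z > 0}" by (simp add: halfplane_measure_def space_restrict_space)
  have spp: "simple_point_process M halfplane_measure Z" using dp by (simp add: determinantal_process_def)
  have fin: "finite (Z \<omega> \<inter> B)" if "\<omega> \<in> space M" for \<omega>
  proof -
    have "finite (Z \<omega> \<inter> C)" using spp C that unfolding simple_point_process_def space by blast
    thus ?thesis by (rule finite_subset[rotated]) (use C in auto)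
  qed
  have meas: "(\<lambda>\<omega>. card (Z \<omega> \<inter> B)) \<in> measurable M (count_space UNIV)"
    using spp C sets_halfplane[OF B B_half] unfolding simple_point_process_def space by blast
  define f where "f x = ennreal (\<Prod>i<n. indicator B (x i))" for x :: "nat \<Rightarrow> complex"
  have f: "f \<in> borel_measurable ?P"
    unfolding f_def using prod_indicator_measurable by (intro measurable_compose[OF _ measurable_ennreal])
  have eq: "(\<integral>\<^sup>+\<omega>. (\<integral>\<^sup>+x. f x \<partial>count_space {x \<in> {..<n} \<rightarrow>\<^sub>E Z \<omega>. inj_on x {..<n}}) \<partial>M) =
     (\<integral>\<^sup>+x. f x * ennreal (correlation n x) \<partial>?P)"
    using dp f unfolding determinantal_process_def correlation_def by blast
  have "(\<integral>\<^sup>+x. f x \<partial>count_space {x \<in> {..<n} \<rightarrow>\<^sub>E Z \<omega>. inj_on x {..<n}}) = ennreal (fact n * real (card (Z \<omega> \<inter> B) choose n))"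
    if \<omega>: "\<omega> \<in> space M" for \<omega>
  proof -
    let ?A = "{x \<in> {..<n} \<rightarrow>\<^sub>E Z \<omega>. inj_on x {..<n}}"
    let ?S = "{x \<in> {..<n} \<rightarrow>\<^sub>E Z \<omega> \<inter> B. inj_on x {..<n}}"
    have sub: "?S \<subseteq> ?A" by (auto simp: PiE_def)
    have "(\<integral>\<^sup>+x. f x \<partial>count_space ?A) = (\<integral>\<^sup>+x. indicator ?S x \<partial>count_space ?A)"
    proof (rule nn_integral_cong)
      fix x assume "x \<in> space (count_space ?A)"
      hence "x \<in> ?A" by simp
      hence "x \<in> ?S \<longleftrightarrow> (\<forall>i<n. x i \<in> B)" by (auto simp: PiE_def Pi_def)
      thus "f x = indicator ?S x" unfolding f_def prod_indicator_cases by (simp add: indicator_def)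
    qed
    also have "\<dots> = emeasure (count_space ?A) ?S" using sub by (intro nn_integral_indicator) simp
    also have "\<dots> = of_nat (card ?S)"
    proof -
      have "finite ?S" by (rule finite_subset[of _ "{..<n} \<rightarrow>\<^sub>E Z \<omega> \<inter> B"]) (auto intro!: finite_PiE fin[OF \<omega>])
      thus ?thesis using sub by (simp add: emeasure_count_space)
    qed
    also have "card ?S = fact n * (card (Z \<omega> \<inter> B) choose n)" by (rule card_inj_PiE[OF fin[OF \<omega>]])
    finally show ?thesis by (simp add: ennreal_of_nat_eq_real_of_nat)
  qed
  hence lhs: "(\<integral>\<^sup>+\<omega>. (\<integral>\<^sup>+x. f x \<partial>count_space {x \<in> {..<n} \<rightarrow>\<^sub>E Z \<omega>. inj_on x {..<n}}) \<partial>M) =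
    (\<integral>\<^sup>+\<omega>. ennreal (fact n * real (card (Z \<omega> \<inter> B) choose n)) \<partial>M)" by (rule nn_integral_cong)
  have nonneg: "0 \<le> (\<Prod>i<n. indicator B (x i)) * correlation n x" for x
  proof (cases "\<forall>i<n. x i \<in> B")
    case True
    thus ?thesis using B_half by (intro mult_nonneg_nonneg correlation_nonneg) (auto simp: prod_indicator_cases)
  next
    case False
    show ?thesis unfolding prod_indicator_cases if_not_P[OF False] by simp
  qed
  have "(\<integral>\<^sup>+x. f x * ennreal (correlation n x) \<partial>?P) = (\<integral>\<^sup>+x. ennreal ((\<Prod>i<n. indicator B (x i)) * correlation n x) \<partial>?P)"
    by (intro nn_integral_cong) (simp add: f_def prod_indicator_cases)
  also have "\<dots> = ennreal (\<integral>x. (\<Prod>i<n. indicator B (x i)) * correlation n x \<partial>?P)"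
    by (rule nn_integral_eq_integral[OF correlation_integrable]) (simp add: nonneg)
  finally have "(\<integral>\<^sup>+x. f x * ennreal (correlation n x) \<partial>?P) = ennreal (fact n * correlation_integral B (\<lambda>z. z) n)"
    by (simp add: correlation_integral_def)
  with eq lhs have "(\<integral>\<^sup>+\<omega>. ennreal (fact n * real (card (Z \<omega> \<inter> B) choose n)) \<partial>M) = ennreal (fact n * correlation_integral B (\<lambda>z. z) n)"
    by simp
  moreover have "(\<lambda>\<omega>. fact n * real (card (Z \<omega> \<inter> B) choose n)) \<in> borel_measurable M"
    by (rule measurable_compose[OF meas]) simp
  moreover have "0 \<le> correlation_integral B (\<lambda>z. z) n" by (rule correlation_integral_nonneg) (use B_half in auto)
  ultimately have "has_bochner_integral M (\<lambda>\<omega>. fact n * real (card (Z \<omega> \<inter> B) choose n)) (fact n * correlation_integral B (\<lambda>z. z) n)"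
    by (intro has_bochner_integral_nn_integral) auto
  from has_bochner_integral_mult_right[OF this, of "1 / fact n"] show ?thesis by simp
qed

end

section \<open>The cumulant generating function of the counts in windows\<close>

lemma window_compact: "compact (window a r s)"
proof -
  have "window a r s = cbox (Complex r 1) (Complex s a)" by (auto simp: window_def in_cbox_complex_iff)
  thus ?thesis by simp
qed

lemma window_bounded_region: "bounded_region (window a r s)"
proof
  have "window a r s = cbox (Complex r 1) (Complex s a)" by (auto simp: window_def in_cbox_complex_iff)
  thus "emeasure lborel (window a r s) < \<infinity>" by (simp only: emeasure_lborel_cbox_finite)
qed (auto simp: window_def)

lemma N_pts_eq_card: "N_pts Z a L \<omega> = card (Z \<omega> \<inter> window a 0 L)"
  by (auto simp: N_pts_def window_def intro!: arg_cong[where f = card])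

lemma N_pts_bernoulli_limit:
  assumes dp: "determinantal_process M halfplane_measure K_H Z"
  obtains c d l cs where "bernoulli_limit M (N_pts Z a L) c d l cs (\<lambda>k. Re (trace_power a L k))"
proof -
  interpret bounded_region "window a 0 L" by (rule window_bounded_region)
  have spp: "simple_point_process M halfplane_measure Z" using dp by (simp add: determinantal_process_def)
  interpret prob_space M using spp by (simp add: simple_point_process_def)
  have sub: "window a 0 L \<subseteq> {z. Im z > 0}" by (rule B_half)
  note moments = binomial_moments[OF dp window_compact sub subset_refl]
  have meas: "(\<lambda>\<omega>. card (Z \<omega> \<inter> window a 0 L)) \<in> measurable M (count_space UNIV)"
    using spp window_compact[of a 0 L] sub sets_halfplane[OF B B_half]
    unfolding simple_point_process_def halfplane_measure_def by (simp add: space_restrict_space) blast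
  obtain d l cs where *: "\<And>i j. j < d i \<Longrightarrow> 0 \<le> l i j"
    "\<And>i t. (\<Prod>j<d i. 1 + t * l i j) = (\<Sum>n\<le>d i. cs i n * t ^ n :: real)"
    "\<And>i n. 0 \<le> cs i n" "\<And>i n. n > d i \<Longrightarrow> cs i n = 0"
    "\<And>n. (\<lambda>i. cs i n) \<longlonglongrightarrow> correlation_integral (window a 0 L) (\<lambda>z. z) n"
    "\<And>k. (\<lambda>i. \<Sum>j<d i. l i j ^ Suc k) \<longlonglongrightarrow> Re (\<integral>z. iter_kernel (restrict_kernel (window a 0 L)) k z z \<partial>lborel)"
    by (rule spectral_approximation, rule that)
  have eqN: "N_pts Z a L = (\<lambda>\<omega>. card (Z \<omega> \<inter> window a 0 L))" by (simp add: fun_eq_iff N_pts_eq_card)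
  show thesis
  proof (rule that, unfold_locales)
    show "integrable M (\<lambda>\<omega>. real (N_pts Z a L \<omega> choose n))" for n
      unfolding eqN by (rule integrable.intros[OF moments])
    show "(\<integral>\<omega>. real (N_pts Z a L \<omega> choose n) \<partial>M) = correlation_integral (window a 0 L) (\<lambda>z. z) n" for n
      unfolding eqN by (rule has_bochner_integral_integral_eq[OF moments])
    show "N_pts Z a L \<in> measurable M (count_space UNIV)" unfolding eqN by (rule meas)
    show "(\<lambda>i. \<Sum>j<d i. l i j ^ Suc k) \<longlonglongrightarrow> Re (trace_power a L k)" for k
      unfolding trace_power_def by (rule *(6))
  qed (fact *)+
qed

text \<open>The counterpart of \<open>log_pgf_approx\<close> for the limit: the same
  \<open>q\<close> and \<open>\<epsilon>\<close> serve both, so both logarithms are compared with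
  the same combination of traces, before and after the limit in \<open>L\<close>.\<close>

lemma scgf_polynomial_approx:
  assumes a: "a > 1"
    and q: "\<And>x. 0 \<le> x \<Longrightarrow> x \<le> 1 \<Longrightarrow> \<bar>ln (1 + (exp \<theta> - 1) * x) - (\<Sum>k\<le>m. q k * x ^ Suc k)\<bar> \<le> \<epsilon> * x"
  shows "\<bar>scgf a \<theta> - (\<Sum>k\<le>m. q k * symbol_moment a k)\<bar> \<le> \<epsilon> * symbol_moment a 0"
proof -
  have int: "set_integrable lborel {0<..} (\<lambda>\<xi>. q k * symbol a \<xi> ^ Suc k)" for k
    by (intro set_integrable_mult_right symbol_power_integrable a)
  have ints: "set_integrable lborel {0<..} (\<lambda>\<xi>. \<Sum>k\<le>m. q k * symbol a \<xi> ^ Suc k)"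
    using int unfolding set_integrable_def scaleR_sum_right by (intro Bochner_Integration.integrable_sum) auto
  have "(LBINT \<xi>:{0<..}. (\<Sum>k\<le>m. q k * symbol a \<xi> ^ Suc k)) = (\<Sum>k\<le>m. LBINT \<xi>:{0<..}. q k * symbol a \<xi> ^ Suc k)"
    using int unfolding set_lebesgue_integral_def set_integrable_def scaleR_sum_right
    by (intro Bochner_Integration.integral_sum) auto
  hence S: "(\<Sum>k\<le>m. q k * symbol_moment a k) = (1 / (2 * pi)) * (LBINT \<xi>:{0<..}. (\<Sum>k\<le>m. q k * symbol a \<xi> ^ Suc k))"
    unfolding symbol_moment_def sum_distrib_left by (simp add: mult_ac sum_divide_distrib del: power_Suc)
  let ?g = "\<lambda>\<xi>. ln (1 + (exp \<theta> - 1) * symbol a \<xi>)"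
  let ?h = "\<lambda>\<xi>. \<Sum>k\<le>m. q k * symbol a \<xi> ^ Suc k"
  have "scgf a \<theta> - (\<Sum>k\<le>m. q k * symbol_moment a k) = (1 / (2 * pi)) * (LBINT \<xi>:{0<..}. ?g \<xi> - ?h \<xi>)"
    unfolding S scgf_def set_integral_diff(2)[OF log_tilted_integrable[OF a] ints] by (simp only: right_diff_distrib)
  also have "\<bar>\<dots>\<bar> = (1 / (2 * pi)) * \<bar>LBINT \<xi>:{0<..}. ?g \<xi> - ?h \<xi>\<bar>" by (simp add: abs_mult)
  also have "\<dots> \<le> (1 / (2 * pi)) * (LBINT \<xi>:{0<..}. \<epsilon> * symbol a \<xi>)"
  proof (rule mult_left_mono)
    have "\<bar>LBINT \<xi>:{0<..}. ?g \<xi> - ?h \<xi>\<bar> \<le> (LBINT \<xi>:{0<..}. \<bar>?g \<xi> - ?h \<xi>\<bar>)"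
      using set_integral_norm_bound[OF set_integral_diff(1)[OF log_tilted_integrable[OF a] ints]] by simp
    also have "\<dots> \<le> (LBINT \<xi>:{0<..}. \<epsilon> * symbol a \<xi>)"
    proof (rule set_integral_mono)
      show "set_integrable lborel {0<..} (\<lambda>\<xi>. \<bar>?g \<xi> - ?h \<xi>\<bar>)"
        by (intro set_integrable_abs set_integral_diff(1) log_tilted_integrable a ints)
      show "set_integrable lborel {0<..} (\<lambda>\<xi>. \<epsilon> * symbol a \<xi>)"
        by (intro set_integrable_mult_right symbol_integrable a)
      show "\<bar>?g \<xi> - ?h \<xi>\<bar> \<le> \<epsilon> * symbol a \<xi>" if "\<xi> \<in> {0<..}" for \<xi>
        using q[of "symbol a \<xi>"] symbol_bounds[OF a, of \<xi>] that by simp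
    qed
    finally show "\<bar>LBINT \<xi>:{0<..}. ?g \<xi> - ?h \<xi>\<bar> \<le> (LBINT \<xi>:{0<..}. \<epsilon> * symbol a \<xi>)" .
  qed simp
  also have "\<dots> = \<epsilon> * symbol_moment a 0" by (simp add: symbol_moment_def)
  finally show ?thesis .
qed

theorem scgf_limit:
  assumes dp: "determinantal_process M halfplane_measure K_H Z" and a: "a > 1"
  shows "((\<lambda>L. 1 / L * ln (\<integral>\<omega>. exp (\<theta> * real (N_pts Z a L \<omega>)) \<partial>M)) \<longlongrightarrow> scgf a \<theta>) at_top"
proof (rule tendstoI)
  fix r :: real assume r: "r > 0"
  define t where "t = exp \<theta> - 1"
  have t: "t > -1" by (simp add: t_def)
  obtain R where R: "R > 1" "1 + t * R > 0"
  proof (cases "t \<ge> 0")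
    case True
    show ?thesis by (rule that[of 2]) (use True in auto)
  next
    case False
    define u where "u = 1 / t"
    \<comment> \<open>The midpoint between \<open>1\<close> and the singularity
      \<open>- 1 / t\<close> of the logarithm.\<close>
    define R0 where "R0 = (1 - u) / 2"
    have "1 < - u" using False t by (simp add: u_def field_simps)
    hence R0: "1 < R0" by (simp add: R0_def field_simps)
    have "t * R0 = t / 2 - 1 / 2" using False by (simp add: R0_def u_def field_simps)
    hence "0 < 1 + t * R0" using t by linarith
    thus ?thesis by (rule that[OF R0])
  qed
  define \<mu> where "\<mu> = symbol_moment a 0"
  have \<mu>: "\<mu> \<ge> 0" unfolding \<mu>_def symbol_moment_def set_lebesgue_integral_def
    using symbol_bounds(1)[OF a] by (intro mult_nonneg_nonneg integral_nonneg_AE AE_I2) (auto simp: indicator_def less_imp_le)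
  \<comment> \<open>For large \<open>L\<close> the trace per unit length is below
    \<open>\<mu> + 1\<close>; with this \<open>\<epsilon>\<close> both polynomial errors are at most
    \<open>r / 4\<close>, and the convergence of finitely many traces costs another
    \<open>r / 4\<close>.\<close>
  define \<epsilon> where "\<epsilon> = r / (4 * (\<mu> + 1))"
  have \<epsilon>: "\<epsilon> > 0" using r \<mu> by (simp add: \<epsilon>_def)
  have \<epsilon>\<mu>: "\<epsilon> * (\<mu> + 1) = r / 4"
  proof -
    have "\<mu> + 1 \<noteq> 0" using \<mu> by linarith
    thus ?thesis unfolding \<epsilon>_def by (simp only: divide_divide_eq_left[symmetric] nonzero_eq_divide_eq times_divide_eq_left) simp
  qed
  obtain q m where q: "\<And>x. 0 \<le> x \<Longrightarrow> x \<le> R \<Longrightarrow> \<bar>ln (1 + t * x) - (\<Sum>k\<le>m. q k * x ^ Suc k)\<bar> \<le> \<epsilon> * x"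
    by (rule polynomial_approx_log[OF t R(2) _ \<epsilon>], use R(1) in simp, rule that)
  let ?S = "\<Sum>k\<le>m. q k * symbol_moment a k"
  let ?T = "\<lambda>L k. Re (trace_power a L k) / L"
  have sc: "\<bar>scgf a \<theta> - ?S\<bar> \<le> \<epsilon> * \<mu>"
    unfolding \<mu>_def by (rule scgf_polynomial_approx[OF a]) (use q R in \<open>auto simp: t_def\<close>)
  have T: "((\<lambda>L. ?T L k) \<longlongrightarrow> symbol_moment a k) at_top" for k
    using tendsto_Re[OF trace_power_limit[OF a, of k]] by simp
  have "((\<lambda>L. \<Sum>k\<le>m. q k * ?T L k) \<longlongrightarrow> ?S) at_top"
    by (intro tendsto_sum tendsto_mult tendsto_const T)
  from tendstoD[OF this, of "r / 4"] r have e1: "\<forall>\<^sub>F L in at_top. \<bar>(\<Sum>k\<le>m. q k * ?T L k) - ?S\<bar> < r / 4"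
    by (simp add: dist_real_def)
  have e2: "\<forall>\<^sub>F L in at_top. ?T L 0 < \<mu> + 1"
    using T[of 0] unfolding \<mu>_def by (rule order_tendstoD) simp
  show "\<forall>\<^sub>F L in at_top. dist (1 / L * ln (\<integral>\<omega>. exp (\<theta> * real (N_pts Z a L \<omega>)) \<partial>M)) (scgf a \<theta>) < r"
    using e1 e2 eventually_gt_at_top[of "0::real"]
  proof eventually_elim
    case (elim L)
    note L = elim(3)
    obtain c d l cs where "bernoulli_limit M (N_pts Z a L) c d l cs (\<lambda>k. Re (trace_power a L k))"
      by (rule N_pts_bernoulli_limit[OF dp])
    then interpret bernoulli_limit M "N_pts Z a L" c d l cs "\<lambda>k. Re (trace_power a L k)" .
    let ?E = "ln (\<integral>\<omega>. (1 + t) ^ N_pts Z a L \<omega> \<partial>M)"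
    have E: "(\<integral>\<omega>. exp (\<theta> * real (N_pts Z a L \<omega>)) \<partial>M) = (\<integral>\<omega>. (1 + t) ^ N_pts Z a L \<omega> \<partial>M)"
      by (simp add: t_def exp_of_nat2_mult)
    have "\<bar>?E - (\<Sum>k\<le>m. q k * Re (trace_power a L k))\<bar> \<le> \<epsilon> * Re (trace_power a L 0)"
      by (rule log_pgf_approx[OF t R(2) R(1) q])
    hence "\<bar>?E - (\<Sum>k\<le>m. q k * Re (trace_power a L k))\<bar> / L \<le> \<epsilon> * Re (trace_power a L 0) / L"
      using L by (intro divide_right_mono) auto
    moreover have "\<bar>?E - (\<Sum>k\<le>m. q k * Re (trace_power a L k))\<bar> / L = \<bar>1 / L * ?E - (\<Sum>k\<le>m. q k * ?T L k)\<bar>"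
    proof -
      have "(?E - (\<Sum>k\<le>m. q k * Re (trace_power a L k))) / L = 1 / L * ?E - (\<Sum>k\<le>m. q k * ?T L k)"
        by (simp add: diff_divide_distrib sum_divide_distrib)
      thus ?thesis using L abs_divide[of "?E - (\<Sum>k\<le>m. q k * Re (trace_power a L k))" L] by simp
    qed
    ultimately have "\<bar>1 / L * ?E - (\<Sum>k\<le>m. q k * ?T L k)\<bar> \<le> \<epsilon> * ?T L 0" by simp
    also have "\<dots> \<le> \<epsilon> * (\<mu> + 1)" using elim(2) \<epsilon> by (intro mult_left_mono) auto
    finally have "\<bar>1 / L * ?E - (\<Sum>k\<le>m. q k * ?T L k)\<bar> \<le> r / 4" by (simp only: \<epsilon>\<mu>)
    moreover have "\<epsilon> * \<mu> \<le> r / 4" using \<epsilon>\<mu> \<epsilon> by (simp add: distrib_left)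
    ultimately have "\<bar>1 / L * ?E - scgf a \<theta>\<bar> < r" using elim(1) sc r by linarith
    thus ?case by (simp only: dist_real_def E)
  qed
qed

theorem theorem1p2:
  fixes M :: "'w measure" and Z :: "'w \<Rightarrow> complex set" and a :: real
  assumes "determinantal_process M halfplane_measure K_H Z"
    and "a > 1"
  shows "good_rate_function {0..} (J_rate M Z a) \<and>
    large_deviations_principle M (\<lambda>L \<omega>. real (N_pts Z a L \<omega>) / L) {0..} (J_rate M Z a) \<and>
    strictly_convex_on {0<..} (J_rate M Z a) \<and>
    (\<forall>x\<ge>0. J_rate M Z a x = 0 \<longleftrightarrow> x = 1 / (4 * pi) * (1 - 1 / a))"
proof -
  interpret legendre "scgf a" "scgf_deriv a" by (rule scgf_legendre[OF assms(2)])
  interpret prob_space M using assms(1) by (simp add: determinantal_process_def simple_point_process_def)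
  \<comment> \<open>\<open>Lim\<close> denotes the limit only once convergence is known, which
    \<open>scgf_limit\<close> provides; hence \<open>J_rate\<close> is the abstract \<open>J\<close>
    for \<open>scgf a\<close>.\<close>
  have "Lambda M Z a \<theta> = scgf a \<theta>" for \<theta>
    unfolding Lambda_def by (rule tendsto_Lim[OF _ scgf_limit[OF assms]]) simp
  hence J: "J_rate M Z a = J" by (simp add: fun_eq_iff J_rate_def J_def)
  interpret gaertner_ellis "scgf a" "scgf_deriv a" M "\<lambda>L \<omega>. real (N_pts Z a L \<omega>)"
  proof
    fix \<theta> L :: real
    obtain c d l cs where "bernoulli_limit M (N_pts Z a L) c d l cs (\<lambda>k. Re (trace_power a L k))"
      by (rule N_pts_bernoulli_limit[OF assms(1)])
    then interpret bernoulli_limit M "N_pts Z a L" c d l cs "\<lambda>k. Re (trace_power a L k)" .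
    show "integrable M (\<lambda>\<omega>. exp (\<theta> * real (N_pts Z a L \<omega>)))"
      using pgf_integrable[of "exp \<theta> - 1"] by (simp add: exp_of_nat2_mult)
    show "(\<lambda>\<omega>. real (N_pts Z a L \<omega>)) \<in> borel_measurable M"
      by (rule measurable_compose[OF N_meas]) simp
  qed (simp, rule scgf_limit[OF assms])
  show ?thesis
    unfolding J using J_good_rate_function ldp J_strictly_convex J_zero_iff scgf_deriv_0[OF assms(2)] by simp
qed

end
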